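(* Let $A\in\mathbb Z^{\ell\times(\ell+k)}$ be a Type I$_k$ weight matrix with $V_A$ a faithful $\mathbb T^\ell$-module, write $\alpha=\alpha(A)$, $\beta=\beta(A)$, $m_j=m_j(A)$, and let $B=(-\alpha,\beta,\dots,\beta)\in\mathbb Z^{1\times(k+1)}$, with coordinates $w_1,\dots,w_{k+1}$ on $V_B$. Let $\kappa=\sqrt{\beta^{-\beta}\prod_{j=1}^\ell m_j^{m_j}}$. The assignment $r_i\mapsto\frac{m_i}{\beta}w_1\overline{w_1}$ ($1\le i\le\ell$), $p_{i,j}\mapsto w_{i+1}\overline{w_{j+1}}$ ($1\le i,j\le k$), $q_{\boldsymbol s}\mapsto\kappa\,w_1^{\beta}\prod_{j=1}^kw_{j+1}^{s_j}$, $\overline{q_{\boldsymbol s}}\mapsto\kappa\,\overline{w_1}^{\beta}\prod_{j=1}^k\overline{w_{j+1}}^{s_j}$ extends to a well-defined algebra homomorphism $\Phi$ from the algebra of $\mathbb T^\ell$-invariant complex polynomials in $z_j,\overline{z_j}$ on $V_A$ to the algebra of $\mathbb T^1$-invariant complex polynomials in $w_j,\overline{w_j}$ on $V_B$; $\Phi$ induces an isomorphism $\mathbb R[M_0(A)]\to\mathbb R[M_0(B)]$ and a graded regular symplectomorphism between $M_0(A)$ and $M_0(B)$.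
   Context: For $A=(a_{ij})\in\mathbb Z^{\ell\times n}$, $V_A=\mathbb C^n$ with $\mathbb T^\ell$ acting by $z_j\mapsto\prod_it_i^{a_{ij}}z_j$ (faithful = effective), symplectic form $\operatorname{Im}$ of standard hermitian product, moment map $J_i=\tfrac12\sum_ja_{ij}z_j\overline{z_j}$, shell $Z_A=J_A^{-1}(0)$, $M_0(A)=Z_A/\mathbb T^\ell$; $\mathcal C^\infty(M_0(A))=\mathcal C^\infty(V_A)^{\mathbb T^\ell}/(\text{invariant smooth functions vanishing on }Z_A)$ with Poisson bracket induced by $\{z_i,\overline{z_j}\}=-2\sqrt{-1}\delta_{ij}$; $\mathbb R[M_0(A)]=\mathbb R[V_A]^{\mathbb T^\ell}/(\text{invariant polynomials vanishing on }Z_A)$ graded by degree. A graded regular symplectomorphism $F:M_0\to M_0'$ is a homeomorphism with $F^*:\mathcal C^\infty(M_0')\to\mathcal C^\infty(M_0)$ a Poisson isomorphism restricting to a degree-preserving isomorphism $\mathbb R[M_0']\to\mathbb R[M_0]$. Type I$_k$: $A=[D,\boldsymbol n,\dots,\boldsymbol n]$ with $D=\operatorname{diag}(-a_1,\dots,-a_\ell)$, $a_i>0$, $\boldsymbol n=(n_1,\dots,n_\ell)^T$, $n_i>0$. $\alpha(A)=\operatorname{lcm}(a_i)$, $m_i(A)=n_i\alpha(A)/a_i$, $\beta(A)=\sum m_i(A)$. Invariants on $V_A$: $r_i=z_i\overline{z_i}$, $p_{i,j}=z_{\ell+i}\overline{z_{\ell+j}}$, $q_{\boldsymbol s}=\prod_{i\le\ell}z_i^{m_i}\prod_{i\le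 k}z_{\ell+i}^{s_i}$ and $\overline{q_{\boldsymbol s}}$ for $\boldsymbol s\in\mathbb Z_{\ge0}^k$ with $\sum s_i=\alpha$; these generate the invariant algebra. *)

theory Defs
  imports "HOL-Analysis.Analysis"
begin

text \<open>A weight matrix is W :: 'l => 'c => int (rows indexed by the finite type 'l,
  columns by the finite type 'c); V_W = complex^'c.\<close>

definition torus :: "('l \<Rightarrow> complex) \<Rightarrow> bool" where
  "torus t \<longleftrightarrow> (\<forall>i. cmod (t i) = 1)"

definition tact :: "('l::finite \<Rightarrow> 'c::finite \<Rightarrow> int) \<Rightarrow> ('l \<Rightarrow> complex) \<Rightarrow> complex^'c \<Rightarrow> complex^'c" where
  "tact W t z = (\<chi> j. (\<Prod>i\<in>UNIV. t i powi W i j) * z $ j)"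

definition faithful :: "('l::finite \<Rightarrow> 'c::finite \<Rightarrow> int) \<Rightarrow> bool" where
  "faithful W \<longleftrightarrow> (\<forall>t. torus t \<and> (\<forall>j. (\<Prod>i\<in>UNIV. t i powi W i j) = 1) \<longrightarrow> (\<forall>i. t i = 1))"

definition moment :: "('l::finite \<Rightarrow> 'c::finite \<Rightarrow> int) \<Rightarrow> complex^'c \<Rightarrow> 'l \<Rightarrow> real" where
  "moment W z i = (1/2) * (\<Sum>j\<in>UNIV. real_of_int (W i j) * (cmod (z $ j))\<^sup>2)"

definition Zset :: "('l::finite \<Rightarrow> 'c::finite \<Rightarrow> int) \<Rightarrow> (complex^'c) set" where
  "Zset W = {z. \<forall>i. moment W z i = 0}"

definition invariant :: "('l::finite \<Rightarrow> 'c::finite \<Rightarrow> int) \<Rightarrow> (complex^'c \<Rightarrow> 'b) \<Rightarrow> bool" where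
  "invariant W f \<longleftrightarrow> (\<forall>t z. torus t \<longrightarrow> f (tact W t z) = f z)"

definition orbit :: "('l::finite \<Rightarrow> 'c::finite \<Rightarrow> int) \<Rightarrow> complex^'c \<Rightarrow> (complex^'c) set" where
  "orbit W z = {tact W t z | t. torus t}"

definition M0 :: "('l::finite \<Rightarrow> 'c::finite \<Rightarrow> int) \<Rightarrow> (complex^'c) set set" where
  "M0 W = orbit W ` Zset W"

definition M0top :: "('l::finite \<Rightarrow> 'c::finite \<Rightarrow> int) \<Rightarrow> (complex^'c) set topology" where
  "M0top W = topology (\<lambda>U. U \<subseteq> M0 W \<and> openin (top_of_set (Zset W)) (\<Union>U))"

inductive polyfun :: "(complex^'c \<Rightarrow> complex) \<Rightarrow> bool" where
  pconst: "polyfun (\<lambda>_. c)"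
| pvar: "polyfun (\<lambda>z. z $ j)"
| pcvar: "polyfun (\<lambda>z. cnj (z $ j))"
| padd: "polyfun f \<Longrightarrow> polyfun g \<Longrightarrow> polyfun (\<lambda>z. f z + g z)"
| pmult: "polyfun f \<Longrightarrow> polyfun g \<Longrightarrow> polyfun (\<lambda>z. f z * g z)"

inductive hpoly :: "nat \<Rightarrow> (complex^'c \<Rightarrow> complex) \<Rightarrow> bool" where
  hconst: "hpoly 0 (\<lambda>_. c)"
| hvar: "hpoly 1 (\<lambda>z. z $ j)"
| hcvar: "hpoly 1 (\<lambda>z. cnj (z $ j))"
| hadd: "hpoly d f \<Longrightarrow> hpoly d g \<Longrightarrow> hpoly d (\<lambda>z. f z + g z)"
| hmult: "hpoly d f \<Longrightarrow> hpoly e g \<Longrightarrow> hpoly (d + e) (\<lambda>z. f z * g z)"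

text \<open>Real invariant polynomials R[V_W]^T: invariant polynomials in z, conj z taking
  real values (= invariant polynomials with real coefficients in the real coordinates).\<close>
definition real_inv_poly :: "('l::finite \<Rightarrow> 'c::finite \<Rightarrow> int) \<Rightarrow> (complex^'c \<Rightarrow> complex) \<Rightarrow> bool" where
  "real_inv_poly W f \<longleftrightarrow> polyfun f \<and> invariant W f \<and> (\<forall>z. Im (f z) = 0)"

primrec Ck :: "nat \<Rightarrow> ('a::real_normed_vector \<Rightarrow> real) \<Rightarrow> bool" where
  "Ck 0 f = continuous_on UNIV f"
| "Ck (Suc k) f = ((\<forall>x. f differentiable (at x)) \<and>
                   (\<forall>v. Ck k (\<lambda>x. frechet_derivative f (at x) v)))"

definition smooth :: "('a::real_normed_vector \<Rightarrow> real) \<Rightarrow> bool" where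
  "smooth f \<longleftrightarrow> (\<forall>k. Ck k f)"

text \<open>Poisson bracket on V = complex^'c with z_j = x_j + i y_j, normalised so that
  {z_i, conj z_j} = -2 i delta_ij, i.e. {f,g} = sum_j (f_x g_y - f_y g_x).\<close>
definition pbracket :: "(complex^'c::finite \<Rightarrow> real) \<Rightarrow> (complex^'c \<Rightarrow> real) \<Rightarrow> complex^'c \<Rightarrow> real" where
  "pbracket f g z = (\<Sum>j\<in>UNIV.
      frechet_derivative f (at z) (axis j 1) * frechet_derivative g (at z) (axis j \<i>)
    - frechet_derivative f (at z) (axis j \<i>) * frechet_derivative g (at z) (axis j 1))"

text \<open>C^infty(M_0(W)) = C^infty(V)^T / (invariant functions vanishing on Z_W), realised as
  functions on orbits admitting a smooth invariant lift.\<close>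
definition lifts :: "('l::finite \<Rightarrow> 'c::finite \<Rightarrow> int) \<Rightarrow> (complex^'c \<Rightarrow> 'b) \<Rightarrow> ((complex^'c) set \<Rightarrow> 'b) \<Rightarrow> bool" where
  "lifts W f \<phi> \<longleftrightarrow> (\<forall>z\<in>Zset W. \<phi> (orbit W z) = f z)"

definition smooth_M0 :: "('l::finite \<Rightarrow> 'c::finite \<Rightarrow> int) \<Rightarrow> ((complex^'c) set \<Rightarrow> real) \<Rightarrow> bool" where
  "smooth_M0 W \<phi> \<longleftrightarrow> (\<exists>f. smooth f \<and> invariant W f \<and> lifts W f \<phi>)"

definition Rpoly_M0 :: "('l::finite \<Rightarrow> 'c::finite \<Rightarrow> int) \<Rightarrow> ((complex^'c) set \<Rightarrow> real) \<Rightarrow> bool" where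
  "Rpoly_M0 W \<phi> \<longleftrightarrow> (\<exists>f. real_inv_poly W f \<and> lifts W (\<lambda>z. Re (f z)) \<phi>)"

definition Rpoly_deg_M0 :: "('l::finite \<Rightarrow> 'c::finite \<Rightarrow> int) \<Rightarrow> nat \<Rightarrow> ((complex^'c) set \<Rightarrow> real) \<Rightarrow> bool" where
  "Rpoly_deg_M0 W d \<phi> \<longleftrightarrow> (\<exists>f. real_inv_poly W f \<and> hpoly d f \<and> lifts W (\<lambda>z. Re (f z)) \<phi>)"

text \<open>Graded regular symplectomorphism F : M_0(W) -> M_0(W').  F^* phi = phi o F.
  The Poisson condition: the bracket of lifts of F^* phi, F^* psi agrees with the
  pull-back of the bracket of lifts of phi, psi.\<close>
definition graded_regular_symplecto ::
  "('l::finite \<Rightarrow> 'c::finite \<Rightarrow> int) \<Rightarrow> ('l2::finite \<Rightarrow> 'c2::finite \<Rightarrow> int)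
   \<Rightarrow> ((complex^'c) set \<Rightarrow> (complex^'c2) set) \<Rightarrow> bool" where
  "graded_regular_symplecto W W' F \<longleftrightarrow>
     homeomorphic_map (M0top W) (M0top W') F
   \<and> (\<forall>\<phi>. smooth_M0 W' \<phi> \<longleftrightarrow> smooth_M0 W (\<phi> \<circ> F))
   \<and> (\<forall>f g f' g'. smooth f \<and> invariant W' f \<and> smooth g \<and> invariant W' g
        \<and> smooth f' \<and> invariant W f' \<and> smooth g' \<and> invariant W g'
        \<and> (\<forall>z\<in>Zset W. \<forall>w\<in>Zset W'. F (orbit W z) = orbit W' w \<longrightarrow> f' z = f w \<and> g' z = g w)
        \<longrightarrow> (\<forall>z\<in>Zset W. \<forall>w\<in>Zset W'. F (orbit W z) = orbit W' w \<longrightarrow>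
               pbracket f' g' z = pbracket f g w))
   \<and> (\<forall>\<phi>. Rpoly_M0 W' \<phi> \<longleftrightarrow> Rpoly_M0 W (\<phi> \<circ> F))
   \<and> (\<forall>d \<phi>. Rpoly_deg_M0 W' d \<phi> \<longleftrightarrow> Rpoly_deg_M0 W d (\<phi> \<circ> F))"

text \<open>Columns of A indexed by 'l + 'k: Inl i is column i (1 <= i <= l), Inr j is column l+j.\<close>
definition typeI :: "('l \<Rightarrow> nat) \<Rightarrow> ('l \<Rightarrow> nat) \<Rightarrow> 'l \<Rightarrow> ('l + 'k) \<Rightarrow> int" where
  "typeI a n i c = (case c of Inl i' \<Rightarrow> (if i = i' then - int (a i) else 0) | Inr _ \<Rightarrow> int (n i))"

definition alphaA :: "('l::finite \<Rightarrow> nat) \<Rightarrow> nat" where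
  "alphaA a = Lcm (range a)"

definition mA :: "('l::finite \<Rightarrow> nat) \<Rightarrow> ('l \<Rightarrow> nat) \<Rightarrow> 'l \<Rightarrow> nat" where
  "mA a n i = n i * alphaA a div a i"

definition betaA :: "('l::finite \<Rightarrow> nat) \<Rightarrow> ('l \<Rightarrow> nat) \<Rightarrow> nat" where
  "betaA a n = (\<Sum>i\<in>UNIV. mA a n i)"

text \<open>B = (-alpha, beta, ..., beta), columns indexed by unit + 'k: Inl () is w_1, Inr j is w_{j+1}.\<close>
definition weightB :: "nat \<Rightarrow> nat \<Rightarrow> unit \<Rightarrow> (unit + 'k) \<Rightarrow> int" where
  "weightB al be u c = (case c of Inl _ \<Rightarrow> - int al | Inr _ \<Rightarrow> int be)"

definition kappaA :: "('l::finite \<Rightarrow> nat) \<Rightarrow> ('l \<Rightarrow> nat) \<Rightarrow> real" where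
  "kappaA a n = sqrt (inverse (real (betaA a n) ^ betaA a n) * (\<Prod>j\<in>UNIV. real (mA a n j) ^ mA a n j))"

end

(*
  The linear map L w = (c_1 w_1, ..., c_l w_1, w_2, ..., w_{k+1}) with c_i = sqrt (m_i / beta)
  is a unitary embedding of V_B into V_A. It is equivariant along t |-> (t^(alpha/a_i))_i and
  satisfies L -` Z_A = Z_B, and Phi is composition with L. Every torus orbit in Z_A meets L (Z_B),
  and since alpha and beta are coprime it does so in a single orbit, so L induces the
  homeomorphism. It is Poisson because the derivatives of invariants along the orthogonal
  complement of the image annihilate a Lagrangian subspace, and because the bracket of
  invariants at a point of Z_B depends only on their restrictions to Z_B.

  The substantial point is that every smooth invariant g on V_B has a smooth invariant lift to
  V_A. The homogeneous Taylor polynomials of g at 0 are invariant, hence lift, and Borel's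
  theorem sums the lifts; this reduces to a g that is flat at 0. Such a g is evaluated at
  w_1 = (prod_i (z_i / c_i)^(m_i))^(1/beta), multiplied by a cutoff to a conic neighbourhood of
  Z_A. The result is smooth because these functions, together with their products with
  1/z_i and 1/|w_1|^2, form a class closed under derivatives and vanish to infinite order
  where some z_i = 0.
*)
theory Submission
  imports Defs
begin

text \<open>Since \<open>L\<close> runs from V_B to V_A, the induced map of quotients runs from B to
  A and its pull-back is \<Phi>; what has to be earned is lifting from V_B to V_A. The natural
  formula for a lift contains a \<beta>-th root of a monomial, which is multivalued and singular
  where some z_i with i \<le> l vanishes. Multivaluedness is harmless: \<alpha> and \<beta> being
  coprime, the circle contains elements that multiply w_1 by any prescribed \<beta>-th root of unity
  and fix the other coordinates. The singular hyperplanes meet the shell only at the origin, because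
  on Z_A the vanishing of one such z_i forces z = 0; this is why a conic cutoff together with
  flatness at the single point 0 suffices. The part that is not flat is handled by algebra instead:
  coprimality makes every monomial of weight zero on V_B the restriction of an explicit invariant
  monomial on V_A. Throughout, smoothness is obtained by exhibiting a class of functions closed
  under differentiation, so that no formula for a higher derivative is ever needed.\<close>

section \<open>Calculus of directional derivatives and smooth functions\<close>

definition dd :: "'a::real_normed_vector \<Rightarrow> ('a \<Rightarrow> real) \<Rightarrow> 'a \<Rightarrow> real" where
  "dd v f x = frechet_derivative f (at x) v"

lemma dd_eqI: "(f has_derivative f') (at x) \<Longrightarrow> dd v f x = f' v"
  unfolding dd_def by (metis frechet_derivative_at)

lemma has_derivative_ddI:
  assumes "f differentiable (at x)"
  shows "(f has_derivative (\<lambda>v. dd v f x)) (at x)"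
  using assms by (simp add: dd_def frechet_derivative_works)

lemma Ck_Suc_dd: "Ck (Suc k) f \<longleftrightarrow> (\<forall>x. f differentiable (at x)) \<and> (\<forall>v. Ck k (dd v f))"
  by (simp add: dd_def[abs_def])

declare Ck.simps(2) [simp del]

lemma Ck_continuous: "Ck k f \<Longrightarrow> continuous_on UNIV f"
  by (cases k)
    (auto simp: Ck_Suc_dd intro: continuous_at_imp_continuous_on differentiable_imp_continuous_within)

lemma Ck_pred: "Ck (Suc k) f \<Longrightarrow> Ck k f"
proof (induction k arbitrary: f)
  case 0
  then show ?case by (simp add: Ck_continuous)
next
  case (Suc k)
  then show ?case by (metis Ck_Suc_dd)
qed

lemma smooth_differentiable: "smooth f \<Longrightarrow> f differentiable (at x)"
  unfolding smooth_def by (metis Ck_Suc_dd)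

lemma smooth_dd: "smooth f \<Longrightarrow> smooth (dd v f)"
  unfolding smooth_def by (metis Ck_Suc_dd)

lemma smooth_has_derivative: "smooth f \<Longrightarrow> (f has_derivative (\<lambda>v. dd v f x)) (at x)"
  by (simp add: has_derivative_ddI smooth_differentiable)

lemma smooth_continuous: "smooth f \<Longrightarrow> continuous_on S f"
  unfolding smooth_def by (meson Ck_continuous continuous_on_subset top_greatest)

text \<open>Smoothness is a greatest fixed point: in any class closed under directional derivatives,
  induction on the order of differentiability, applied to all members at once, shows every member
  smooth.\<close>

lemma smooth_coinduct:
  assumes "S f"
    and step: "\<And>f. S f \<Longrightarrow> \<exists>f'. (\<forall>x. (f has_derivative (\<lambda>v. f' v x)) (at x)) \<and> (\<forall>v. S (f' v))"
  shows "smooth f"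
proof -
  have "Ck k f" if "S f" for k f
    using that
  proof (induction k arbitrary: f)
    case 0
    then show ?case
      using step[OF 0] has_derivative_continuous
      unfolding Ck.simps(1) by (intro continuous_at_imp_continuous_on) blast
  next
    case (Suc k)
    obtain f' where f': "\<And>x. (f has_derivative (\<lambda>v. f' v x)) (at x)" "\<And>v. S (f' v)"
      using step[OF Suc.prems] by blast
    have "dd v f = f' v" for v
      using dd_eqI[OF f'(1)] by auto
    then show ?case
      unfolding Ck_Suc_dd using f' Suc.IH by (auto simp: differentiable_def)
  qed
  then show ?thesis
    using assms(1) by (simp add: smooth_def)
qed

lemma smooth_const [simp]: "smooth (\<lambda>_. c)"
  by (rule smooth_coinduct[where S = "\<lambda>f. \<exists>c. f = (\<lambda>_. c)"]) (auto intro!: exI[of _ "\<lambda>_ _. 0"])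

lemma Ck_const [simp]: "Ck k (\<lambda>_. c)"
  using smooth_const unfolding smooth_def by blast

lemma smooth_bounded_linear:
  assumes "bounded_linear f"
  shows "smooth f"
proof (rule smooth_coinduct[where S = "\<lambda>f. bounded_linear f \<or> (\<exists>c. f = (\<lambda>_. c))"])
  fix f :: "'a \<Rightarrow> real"
  assume "bounded_linear f \<or> (\<exists>c. f = (\<lambda>_. c))"
  then show "\<exists>f'. (\<forall>x. (f has_derivative (\<lambda>v. f' v x)) (at x)) \<and>
      (\<forall>v. bounded_linear (f' v) \<or> (\<exists>c. f' v = (\<lambda>_. c)))"
  proof
    assume "bounded_linear f"
    then show ?thesis
      by (intro exI[of _ "\<lambda>v _. f v"]) (auto intro: bounded_linear_imp_has_derivative)
  qed (auto intro!: exI[of _ "\<lambda>_ _. 0"])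
qed (use assms in simp)

lemma Ck_add: "Ck k f \<Longrightarrow> Ck k g \<Longrightarrow> Ck k (\<lambda>x. f x + g x)"
proof (induction k arbitrary: f g)
  case 0
  then show ?case by (auto intro: continuous_on_add)
next
  case (Suc k)
  have "dd v (\<lambda>x. f x + g x) = (\<lambda>x. dd v f x + dd v g x)" for v
    using Suc.prems
    by (intro ext dd_eqI has_derivative_add has_derivative_ddI) (auto simp: Ck_Suc_dd)
  then show ?case
    using Suc by (auto simp: Ck_Suc_dd)
qed

lemma Ck_mult: "Ck k f \<Longrightarrow> Ck k g \<Longrightarrow> Ck k (\<lambda>x. f x * g x)"
proof (induction k arbitrary: f g)
  case 0
  then show ?case by (auto intro: continuous_on_mult)
next
  case (Suc k)
  have "dd v (\<lambda>x. f x * g x) = (\<lambda>x. f x * dd v g x + dd v f x * g x)" for v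
    using Suc.prems
    by (intro ext dd_eqI has_derivative_mult has_derivative_ddI) (auto simp: Ck_Suc_dd)
  moreover have "Ck k f" "Ck k g"
    using Suc.prems Ck_pred by blast+
  ultimately show ?case
    using Suc by (auto simp: Ck_Suc_dd intro!: Ck_add)
qed

lemma Ck_uminus: "Ck k f \<Longrightarrow> Ck k (\<lambda>x. - f x)"
  using Ck_mult[of k "\<lambda>_. -1" f] by simp

lemma smooth_add: "smooth f \<Longrightarrow> smooth g \<Longrightarrow> smooth (\<lambda>x. f x + g x)"
  by (simp add: smooth_def Ck_add)

lemma smooth_mult: "smooth f \<Longrightarrow> smooth g \<Longrightarrow> smooth (\<lambda>x. f x * g x)"
  by (simp add: smooth_def Ck_mult)

lemma smooth_uminus: "smooth f \<Longrightarrow> smooth (\<lambda>x. - f x)"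
  by (simp add: smooth_def Ck_uminus)

lemma smooth_diff: "smooth f \<Longrightarrow> smooth g \<Longrightarrow> smooth (\<lambda>x. f x - g x)"
  using smooth_add[of f "\<lambda>x. - g x"] smooth_uminus[of g] by simp

lemma smooth_sum: "(\<And>i. i \<in> I \<Longrightarrow> smooth (f i)) \<Longrightarrow> smooth (\<lambda>x. \<Sum>i\<in>I. f i x)"
  by (induction I rule: infinite_finite_induct) (auto intro: smooth_add)

text \<open>A variant for classes that are closed under partial derivatives but not under linear
  combinations, such as the termwise derivatives of a series, whose bounds are available for basis
  directions only.\<close>

lemma smooth_coinduct_Basis:
  fixes f :: "'a::euclidean_space \<Rightarrow> real"
  assumes "S f"
    and step: "\<And>f. S f \<Longrightarrow> \<exists>f'. (\<forall>x. (f has_derivative (\<lambda>v. \<Sum>b\<in>Basis. (v \<bullet> b) * f' b x)) (at x))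
      \<and> (\<forall>b\<in>Basis. S (f' b))"
  shows "smooth f"
proof -
  have sum: "Ck k (\<lambda>x. \<Sum>b\<in>B. c b * g b x)" if "finite B" "\<forall>b\<in>B. Ck k (g b)"
    for B :: "'a set" and k c and g :: "'a \<Rightarrow> 'a \<Rightarrow> real"
    using that
  proof (induction B)
    case empty
    show ?case by simp
  next
    case (insert b B)
    then show ?case by (simp add: Ck_add Ck_mult)
  qed
  have "Ck k f" if "S f" for k f
    using that
  proof (induction k arbitrary: f)
    case 0
    then show ?case
      using step[OF 0] has_derivative_continuous
      unfolding Ck.simps(1) by (intro continuous_at_imp_continuous_on) blast
  next
    case (Suc k)
    obtain f' where f': "\<And>x. (f has_derivative (\<lambda>v. \<Sum>b\<in>Basis. (v \<bullet> b) * f' b x)) (at x)"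
      "\<And>b. b \<in> Basis \<Longrightarrow> S (f' b)"
      using step[OF Suc.prems] by blast
    have "dd v f = (\<lambda>x. \<Sum>b\<in>Basis. (v \<bullet> b) * f' b x)" for v
      using dd_eqI[OF f'(1)] by auto
    then show ?case
      unfolding Ck_Suc_dd using f' Suc.IH by (auto simp: differentiable_def intro!: sum)
  qed
  then show ?thesis
    using assms(1) by (simp add: smooth_def)
qed

lemma smooth_compose_linear:
  fixes f :: "'b::real_normed_vector \<Rightarrow> real"
  assumes "smooth f" "bounded_linear L"
  shows "smooth (\<lambda>x. f (L x))"
proof (rule smooth_coinduct[where S = "\<lambda>g. \<exists>f. smooth f \<and> g = (\<lambda>x. f (L x))"])
  fix g assume "\<exists>f. smooth f \<and> g = (\<lambda>x. f (L x))"
  then obtain f where f: "smooth f" "g = (\<lambda>x. f (L x))" by blast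
  show "\<exists>f'. (\<forall>x. (g has_derivative (\<lambda>v. f' v x)) (at x)) \<and>
      (\<forall>v. \<exists>f. smooth f \<and> f' v = (\<lambda>x. f (L x)))"
  proof (intro exI[of _ "\<lambda>v x. dd (L v) f (L x)"] conjI allI)
    fix x
    show "(g has_derivative (\<lambda>v. dd (L v) f (L x))) (at x)"
      unfolding f(2)
      using has_derivative_compose[OF bounded_linear_imp_has_derivative[OF assms(2)]
          smooth_has_derivative[OF f(1)]] by simp
  qed (use f(1) smooth_dd in blast)
qed (use assms(1) in blast)

lemma dd_compose_linear:
  assumes "f differentiable (at (L x))" "bounded_linear L"
  shows "dd v (\<lambda>x. f (L x)) x = dd (L v) f (L x)"
  by (rule dd_eqI)
    (use has_derivative_compose[OF bounded_linear_imp_has_derivative[OF assms(2)]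
        has_derivative_ddI[OF assms(1)]] in simp)

lemma Ck_compose:
  fixes b :: "real \<Rightarrow> real"
  shows "smooth b \<Longrightarrow> Ck k f \<Longrightarrow> Ck k (\<lambda>x. b (f x))"
proof (induction k arbitrary: b)
  case 0
  then show ?case
    using continuous_on_compose2[OF smooth_continuous[OF 0(1), of UNIV]] by auto
next
  case (Suc k)
  have d: "((\<lambda>x. b (f x)) has_derivative (\<lambda>v. dd v f x * dd 1 b (f x))) (at x)" for x
  proof -
    have "((\<lambda>x. b (f x)) has_derivative (\<lambda>v. dd (dd v f x) b (f x))) (at x)"
      using has_derivative_compose[OF has_derivative_ddI smooth_has_derivative[OF Suc.prems(1)]] Suc.prems(2)
      by (auto simp: Ck_Suc_dd)
    moreover have "dd (dd v f x) b (f x) = dd v f x * dd 1 b (f x)" for v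
      using linear_scale[OF has_derivative_linear[OF smooth_has_derivative[OF Suc.prems(1)]], of "dd v f x" 1 "f x"]
      by simp
    ultimately show ?thesis by simp
  qed
  have "dd v (\<lambda>x. b (f x)) = (\<lambda>x. dd v f x * dd 1 b (f x))" for v
    using dd_eqI[OF d] by auto
  then show ?case
    using d Suc Ck_pred[of k f] by (auto simp: Ck_Suc_dd differentiable_def smooth_dd intro!: Ck_mult)
qed

lemma smooth_compose:
  fixes b :: "real \<Rightarrow> real"
  shows "smooth b \<Longrightarrow> smooth f \<Longrightarrow> smooth (\<lambda>x. b (f x))"
  by (simp add: smooth_def Ck_compose)

lemma Ck_inverse:
  shows "\<forall>x. f x \<noteq> 0 \<Longrightarrow> Ck k f \<Longrightarrow> Ck k (\<lambda>x. inverse (f x))"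
proof (induction k)
  case 0
  then show ?case by (auto intro: continuous_on_inverse)
next
  case (Suc k)
  have d: "((\<lambda>x. inverse (f x)) has_derivative (\<lambda>v. - (inverse (f x) * dd v f x * inverse (f x)))) (at x)" for x
    by (rule has_derivative_compose[OF has_derivative_ddI has_derivative_inverse', simplified])
      (use Suc.prems in \<open>auto simp: Ck_Suc_dd\<close>)
  have "dd v (\<lambda>x. inverse (f x)) = (\<lambda>x. - (inverse (f x) * dd v f x * inverse (f x)))" for v
    using dd_eqI[OF d] by auto
  then show ?case
    using d Suc Ck_pred[of k f] by (auto simp: Ck_Suc_dd differentiable_def intro!: Ck_uminus Ck_mult)
qed

lemma smooth_inverse: "\<forall>x. f x \<noteq> 0 \<Longrightarrow> smooth f \<Longrightarrow> smooth (\<lambda>x. inverse (f x))"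
  by (simp add: smooth_def Ck_inverse)

lemma dd_linear: "smooth f \<Longrightarrow> linear (\<lambda>v. dd v f x)"
  using has_derivative_linear[OF smooth_has_derivative] .

lemma dd_Basis_expand:
  fixes f :: "'a::euclidean_space \<Rightarrow> real"
  assumes "smooth f"
  shows "dd v f x = (\<Sum>b\<in>Basis. (v \<bullet> b) * dd b f x)"
proof -
  have "dd v f x = dd (\<Sum>b\<in>Basis. (v \<bullet> b) *\<^sub>R b) f x"
    by (simp add: euclidean_representation)
  also have "\<dots> = (\<Sum>b\<in>Basis. (v \<bullet> b) * dd b f x)"
    using linear_sum[OF dd_linear[OF assms], of "\<lambda>b. (v \<bullet> b) *\<^sub>R b" Basis x]
      linear_scale[OF dd_linear[OF assms]] by simp
  finally show ?thesis .
qed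

text \<open>A quadratic bound is all that is needed to glue by zero; it is used at 0 for
  \<open>expinv\<close>, at 0 for flat functions and on the hyperplanes for lifted
  functions.\<close>

lemma has_derivative_at_flat:
  fixes f :: "'a::real_normed_vector \<Rightarrow> 'b::real_normed_vector"
  assumes "f x = 0" "r > 0"
    and bd: "\<And>y. dist y x < r \<Longrightarrow> norm (f y) \<le> C * (dist y x)\<^sup>2"
  shows "(f has_derivative (\<lambda>_. 0)) (at x)"
proof (rule has_derivativeI_sandwich[of r])
  show "bounded_linear (\<lambda>_. 0)" by simp
  show "((\<lambda>y. C * norm (y - x)) \<longlongrightarrow> 0) (at x)"
    by (auto intro!: tendsto_eq_intros)
  show "norm (f y - f x - 0) / norm (y - x) \<le> C * norm (y - x)"
    if "y \<noteq> x" "dist y x < r" for y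
    using bd[OF that(2)] that(1) assms(1)
    by (simp add: dist_norm field_simps power2_eq_square)
qed (use assms in auto)

subsection \<open>Cutoff functions\<close>

text \<open>The exponent \<open>N\<close> is there so that the span of these functions is closed
  under differentiation.\<close>

definition expinv :: "nat \<Rightarrow> real \<Rightarrow> real" where
  "expinv N x = (if x \<le> 0 then 0 else exp (- (1 / x)) / x ^ N)"

text \<open>Raise \<open>1 + u \<le> exp u\<close> with \<open>u = 1 / ((N + 2) * x)\<close> to the
  power \<open>N + 2\<close>; dividing by \<open>x ^ N\<close> leaves exactly the quadratic factor
  that differentiability at 0 asks for.\<close>

lemma expinv_bound: "\<bar>expinv N x\<bar> \<le> real (N + 2) ^ (N + 2) * x\<^sup>2"
proof (cases "x \<le> 0")
  case False
  let ?n = "N + 2"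
  have "(1 / (real ?n * x)) ^ ?n \<le> exp (1 / (real ?n * x)) ^ ?n"
  proof (intro power_mono)
    show "1 / (real ?n * x) \<le> exp (1 / (real ?n * x))"
      using exp_ge_add_one_self[of "1 / (real ?n * x)"] by linarith
  qed (use False in auto)
  also have "\<dots> = exp (1 / x)"
    unfolding exp_of_nat_mult[symmetric] using False by simp
  finally have le: "1 / (real ?n * x) ^ ?n \<le> exp (1 / x)"
    by (simp only: power_one_over)
  have pos: "0 < (real ?n * x) ^ ?n"
    using False by (intro zero_less_power mult_pos_pos) auto
  have "exp (- (1 / x)) \<le> (real ?n * x) ^ ?n"
    using le_imp_inverse_le[OF le] pos by (simp only: exp_minus) simp
  then have "exp (- (1 / x)) / x ^ N \<le> (real ?n * x) ^ ?n / x ^ N"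
    using False by (intro divide_right_mono) auto
  also have "\<dots> = real ?n ^ ?n * x\<^sup>2"
    using False unfolding power_mult_distrib power_add[of x] by simp
  finally show ?thesis using False by (simp add: expinv_def)
qed (simp add: expinv_def)

lemma has_derivative_expinv:
  "(expinv N has_derivative (\<lambda>v. v * (expinv (N + 2) x - real N * expinv (N + 1) x))) (at x)"
proof (cases x "0::real" rule: linorder_cases)
  case less
  have "((\<lambda>_. 0) has_derivative (\<lambda>v. v * (expinv (N + 2) x - real N * expinv (N + 1) x))) (at x)"
    using less by (simp add: expinv_def)
  then show ?thesis
    by (rule has_derivative_transform_within_open[of _ _ _ _ "{..<0}"])
      (use less in \<open>auto simp: expinv_def\<close>)
next
  case equal
  have "(expinv N has_derivative (\<lambda>_. 0)) (at x)"
    by (rule has_derivative_at_flat[of _ _ 1 "real (N + 2) ^ (N + 2)"])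
      (use expinv_bound[of N] equal in \<open>auto simp: dist_real_def expinv_def\<close>)
  then show ?thesis
    using equal by (simp add: expinv_def)
next
  case greater
  have e: "expinv K x = exp (- inverse x) * inverse x ^ K" for K
    using greater by (simp add: expinv_def divide_inverse power_inverse)
  have "((\<lambda>x. exp (- inverse x) * inverse x ^ N) has_real_derivative
      expinv (N + 2) x - real N * expinv (N + 1) x) (at x)"
  proof -
    have "((\<lambda>x. inverse x ^ N) has_real_derivative
        real N * (- (inverse x ^ Suc (Suc 0)) * inverse x ^ (N - Suc 0))) (at x)"
      using greater by (intro DERIV_power DERIV_inverse) simp
    moreover have "((\<lambda>x. exp (- inverse x)) has_real_derivative exp (- inverse x) * inverse x ^ 2) (at x)"
      using greater by (auto intro!: derivative_eq_intros simp: power2_eq_square)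
    ultimately show ?thesis
      by (rule DERIV_cong[OF DERIV_mult[rotated]])
        (cases N; simp add: e power2_eq_square algebra_simps)
  qed
  then have "((\<lambda>x. exp (- (1 / x)) / x ^ N) has_derivative
      (\<lambda>v. v * (expinv (N + 2) x - real N * expinv (N + 1) x))) (at x)"
    by (simp add: has_field_derivative_def divide_inverse power_inverse mult.commute[of _ "_ - _"])
  then show ?thesis
    by (rule has_derivative_transform_within_open[of _ _ _ _ "{0<..}"])
      (use greater in \<open>auto simp: expinv_def\<close>)
qed

inductive expinv_span :: "(real \<Rightarrow> real) \<Rightarrow> bool" where
  base: "expinv_span (expinv N)"
| scale: "expinv_span f \<Longrightarrow> expinv_span (\<lambda>x. c * f x)"
| add: "expinv_span f \<Longrightarrow> expinv_span g \<Longrightarrow> expinv_span (\<lambda>x. f x + g x)"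

lemma smooth_expinv: "smooth (expinv N)"
proof (rule smooth_coinduct[where S = expinv_span])
  show "expinv_span (expinv N)" by (rule base)
  fix f assume "expinv_span f"
  then show "\<exists>f'. (\<forall>x. (f has_derivative (\<lambda>v. f' v x)) (at x)) \<and> (\<forall>v. expinv_span (f' v))"
  proof induction
    case (base N)
    show ?case
    proof (intro exI[of _ "\<lambda>v x. v * (expinv (N + 2) x + (- real N) * expinv (N + 1) x)"] conjI allI)
      show "expinv_span (\<lambda>x. v * (expinv (N + 2) x + (- real N) * expinv (N + 1) x))" for v
        by (intro expinv_span.intros)
    qed (use has_derivative_expinv[of N] in simp)
  next
    case (scale f c)
    then obtain f' where "\<forall>x. (f has_derivative (\<lambda>v. f' v x)) (at x)" "\<forall>v. expinv_span (f' v)"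
      by blast
    then show ?case
      by (intro exI[of _ "\<lambda>v x. c * f' v x"])
        (auto intro: expinv_span.intros has_derivative_mult_right)
  next
    case (add f g)
    then obtain f' g' where "\<forall>x. (f has_derivative (\<lambda>v. f' v x)) (at x)" "\<forall>v. expinv_span (f' v)"
      "\<forall>x. (g has_derivative (\<lambda>v. g' v x)) (at x)" "\<forall>v. expinv_span (g' v)"
      by blast
    then show ?case
      by (intro exI[of _ "\<lambda>v x. f' v x + g' v x"])
        (auto intro: expinv_span.intros has_derivative_add)
  qed
qed

lemma expinv_nonneg: "0 \<le> expinv N x"
  by (simp add: expinv_def)

lemma expinv_pos: "0 < x \<Longrightarrow> 0 < expinv N x"
  by (simp add: expinv_def)

lemma expinv_zero: "x \<le> 0 \<Longrightarrow> expinv N x = 0"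
  by (simp add: expinv_def)

lemma smooth_affine: "smooth (\<lambda>x. c * x + d :: real)"
  by (intro smooth_add smooth_bounded_linear bounded_linear_mult_right smooth_const)

text \<open>A quotient \<open>p / (p + p')\<close> with \<open>p\<close> positive below 2 and
  \<open>p'\<close> positive above 1: the two half-lines cover the line, so the denominator never
  vanishes.\<close>

lemma smooth_cutoff:
  obtains cut :: "real \<Rightarrow> real"
  where "smooth cut" "\<And>x. x \<le> 1 \<Longrightarrow> cut x = 1" "\<And>x. 2 \<le> x \<Longrightarrow> cut x = 0"
    "\<And>x. 0 \<le> cut x" "\<And>x. cut x \<le> 1"
proof -
  define p where "p x = expinv 0 (2 - x)" for x
  define q where "q x = p x + expinv 0 (x - 1)" for x
  have pq: "0 \<le> p x" "p x \<le> q x" "0 < q x" for x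
    using expinv_nonneg[of 0 "x - 1"] expinv_nonneg[of 0 "2 - x"] expinv_pos[of "x - 1" 0]
      expinv_pos[of "2 - x" 0]
    by (cases "x < 2"; force simp: p_def q_def)+
  have p: "smooth p"
    using smooth_compose[OF smooth_expinv smooth_affine[of "-1" 2], of 0] by (simp add: p_def[abs_def])
  have q: "smooth q"
    unfolding q_def
    using smooth_add[OF p smooth_compose[OF smooth_expinv smooth_affine[of 1 "-1"], of 0]] by simp
  show ?thesis
  proof (rule that[of "\<lambda>x. p x * inverse (q x)"])
    show "smooth (\<lambda>x. p x * inverse (q x))"
      using pq(3) by (intro smooth_mult smooth_inverse p q allI) (metis less_irrefl)
    show "p x * inverse (q x) = 1" if "x \<le> 1" for x
      using that pq(3)[of x] by (simp add: q_def expinv_zero)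
  qed (use pq in \<open>auto simp: field_simps p_def expinv_zero\<close>)
qed

text \<open>The support is bounded away from 0 as well as from infinity. It is later used at
  \<open>c = \<alpha> / \<beta>\<close>, the value on the shell of the ratio that measures the
  distance to it.\<close>

lemma smooth_bump:
  fixes c :: real
  assumes "c > 0"
  obtains b :: "real \<Rightarrow> real"
  where "smooth b" "b c = 1" "\<And>x. x \<le> c / 2 \<Longrightarrow> b x = 0" "\<And>x. 2 * c \<le> x \<Longrightarrow> b x = 0"
proof -
  define b where "b x = inverse (expinv 0 (c / 2) * expinv 0 c) * (expinv 0 (x - c / 2) * expinv 0 (2 * c - x))" for x
  show ?thesis
  proof (rule that[of b])
    have "smooth (\<lambda>x. expinv 0 (x - c / 2))"
      using smooth_compose[OF smooth_expinv smooth_affine[of 1 "- c / 2"], of 0] by simp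
    moreover have "smooth (\<lambda>x. expinv 0 (2 * c - x))"
      using smooth_compose[OF smooth_expinv smooth_affine[of "-1" "2 * c"], of 0] by simp
    ultimately show "smooth b"
      unfolding b_def by (intro smooth_mult smooth_const)
    show "b c = 1"
      using assms expinv_pos[of c 0] expinv_pos[of "c / 2" 0] by (simp add: b_def field_simps)
  qed (auto simp: b_def expinv_zero)
qed

subsection \<open>Borel's theorem\<close>

lemma smooth_norm_power2:
  "smooth (\<lambda>z :: 'a::euclidean_space. (norm z)\<^sup>2)"
proof -
  have "(\<lambda>z :: 'a. (norm z)\<^sup>2) = (\<lambda>z. \<Sum>b\<in>Basis. (z \<bullet> b) * (z \<bullet> b))"
    by (simp add: fun_eq_iff norm_eq_sqrt_inner euclidean_inner[symmetric])
  moreover have "smooth (\<lambda>z :: 'a. z \<bullet> b)" for b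
    by (intro smooth_bounded_linear bounded_linear_inner_left)
  ultimately show ?thesis
    by (simp add: smooth_sum smooth_mult)
qed

definition dds :: "'a::real_normed_vector list \<Rightarrow> ('a \<Rightarrow> real) \<Rightarrow> 'a \<Rightarrow> real" where
  "dds vs f = foldr dd vs f"

lemma dds_simps [simp]: "dds [] f = f" "dds (v # vs) f = dd v (dds vs f)"
  by (simp_all add: dds_def)

lemma smooth_dds: "smooth f \<Longrightarrow> smooth (dds vs f)"
  by (induction vs) (auto intro: smooth_dd)

lemma dd_scaled:
  assumes "smooth f"
  shows "dd v (\<lambda>x. c * f (s *\<^sub>R x)) = (\<lambda>x. (c * s) * dd v f (s *\<^sub>R x))"
proof
  fix x
  have "((\<lambda>x. c * f (s *\<^sub>R x)) has_derivative (\<lambda>v. c * dd (s *\<^sub>R v) f (s *\<^sub>R x))) (at x)"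
    by (intro has_derivative_mult_right
        has_derivative_compose[OF bounded_linear_imp_has_derivative[OF bounded_linear_scaleR_right]
          smooth_has_derivative[OF assms]])
  from dd_eqI[OF this] show "dd v (\<lambda>x. c * f (s *\<^sub>R x)) x = (c * s) * dd v f (s *\<^sub>R x)"
    using linear_scale[OF dd_linear[OF assms], of s v "s *\<^sub>R x"] by simp
qed

lemma dds_scaled:
  assumes "smooth f"
  shows "dds vs (\<lambda>x. c * f (s *\<^sub>R x)) = (\<lambda>x. (c * s ^ length vs) * dds vs f (s *\<^sub>R x))"
proof (induction vs)
  case (Cons v vs)
  then show ?case
    using dd_scaled[OF smooth_dds[OF assms], of v "c * s ^ length vs" vs s] by (simp add: mult.assoc mult.commute[of s])
qed simp

lemma dds_zero_outside:
  fixes f :: "'a::real_normed_vector \<Rightarrow> real"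
  assumes "\<And>z. r < norm z \<Longrightarrow> f z = 0" "r < norm z"
  shows "dds vs f z = 0"
  using assms(2)
proof (induction vs arbitrary: z)
  case (Cons v vs)
  have "open {z :: 'a. r < norm z}"
    by (intro open_Collect_less continuous_intros)
  then have "(dds vs f has_derivative (\<lambda>_. 0)) (at z)"
    using Cons by (intro has_derivative_transform_within_open[OF has_derivative_const[of 0]]) auto
  then show ?case using dd_eqI by simp
qed (use assms(1) in simp)

text \<open>For each list of directions only finitely many terms escape the bound, so every termwise
  differentiated series is dominated by a geometric tail. The class of all such series is closed
  under partial derivatives.\<close>

lemma smooth_suminf:
  fixes F :: "nat \<Rightarrow> 'a::euclidean_space \<Rightarrow> real"
  assumes sm: "\<And>d. smooth (F d)"
    and bd: "\<And>vs d z. set vs \<subseteq> Basis \<Longrightarrow> length vs < d \<Longrightarrow> \<bar>dds vs (F d) z\<bar> \<le> (1/2) ^ d"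
  shows "smooth (\<lambda>z. \<Sum>d. F d z)"
proof (rule smooth_coinduct_Basis[where S = "\<lambda>f. \<exists>vs. set vs \<subseteq> Basis \<and> f = (\<lambda>z. \<Sum>d. dds vs (F d) z)"])
  show "\<exists>vs. set vs \<subseteq> Basis \<and> (\<lambda>z. \<Sum>d. F d z) = (\<lambda>z. \<Sum>d. dds vs (F d) z)"
    by (intro exI[of _ "[]"]) simp
  fix f assume "\<exists>vs. set vs \<subseteq> Basis \<and> f = (\<lambda>z. \<Sum>d. dds vs (F d) z)"
  then obtain vs where vs: "set vs \<subseteq> Basis" "f = (\<lambda>z. \<Sum>d. dds vs (F d) z)" by blast
  define G where "G b z = (\<Sum>d. dds (b # vs) (F d) z)" for b z
  have sums: "summable (\<lambda>d. dds ws (F d) z)" if "set ws \<subseteq> Basis" for ws z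
    by (rule summable_comparison_test'[of "\<lambda>d. (1/2 :: real) ^ d" "Suc (length ws)"])
      (use bd[OF that] in \<open>auto simp: summable_geometric\<close>)
  have tail: "\<bar>(\<Sum>i<n. dds ws (F i) z) - (\<Sum>d. dds ws (F d) z)\<bar> \<le> 2 * (1/2) ^ n"
    if "set ws \<subseteq> Basis" "length ws < n" for ws n z
  proof -
    have "(\<Sum>d. dds ws (F d) z) - (\<Sum>i<n. dds ws (F i) z) = (\<Sum>d. dds ws (F (d + n)) z)"
      using suminf_split_initial_segment[OF sums[OF that(1)], of z n] by simp
    moreover have "\<bar>\<Sum>d. dds ws (F (d + n)) z\<bar> \<le> (\<Sum>d. (1/2) ^ d * (1/2) ^ n)"
      using bd[OF that(1)] that(2) unfolding real_norm_def[symmetric]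
      by (intro norm_suminf_le summable_mult2)
        (auto simp: power_add[symmetric] summable_geometric simp del: real_norm_def)
    moreover have "(\<Sum>d. (1/2 :: real) ^ d * (1/2) ^ n) = 2 * (1/2) ^ n"
      by (subst suminf_mult2[symmetric]) (auto simp: summable_geometric suminf_geometric)
    ultimately show ?thesis by linarith
  qed
  have "\<exists>g. \<forall>x\<in>UNIV. (\<lambda>d. dds vs (F d) x) sums g x \<and>
      (g has_derivative (\<lambda>v. \<Sum>b\<in>Basis. (v \<bullet> b) * G b x)) (at x within UNIV)"
  proof (rule has_derivative_series[where f' = "\<lambda>d x v. dd v (dds vs (F d)) x"])
    fix e :: real assume "e > 0"
    define K where "K = real (card (Basis :: 'a set)) * 2"
    have "(\<lambda>n. K * (1/2) ^ n) \<longlonglongrightarrow> K * 0"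
      by (intro tendsto_intros LIMSEQ_power_zero) auto
    then have "\<forall>\<^sub>F n in sequentially. K * (1/2) ^ n < e"
      using \<open>e > 0\<close> by (auto dest: order_tendstoD(2))
    \<comment> \<open>One more than \<open>length vs\<close>, because the tail estimate is applied
      to the lists \<open>b # vs\<close>.\<close>
    moreover have "\<forall>\<^sub>F n in sequentially. Suc (length vs) < n"
      by (rule eventually_gt_at_top)
    ultimately show "\<forall>\<^sub>F n in sequentially. \<forall>x\<in>UNIV. \<forall>h.
        norm ((\<Sum>i<n. dd h (dds vs (F i)) x) - (\<Sum>b\<in>Basis. (h \<bullet> b) * G b x)) \<le> e * norm h"
    proof eventually_elim
      case (elim n)
      show ?case
      proof (intro ballI allI)
        fix x h
        have "(\<Sum>i<n. dd h (dds vs (F i)) x) = (\<Sum>b\<in>Basis. (h \<bullet> b) * (\<Sum>i<n. dds (b # vs) (F i) x))"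
          unfolding dd_Basis_expand[OF smooth_dds[OF sm], of h vs] sum_distrib_left
          by (subst sum.swap) simp
        then have "norm ((\<Sum>i<n. dd h (dds vs (F i)) x) - (\<Sum>b\<in>Basis. (h \<bullet> b) * G b x))
            = norm (\<Sum>b\<in>Basis. (h \<bullet> b) * ((\<Sum>i<n. dds (b # vs) (F i) x) - G b x))"
          by (simp add: sum_subtractf right_diff_distrib)
        also have "\<dots> \<le> (\<Sum>b\<in>(Basis::'a set). norm h * (2 * (1/2) ^ n))"
          using tail[of "_ # vs" n x] vs(1) elim(2)
          by (intro norm_sum[THEN order_trans] sum_mono)
            (auto simp: abs_mult G_def simp del: dds_simps intro!: mult_mono Basis_le_norm)
        also have "\<dots> = K * (1/2) ^ n * norm h"
          by (simp add: K_def)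
        also have "\<dots> \<le> e * norm h"
          using elim(1) by (intro mult_right_mono) auto
        finally show "norm ((\<Sum>i<n. dd h (dds vs (F i)) x) - (\<Sum>b\<in>Basis. (h \<bullet> b) * G b x)) \<le> e * norm h" .
      qed
    qed
  qed (use sums[OF vs(1)] smooth_has_derivative[OF smooth_dds[OF sm]] in \<open>auto simp: summable_sums\<close>)
  then obtain g where g: "\<And>x. (\<lambda>d. dds vs (F d) x) sums g x"
    "\<And>x. (g has_derivative (\<lambda>v. \<Sum>b\<in>Basis. (v \<bullet> b) * G b x)) (at x)"
    by auto
  have "g = f"
    using g(1) vs(2) sums_unique by blast
  then show "\<exists>f'. (\<forall>x. (f has_derivative (\<lambda>v. \<Sum>b\<in>Basis. (v \<bullet> b) * f' b x)) (at x)) \<and>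
      (\<forall>b\<in>Basis. \<exists>vs. set vs \<subseteq> Basis \<and> f' b = (\<lambda>z. \<Sum>d. dds vs (F d) z))"
    using g(2) vs(1)
    by (intro exI[of _ G] conjI ballI exI[of _ "_ # vs"]) (auto simp: G_def[abs_def])
qed


text \<open>Each \<open>f d\<close> is cut off to a ball so small that the series converges with all
  derivatives. The cutoffs are radial, so every norm-preserving symmetry of all the
  \<open>f d\<close> survives; this is how torus invariance passes to the sum. The conclusion
  compares values rather than derivatives, which is the form in which flatness is defined.\<close>

lemma borel:
  fixes f :: "nat \<Rightarrow> 'a::euclidean_space \<Rightarrow> real"
  assumes sm: "\<And>d. smooth (f d)" and hom: "\<And>d c z. f d (c *\<^sub>R z) = c ^ d * f d z"
  obtains g where "smooth g"
    "\<forall>T. (\<forall>z. norm (T z) = norm z) \<and> (\<forall>d z. f d (T z) = f d z) \<longrightarrow> g \<circ> T = g"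
    "\<And>N. \<exists>C r. r > 0 \<and> (\<forall>z. norm z < r \<longrightarrow> \<bar>g z - (\<Sum>d<N. f d z)\<bar> \<le> C * norm z ^ N)"
proof -
  obtain cut :: "real \<Rightarrow> real" where cut: "smooth cut" "\<And>x. x \<le> 1 \<Longrightarrow> cut x = 1" "\<And>x. 2 \<le> x \<Longrightarrow> cut x = 0"
    "\<And>x. 0 \<le> cut x" "\<And>x. cut x \<le> 1"
    by (rule smooth_cutoff) blast
  define P where "P d z = cut ((norm z)\<^sup>2) * f d z" for d z
  have smP: "smooth (P d)" for d
    unfolding P_def by (intro smooth_mult sm smooth_compose[OF cut(1)] smooth_norm_power2)
  have P0: "P d z = 0" if "2 < norm z" for d z
    using power_mono[of 2 "norm z" 2] that by (simp add: P_def cut(3))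
  \<comment> \<open>There are finitely many lists of basis vectors of length at most
    \<open>d\<close>, and each derivative of the compactly supported \<open>P d\<close> is
    bounded.\<close>
  have "\<exists>M\<ge>0. \<forall>vs\<in>{vs. set vs \<subseteq> Basis \<and> length vs \<le> d}. \<forall>z. \<bar>dds vs (P d) z\<bar> \<le> M" for d
  proof -
    have "\<exists>M. \<forall>z. \<bar>dds vs (P d) z\<bar> \<le> M" for vs
    proof -
      have "bounded (dds vs (P d) ` cball 0 2)"
        by (intro compact_imp_bounded compact_continuous_image smooth_continuous smooth_dds smP compact_cball)
      then obtain M where "\<forall>y\<in>dds vs (P d) ` cball 0 2. norm y \<le> M"
        unfolding bounded_iff by blast
      then have M: "\<bar>dds vs (P d) z\<bar> \<le> M" if "z \<in> cball 0 2" for z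
        using that by auto
      have "\<bar>dds vs (P d) z\<bar> \<le> max M 0" for z
        using M[of z] dds_zero_outside[of 2 "P d" z vs, OF P0] by (cases "norm z \<le> 2") (auto simp: le_max_iff_disj)
      then show ?thesis by blast
    qed
    then obtain M where M: "\<And>vs z. \<bar>dds vs (P d) z\<bar> \<le> M vs" by metis
    have fin: "finite {vs :: 'a list. set vs \<subseteq> Basis \<and> length vs \<le> d}"
      by (intro finite_lists_length_le) simp
    have M0: "0 \<le> M vs" for vs
      using M[of vs undefined] by linarith
    have "M vs \<le> (\<Sum>vs\<in>{vs. set vs \<subseteq> Basis \<and> length vs \<le> d}. M vs)"
      if "vs \<in> {vs. set vs \<subseteq> Basis \<and> length vs \<le> d}" for vs
      using member_le_sum[OF that _ fin, of M] M0 by auto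
    with M M0 show ?thesis
      by (intro exI[of _ "\<Sum>vs\<in>{vs. set vs \<subseteq> Basis \<and> length vs \<le> d}. M vs"])
        (auto intro!: sum_nonneg intro: order_trans[OF M])
  qed
  then obtain M where M0: "\<And>d. 0 \<le> M d"
    and M: "\<And>d vs z. set vs \<subseteq> Basis \<Longrightarrow> length vs \<le> d \<Longrightarrow> \<bar>dds vs (P d) z\<bar> \<le> M d"
    by (metis (mono_tags, lifting) mem_Collect_eq)
  \<comment> \<open>Small enough for \<open>e d * M d \<le> (1/2) ^ d\<close>. A derivative of order
    below \<open>d\<close> of \<open>F d\<close> keeps at least one factor \<open>e d\<close>:
    homogeneity supplies \<open>d\<close> of them and each differentiation removes one.\<close>
  define e where "e d = 1 / (2 ^ d * (1 + M d))" for d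
  have e: "0 < e d" "e d \<le> 1" "e d * M d \<le> (1/2) ^ d" "e d \<le> (1/2) ^ d" for d
  proof -
    have "1 * 1 \<le> 2 ^ d * (1 + M d)"
      using M0[of d] by (intro mult_mono) auto
    then show "0 < e d" "e d \<le> 1"
      using M0[of d] by (auto simp: e_def)
    show "e d * M d \<le> (1/2) ^ d" "e d \<le> (1/2) ^ d"
      using M0[of d] add_pos_nonneg[of "2 ^ d" "M d * 2 ^ d"] by (auto simp: e_def field_simps)
  qed
  define F where "F d z = e d ^ d * P d ((1 / e d) *\<^sub>R z)" for d z
  have F_eq: "F d z = cut ((norm z / e d)\<^sup>2) * f d z" for d z
    using e(1)[of d] by (simp add: F_def P_def hom power_divide)
  \<comment> \<open>By homogeneity the unit sphere decides, and there the cutoff equals 1, so the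
    bound on \<open>P d\<close> is one on \<open>f d\<close>.\<close>
  have fM: "\<bar>f d z\<bar> \<le> M d * norm z ^ d" for d z
  proof (cases "z = 0")
    case True
    then show ?thesis
      using hom[of d 0 0] M[of "[]" d 0] M0[of d] by (cases d) (auto simp: P_def cut(2))
  next
    case False
    have "\<bar>P d (z /\<^sub>R norm z)\<bar> \<le> M d"
      using M[of "[]" d] by simp
    then have "\<bar>f d (z /\<^sub>R norm z)\<bar> \<le> M d"
      using False by (simp add: P_def cut(2))
    moreover have "f d z = norm z ^ d * f d (z /\<^sub>R norm z)"
      using hom[of d "norm z" "z /\<^sub>R norm z"] False by simp
    ultimately show ?thesis
      by (simp add: abs_mult mult.commute[of "M d"] mult_left_mono)
  qed
  have near: "F d z = f d z" if "norm z \<le> e d" for d z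
    using that e(1)[of d] by (simp add: F_eq cut(2) power_le_one)
  \<comment> \<open>Where the cutoff is nonzero, \<open>norm z \<le> 2 * e d \<le> 1\<close>, so a
    single one of the \<open>d - N\<close> spare factors \<open>norm z\<close> pays for the constant
    \<open>M d\<close>.\<close>
  have far: "\<bar>F d z\<bar> \<le> 2 * (1/2) ^ d * norm z ^ N" if "N < d" for d N z
  proof (cases "2 \<le> (norm z / e d)\<^sup>2")
    case False
    have nz: "norm z \<le> 2 * e d"
    proof (rule ccontr)
      assume "\<not> norm z \<le> 2 * e d"
      then have "2 \<le> norm z / e d" using e(1)[of d] by (simp add: field_simps)
      from power_mono[OF this, of 2] False show False by simp
    qed
    have e2: "2 * e d \<le> 1"
      using e(4)[of d] power_decreasing[of 1 d "1/2 :: real"] that by simp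
    have "\<bar>F d z\<bar> \<le> 1 * (M d * norm z ^ d)"
      unfolding F_eq abs_mult using cut(4,5) fM by (intro mult_mono) (auto simp: abs_of_nonneg)
    also have "\<dots> = M d * norm z ^ (d - N) * norm z ^ N"
      using that by (simp flip: power_add)
    also have "\<dots> \<le> M d * (2 * e d) * norm z ^ N"
    proof (intro mult_right_mono mult_left_mono)
      have "norm z ^ (d - N) \<le> norm z ^ 1"
        using nz e2 that by (intro power_decreasing) auto
      then show "norm z ^ (d - N) \<le> 2 * e d" using nz by simp
    qed (use M0 in auto)
    also have "\<dots> \<le> 2 * (1/2) ^ d * norm z ^ N"
      using e(3)[of d] by (intro mult_right_mono) (auto simp: mult_ac)
    finally show ?thesis .
  qed (simp add: F_eq cut(3))
  show ?thesis
  proof (rule that[of "\<lambda>z. \<Sum>d. F d z"])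
    show "smooth (\<lambda>z. \<Sum>d. F d z)"
    proof (rule smooth_suminf)
      show "smooth (F d)" for d
        unfolding F_def
        by (intro smooth_mult smooth_const smooth_compose_linear[OF smP bounded_linear_scaleR_right])
      fix vs d and z :: 'a assume vs: "set vs \<subseteq> (Basis :: 'a set)" "length vs < d"
      have "dds vs (F d) z = e d ^ (d - length vs) * dds vs (P d) ((1 / e d) *\<^sub>R z)"
        using vs(2) e(1)[of d] unfolding F_def dds_scaled[OF smP]
        by (simp add: power_diff power_divide)
      then have "\<bar>dds vs (F d) z\<bar> \<le> e d ^ (d - length vs) * M d"
        using M[OF vs(1)] vs(2) e(1)[of d] by (simp add: abs_mult)
      also have "\<dots> \<le> e d ^ 1 * M d"
        using e(1,2)[of d] vs(2) M0[of d] by (intro mult_right_mono power_decreasing) auto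
      also have "\<dots> \<le> (1/2) ^ d" using e(3)[of d] by simp
      finally show "\<bar>dds vs (F d) z\<bar> \<le> (1/2) ^ d" .
    qed
    show "\<forall>T. (\<forall>z. norm (T z) = norm z) \<and> (\<forall>d z. f d (T z) = f d z) \<longrightarrow>
        (\<lambda>z. \<Sum>d. F d z) \<circ> T = (\<lambda>z. \<Sum>d. F d z)"
      by (simp add: fun_eq_iff F_eq)
    show "\<exists>C r. r > 0 \<and> (\<forall>z. norm z < r \<longrightarrow> \<bar>(\<Sum>d. F d z) - (\<Sum>d<N. f d z)\<bar> \<le> C * norm z ^ N)" for N
    \<comment> \<open>\<open>M N\<close> bounds the term of degree \<open>N\<close>, and 4 is the
      sum of the \<open>2 * (1/2) ^ d\<close>. Within this radius all cutoffs up to index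
      \<open>N\<close> equal 1.\<close>
    proof (rule exI[of _ "M N + 4"], rule exI[of _ "Min (e ` {..N})"], intro conjI allI impI)
      show "0 < Min (e ` {..N})" using e(1) by auto
      fix z :: 'a assume z: "norm z < Min (e ` {..N})"
      have zN: "F d z = f d z" if "d \<le> N" for d
        using z that by (intro near less_imp_le) auto
      have sg: "summable (\<lambda>d. 2 * (1/2) ^ d * norm z ^ N)"
        by (intro summable_mult2 summable_mult summable_geometric) simp
      have sF: "summable (\<lambda>d. F d z)"
        by (rule summable_comparison_test'[OF sg, of "Suc N"]) (use far in auto)
      have "(\<Sum>d. F d z) - (\<Sum>d<N. f d z) = f N z + (\<Sum>d. F (d + Suc N) z)"
        using suminf_split_initial_segment[OF sF, of "Suc N"] zN by simp
      moreover have "\<bar>\<Sum>d. F (d + Suc N) z\<bar> \<le> (\<Sum>d. 2 * (1/2) ^ d * norm z ^ N)"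
        unfolding real_norm_def[symmetric]
      proof (intro norm_suminf_le sg)
        fix d
        have "\<bar>F (d + Suc N) z\<bar> \<le> 2 * (1/2) ^ (d + Suc N) * norm z ^ N"
          by (intro far) simp
        also have "\<dots> \<le> 2 * (1/2) ^ d * norm z ^ N"
          by (intro mult_right_mono mult_left_mono power_decreasing) auto
        finally show "norm (F (d + Suc N) z) \<le> 2 * (1/2) ^ d * norm z ^ N" by simp
      qed
      moreover have "(\<Sum>d. 2 * (1/2 :: real) ^ d * norm z ^ N) = 4 * norm z ^ N"
        using sums_unique[OF sums_mult2[OF sums_mult[OF geometric_sums[of "1/2 :: real"]]], of 2 "norm z ^ N"]
        by simp
      ultimately show "\<bar>(\<Sum>d. F d z) - (\<Sum>d<N. f d z)\<bar> \<le> (M N + 4) * norm z ^ N"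
        using fM[of N z] by (simp add: algebra_simps)
    qed
  qed
qed

subsection \<open>Taylor expansion and flat functions\<close>

lemma smooth_dd_power: "smooth f \<Longrightarrow> smooth ((dd w ^^ d) f)"
  by (induction d) (auto intro: smooth_dd)

lemma dd_power_sum:
  assumes "finite B" "\<And>b. b \<in> B \<Longrightarrow> smooth (f b)"
  shows "(dd w ^^ d) (\<lambda>x. \<Sum>b\<in>B. c b * f b x) = (\<lambda>x. \<Sum>b\<in>B. c b * (dd w ^^ d) (f b) x)"
proof (induction d)
  case (Suc d)
  have "dd w (\<lambda>x. \<Sum>b\<in>B. c b * (dd w ^^ d) (f b) x) = (\<lambda>x. \<Sum>b\<in>B. c b * dd w ((dd w ^^ d) (f b)) x)"
    using assms by (intro ext dd_eqI has_derivative_sum has_derivative_mult_right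
        smooth_has_derivative smooth_dd_power)
  with Suc show ?case by simp
qed simp

text \<open>The innermost derivative is expanded, not the outermost: the remaining \<open>d\<close>
  derivatives then act on the fixed function \<open>dd b f\<close>, so an induction hypothesis for
  all functions applies. This yields both the growth in \<open>w\<close> and the polynomial nature
  of Taylor terms.\<close>

lemma dd_power_Suc_Basis:
  fixes f :: "'a::euclidean_space \<Rightarrow> real"
  assumes "smooth f"
  shows "(dd w ^^ Suc d) f y = (\<Sum>b\<in>Basis. (w \<bullet> b) * (dd w ^^ d) (dd b f) y)"
proof -
  have "dd w f = (\<lambda>x. \<Sum>b\<in>Basis. (w \<bullet> b) * dd b f x)"
    using dd_Basis_expand[OF assms] by blast
  then show ?thesis
    unfolding funpow_Suc_right o_apply
    using dd_power_sum[where B = Basis and f = "\<lambda>b. dd b f" and c = "\<lambda>b. w \<bullet> b"] assms by (simp add: smooth_dd)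
qed

lemma continuous_bounded_cball:
  fixes f :: "'a::euclidean_space \<Rightarrow> real"
  assumes "continuous_on UNIV f"
  obtains C where "C \<ge> 0" "\<And>y. norm y \<le> K \<Longrightarrow> \<bar>f y\<bar> \<le> C"
proof -
  have "bounded (f ` cball 0 K)"
    using assms by (intro compact_imp_bounded compact_continuous_image compact_cball)
      (auto intro: continuous_on_subset)
  then obtain C where C: "\<forall>y\<in>f ` cball 0 K. norm y \<le> C"
    unfolding bounded_iff by blast
  show ?thesis
    by (rule that[of "max C 0"]) (use C in \<open>auto simp: le_max_iff_disj\<close>)
qed

lemma dd_power_bound:
  fixes f :: "'a::euclidean_space \<Rightarrow> real"
  assumes "smooth f"
  shows "\<exists>C. \<forall>w y. norm y \<le> K \<longrightarrow> \<bar>(dd w ^^ N) f y\<bar> \<le> C * norm w ^ N"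
  using assms
proof (induction N arbitrary: f)
  case 0
  then show ?case
    using continuous_bounded_cball[OF smooth_continuous[OF 0]] by (metis funpow_0 mult.right_neutral power_0)
next
  case (Suc N)
  have "\<exists>C. \<forall>w y. norm y \<le> K \<longrightarrow> \<bar>(dd w ^^ N) (dd b f) y\<bar> \<le> C * norm w ^ N" for b
    by (intro Suc smooth_dd)
  then obtain C where C: "\<And>b w y. norm y \<le> K \<Longrightarrow> \<bar>(dd w ^^ N) (dd b f) y\<bar> \<le> C b * norm w ^ N"
    by metis
  show ?case
  proof (intro exI[of _ "\<Sum>b\<in>Basis. C b"] allI impI)
    fix w y :: 'a assume y: "norm y \<le> K"
    have "\<bar>(dd w ^^ Suc N) f y\<bar> \<le> (\<Sum>b\<in>Basis. norm w * (C b * norm w ^ N))"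
      unfolding dd_power_Suc_Basis[OF Suc.prems]
      using C[OF y] by (intro sum_abs[THEN order_trans] sum_mono)
        (auto simp: abs_mult intro!: mult_mono Basis_le_norm)
    also have "\<dots> = (\<Sum>b\<in>Basis. C b) * norm w ^ Suc N"
      by (simp add: sum_distrib_right sum_distrib_left mult_ac)
    finally show "\<bar>(dd w ^^ Suc N) f y\<bar> \<le> (\<Sum>b\<in>Basis. C b) * norm w ^ Suc N" .
  qed
qed

lemma has_real_derivative_line:
  assumes "smooth f"
  shows "((\<lambda>t. f (x + t *\<^sub>R w)) has_real_derivative dd w f (x + t *\<^sub>R w)) (at t)"
proof -
  have "((\<lambda>t. x + t *\<^sub>R w) has_derivative (\<lambda>s. s *\<^sub>R w)) (at t)"
    by (auto intro!: derivative_eq_intros)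
  from has_derivative_compose[OF this smooth_has_derivative[OF assms]]
  show ?thesis
    by (simp add: has_field_derivative_def linear_scale[OF dd_linear[OF assms]] mult_commute_abs)
qed

text \<open>One-variable Taylor expansion with Lagrange remainder along the line through
  \<open>x\<close> in direction \<open>w\<close>.\<close>

lemma taylor_line:
  assumes "smooth f"
  obtains t where "\<bar>t\<bar> \<le> \<bar>s\<bar>"
    "f (x + s *\<^sub>R w) = (\<Sum>d<N. (dd w ^^ d) f x / fact d * s ^ d) + (dd w ^^ N) f (x + t *\<^sub>R w) / fact N * s ^ N"
proof -
  have "\<exists>t. \<bar>t\<bar> \<le> \<bar>s\<bar> \<and> f (x + s *\<^sub>R w) = (\<Sum>d<N. (\<lambda>t. (dd w ^^ d) f (x + t *\<^sub>R w)) 0 / fact d * s ^ d)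
      + (\<lambda>t. (dd w ^^ N) f (x + t *\<^sub>R w)) t / fact N * s ^ N"
    using has_real_derivative_line[OF smooth_dd_power[OF assms]]
    by (intro Maclaurin_all_le) auto
  then show ?thesis using that by auto
qed

lemma taylor_remainder:
  fixes f :: "'a::euclidean_space \<Rightarrow> real"
  assumes "smooth f"
  obtains C where "\<And>w. norm w \<le> 1 \<Longrightarrow> \<bar>f w - (\<Sum>d<N. (dd w ^^ d) f 0 / fact d)\<bar> \<le> C * norm w ^ N"
proof -
  obtain C where C: "\<And>w y. norm y \<le> 1 \<Longrightarrow> \<bar>(dd w ^^ N) f y\<bar> \<le> C * norm w ^ N"
    using dd_power_bound[OF assms] by blast
  show ?thesis
  proof (rule that[of "C / fact N"])
    fix w :: 'a assume w: "norm w \<le> 1"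
    obtain t where t: "\<bar>t\<bar> \<le> 1" "f w = (\<Sum>d<N. (dd w ^^ d) f 0 / fact d) + (dd w ^^ N) f (t *\<^sub>R w) / fact N"
      using taylor_line[OF assms, of 1 0 w N] by auto
    have "norm (t *\<^sub>R w) \<le> 1"
      using mult_mono[OF t(1) w] by simp
    from C[OF this, of w] t(2) show "\<bar>f w - (\<Sum>d<N. (dd w ^^ d) f 0 / fact d)\<bar> \<le> C / fact N * norm w ^ N"
      by (simp add: divide_right_mono)
  qed
qed

text \<open>Encoded by the size of the function near 0 rather than by its derivatives there.
  Products then need only continuity of the other factor, and \<open>flat_dd\<close> recovers the
  derivatives.\<close>

definition flat :: "('a::real_normed_vector \<Rightarrow> real) \<Rightarrow> bool" where
  "flat h \<longleftrightarrow> (\<forall>N. \<exists>C r. r > 0 \<and> (\<forall>w. norm w < r \<longrightarrow> \<bar>h w\<bar> \<le> C * norm w ^ N))"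

lemma flat_add:
  assumes "flat g" "flat h"
  shows "flat (\<lambda>x. g x + h x)"
  unfolding flat_def
proof
  fix N
  obtain C r D s where "r > 0" "s > 0" and *: "\<And>w. norm w < r \<Longrightarrow> \<bar>g w\<bar> \<le> C * norm w ^ N"
    "\<And>w. norm w < s \<Longrightarrow> \<bar>h w\<bar> \<le> D * norm w ^ N"
    using assms unfolding flat_def by metis
  show "\<exists>C r. r > 0 \<and> (\<forall>w. norm w < r \<longrightarrow> \<bar>g w + h w\<bar> \<le> C * norm w ^ N)"
  proof (rule exI[of _ "C + D"], rule exI[of _ "min r s"], intro conjI allI impI)
    fix w :: 'a assume "norm w < min r s"
    then show "\<bar>g w + h w\<bar> \<le> (C + D) * norm w ^ N"
      using *[of w] abs_triangle_ineq[of "g w" "h w"] by (simp add: distrib_right)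
  qed (use \<open>r > 0\<close> \<open>s > 0\<close> in simp)
qed

text \<open>Away from the small ball a bound \<open>D\<close> is trivially at most
  \<open>D / r ^ N * norm w ^ N\<close>, so the local estimate holds on every ball at the price of a
  larger constant.\<close>

lemma flat_bound:
  fixes h :: "'a::euclidean_space \<Rightarrow> real"
  assumes "flat h" "continuous_on UNIV h"
  obtains C where "C \<ge> 0" "\<And>w. norm w \<le> K \<Longrightarrow> \<bar>h w\<bar> \<le> C * norm w ^ N"
proof -
  obtain C r where C: "r > 0" "\<And>w. norm w < r \<Longrightarrow> \<bar>h w\<bar> \<le> C * norm w ^ N"
    using assms(1) unfolding flat_def by metis
  obtain D where D: "D \<ge> 0" "\<And>w. norm w \<le> K \<Longrightarrow> \<bar>h w\<bar> \<le> D"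
    using continuous_bounded_cball[OF assms(2)] by blast
  show ?thesis
  proof (rule that[of "max C 0 + D / r ^ N"])
    show "0 \<le> max C 0 + D / r ^ N" using C D by simp
    fix w :: 'a assume w: "norm w \<le> K"
    show "\<bar>h w\<bar> \<le> (max C 0 + D / r ^ N) * norm w ^ N"
    proof (cases "norm w < r")
      case True
      have "C * norm w ^ N \<le> (max C 0 + D / r ^ N) * norm w ^ N"
        using C(1) D(1) by (intro mult_right_mono add_increasing2) auto
      then show ?thesis using C(2)[OF True] by linarith
    next
      case False
      have "D \<le> D / r ^ N * norm w ^ N"
        using False C(1) D(1) power_mono[of r "norm w" N] mult_left_mono[of "r ^ N" "norm w ^ N" D]
        by (simp add: field_simps)
      also have "\<dots> \<le> (max C 0 + D / r ^ N) * norm w ^ N"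
        by (intro mult_right_mono) auto
      finally show ?thesis using D(2)[OF w] by linarith
    qed
  qed
qed

lemma flat_mult:
  fixes h :: "'a::euclidean_space \<Rightarrow> real"
  assumes "flat h" "continuous_on UNIV g"
  shows "flat (\<lambda>x. g x * h x)"
  unfolding flat_def
proof
  fix N
  obtain C r where C: "r > 0" "\<And>w. norm w < r \<Longrightarrow> \<bar>h w\<bar> \<le> C * norm w ^ N"
    using assms(1) unfolding flat_def by metis
  obtain D where D: "D \<ge> 0" "\<And>w. norm w \<le> r \<Longrightarrow> \<bar>g w\<bar> \<le> D"
    using continuous_bounded_cball[OF assms(2)] by blast
  show "\<exists>C r. r > 0 \<and> (\<forall>w. norm w < r \<longrightarrow> \<bar>g w * h w\<bar> \<le> C * norm w ^ N)"
  proof (rule exI[of _ "D * C"], rule exI[of _ r], intro conjI allI impI)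
    fix w :: 'a assume "norm w < r"
    then have "\<bar>g w\<bar> * \<bar>h w\<bar> \<le> D * (C * norm w ^ N)"
      using C D by (intro mult_mono) auto
    then show "\<bar>g w * h w\<bar> \<le> D * C * norm w ^ N"
      by (simp add: abs_mult mult.assoc)
  qed (rule C)
qed

lemma flat_zero: "flat h \<Longrightarrow> h 0 = 0"
  unfolding flat_def
  by (drule spec[of _ 1]) (metis abs_le_zero_iff mult_zero_right norm_zero power_one_right)

text \<open>A difference quotient of step \<open>norm w ^ M\<close> bounds the derivative by a large power of
  \<open>norm w\<close>, the second derivative being locally bounded.\<close>

lemma flat_dd:
  fixes h :: "'a::euclidean_space \<Rightarrow> real"
  assumes sm: "smooth h" and fl: "flat h"
  shows "flat (dd v h)"
  unfolding flat_def
proof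
  fix N
  \<comment> \<open>\<open>Suc\<close> keeps \<open>M\<close> positive, so that the step
    \<open>norm w ^ M\<close> is at most \<open>norm w\<close> and the shifted point stays within
    \<open>L * norm w\<close>. Flatness is used to order \<open>2 * M\<close>, the square of the
    step, to match the second-order remainder.\<close>
  define M where "M = Suc N"
  define L where "L = 1 + norm v"
  have L: "L \<ge> 1" by (simp add: L_def)
  obtain C where C: "C \<ge> 0" "\<And>w. norm w \<le> L \<Longrightarrow> \<bar>h w\<bar> \<le> C * norm w ^ (2 * M)"
    using flat_bound[OF fl smooth_continuous[OF sm]] by blast
  obtain B where B: "B \<ge> 0" "\<And>w. norm w \<le> L \<Longrightarrow> \<bar>dd v (dd v h) w\<bar> \<le> B"
    using continuous_bounded_cball[OF smooth_continuous[OF smooth_dd[OF smooth_dd[OF sm]]]] by blast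
  define E where "E = C * L ^ (2 * M) + C + B"
  have E: "0 \<le> E" using C(1) B(1) L by (simp add: E_def)
  have main: "\<bar>dd v h w\<bar> \<le> E * norm w ^ N" if w: "norm w < 1" "w \<noteq> 0" for w
  proof -
    define t where "t = norm w ^ M"
    have t: "0 < t" "t \<le> norm w"
      using w power_decreasing[of 1 M "norm w"] by (auto simp: t_def M_def)
    obtain s where s: "\<bar>s\<bar> \<le> \<bar>t\<bar>" "h (w + t *\<^sub>R v) = (\<Sum>d<2. (dd v ^^ d) h w / fact d * t ^ d)
        + (dd v ^^ 2) h (w + s *\<^sub>R v) / fact 2 * t ^ 2"
      by (rule taylor_line[OF sm])
    have nb: "norm (w + u *\<^sub>R v) \<le> norm w * L" if "\<bar>u\<bar> \<le> t" for u
    proof -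
      have "norm (w + u *\<^sub>R v) \<le> norm w + \<bar>u\<bar> * norm v"
        by (metis norm_scaleR norm_triangle_ineq)
      also have "\<dots> \<le> norm w + norm w * norm v"
        using that t by (intro add_mono mult_right_mono) auto
      finally show ?thesis by (simp add: L_def algebra_simps)
    qed
    have nbL: "norm (w + u *\<^sub>R v) \<le> L" if "\<bar>u\<bar> \<le> t" for u
    proof -
      have "norm w * L \<le> 1 * L"
        using w L by (intro mult_right_mono) auto
      with nb[OF that] show ?thesis by simp
    qed
    have t2: "t\<^sup>2 = norm w ^ (2 * M)"
      by (simp add: t_def power_mult[symmetric] mult.commute)
    have "\<bar>h (w + t *\<^sub>R v)\<bar> \<le> C * norm (w + t *\<^sub>R v) ^ (2 * M)"
      using t nbL[of t] by (intro C(2)) auto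
    also have "\<dots> \<le> C * (norm w * L) ^ (2 * M)"
      using t nb[of t] C(1) by (intro mult_left_mono power_mono) auto
    also have "\<dots> = C * L ^ (2 * M) * t\<^sup>2"
      by (simp add: t2 power_mult_distrib)
    finally have 1: "\<bar>h (w + t *\<^sub>R v)\<bar> \<le> C * L ^ (2 * M) * t\<^sup>2" .
    have 2: "\<bar>h w\<bar> \<le> C * t\<^sup>2"
      using C(2)[of w] w L by (simp add: t2)
    have 3: "\<bar>(dd v ^^ 2) h (w + s *\<^sub>R v)\<bar> \<le> B"
      using B(2)[OF nbL, of s] s(1) t by (simp add: numeral_2_eq_2)
    have "h (w + t *\<^sub>R v) = h w + dd v h w * t + (dd v ^^ 2) h (w + s *\<^sub>R v) / 2 * t\<^sup>2"
      using s(2) by (simp add: numeral_2_eq_2)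
    then have "dd v h w * t = h (w + t *\<^sub>R v) - h w - (dd v ^^ 2) h (w + s *\<^sub>R v) / 2 * t\<^sup>2"
      by simp
    then have "\<bar>dd v h w * t\<bar> \<le> \<bar>h (w + t *\<^sub>R v)\<bar> + \<bar>h w\<bar> + \<bar>(dd v ^^ 2) h (w + s *\<^sub>R v) / 2 * t\<^sup>2\<bar>"
      by linarith
    also have "\<bar>(dd v ^^ 2) h (w + s *\<^sub>R v) / 2 * t\<^sup>2\<bar> \<le> B * t\<^sup>2"
      unfolding abs_mult using 3 B(1) by (intro mult_mono) auto
    finally have "\<bar>dd v h w\<bar> * t \<le> E * t * t"
      using 1 2 t(1) by (simp add: E_def algebra_simps power2_eq_square abs_mult)
    then have "\<bar>dd v h w\<bar> \<le> E * t"
      using t(1) by simp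
    also have "\<dots> \<le> E * norm w ^ N"
      using w E unfolding t_def M_def by (intro mult_left_mono power_decreasing) auto
    finally show ?thesis .
  qed
  have "(h has_derivative (\<lambda>_. 0)) (at 0)"
  proof -
    obtain D where D: "\<And>w. norm w \<le> 1 \<Longrightarrow> \<bar>h w\<bar> \<le> D * norm w ^ 2"
      using flat_bound[OF fl smooth_continuous[OF sm]] by blast
    show ?thesis
      by (rule has_derivative_at_flat[of _ _ 1 D]) (use D flat_zero[OF fl] in auto)
  qed
  then have "dd v h 0 = 0" by (rule dd_eqI)
  then have "\<bar>dd v h w\<bar> \<le> E * norm w ^ N" if "norm w < 1" for w
    using main[OF that] E by (cases "w = 0") auto
  then show "\<exists>C r. r > 0 \<and> (\<forall>w. norm w < r \<longrightarrow> \<bar>dd v h w\<bar> \<le> C * norm w ^ N)"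
    by (metis zero_less_one)
qed

subsection \<open>The embedding of weights\<close>

lemma norm_vec_sum_power2:
  fixes z :: "complex^('i::finite + 'j::finite)"
  shows "(norm z)\<^sup>2 = (\<Sum>i\<in>UNIV. (cmod (z $ Inl i))\<^sup>2) + (\<Sum>j\<in>UNIV. (cmod (z $ Inr j))\<^sup>2)"
proof -
  have "(norm z)\<^sup>2 = (\<Sum>i\<in>UNIV. (cmod (z $ i))\<^sup>2)"
    by (simp add: norm_vec_def L2_set_def sum_nonneg)
  then show ?thesis
    by (simp add: UNIV_Plus_UNIV[symmetric] sum.Plus del: UNIV_Plus_UNIV)
qed

text \<open>For coprime exponents \<open>t \<mapsto> (t ^ p, t ^ q)\<close> maps the circle onto the
  whole curve \<open>d ^ p = c ^ q\<close>; a preimage is \<open>c ^ x * d ^ y\<close> with Bezout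
  coefficients \<open>x\<close>, \<open>y\<close>.\<close>

lemma unit_root_pair:
  fixes c d :: complex
  assumes "coprime p q" "cmod c = 1" "cmod d = 1" "d ^ p = c ^ q"
  obtains t where "cmod t = 1" "t ^ p = c" "t ^ q = d"
proof -
  obtain x y :: int where xy: "x * int p + y * int q = 1"
    using assms(1) by (metis bezout_int coprime_iff_gcd_eq_1 coprime_int_iff gcd_1_int)
  have c0: "c \<noteq> 0" and d0: "d \<noteq> 0" using assms by auto
  define t where "t = c powi x * d powi y"
  have pow: "t ^ r = (c powi x) powi int r * (d powi y) powi int r" for r
    by (simp add: t_def power_mult_distrib)
  have pow': "t ^ r = c powi (x * int r) * d powi (y * int r)" for r
    unfolding pow by (simp only: power_int_mult)
  have eq: "d powi int p = c powi int q"
    using assms(4) by simp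
  show ?thesis
  proof (rule that[of t])
    show "cmod t = 1"
      by (simp add: t_def norm_mult norm_power_int assms)
    have "d powi (y * int p) = c powi (y * int q)"
      by (metis eq mult.commute power_int_mult)
    then show "t ^ p = c"
      using c0 xy by (simp add: pow' flip: power_int_add)
    have "c powi (x * int q) = d powi (x * int p)"
      by (metis eq mult.commute power_int_mult)
    then show "t ^ q = d"
      using d0 xy by (simp add: pow' flip: power_int_add)
  qed
qed

section \<open>Coordinates and explicit torus actions on both modules\<close>

text \<open>The first index type of \<open>z\<close> is arbitrary: for a point of V_B this replaces
  w_1, for a point of V_A it trades the first l coordinates for a single one.\<close>

definition join :: "complex \<Rightarrow> complex^('i::finite + 'k::finite) \<Rightarrow> complex^(unit + 'k)" where
  "join w z = (\<chi> j. case j of Inl _ \<Rightarrow> w | Inr j \<Rightarrow> z $ Inr j)"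

lemma join_nth [simp]: "join w z $ Inl u = w" "join w z $ Inr j = z $ Inr j"
  by (simp_all add: join_def)

lemma vec_sum_eqI: "(\<And>i. x $ Inl i = y $ Inl i) \<Longrightarrow> (\<And>j. x $ Inr j = y $ Inr j) \<Longrightarrow> x = y"
  unfolding vec_eq_iff by (metis sum.exhaust)

lemma join_self [simp]: "join (w $ Inl ()) w = w"
  by (rule vec_sum_eqI) simp_all

lemma typeI_Inl [simp]: "typeI a n i (Inl i') = (if i = i' then - int (a i) else 0)"
  and typeI_Inr [simp]: "typeI a n i (Inr j) = int (n i)"
  by (simp_all add: typeI_def)

lemma weightB_simps [simp]: "weightB p q u (Inl v) = - int p" "weightB p q u (Inr j) = int q"
  by (simp_all add: weightB_def)

lemma tact_weightB [simp]:
  "tact (weightB p q) t w $ Inl v = inverse (t () ^ p) * w $ Inl v"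
  "tact (weightB p q) t w $ Inr j = t () ^ q * w $ Inr j"
  by (simp_all add: tact_def power_int_minus UNIV_unit)

lemma tact_typeI [simp]:
  "tact (typeI a n) t z $ Inl i = inverse (t i ^ a i) * z $ Inl i"
  "tact (typeI a n) t z $ Inr j = (\<Prod>i\<in>UNIV. t i ^ n i) * z $ Inr j"
proof -
  have "(\<Prod>k\<in>UNIV. t k powi typeI a n k (Inl i)) = (\<Prod>k\<in>UNIV. if k = i then inverse (t k ^ a k) else 1)"
    by (intro prod.cong) (auto simp: power_int_minus)
  then show "tact (typeI a n) t z $ Inl i = inverse (t i ^ a i) * z $ Inl i"
    by (simp add: tact_def)
qed (simp add: tact_def)

lemma invariantI: "(\<And>t z. torus t \<Longrightarrow> f (tact W t z) = f z) \<Longrightarrow> invariant W f"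
  by (simp add: invariant_def)

lemma invariantD: "invariant W f \<Longrightarrow> torus t \<Longrightarrow> f (tact W t z) = f z"
  by (simp add: invariant_def)

text \<open>The condition on \<open>c\<close> and \<open>d\<close> says by
  \<open>unit_root_pair\<close> that the two points lie on one circle orbit. The value type of
  \<open>h\<close> is left free so that the orbit map itself can be inserted.\<close>

lemma invariant_weightB:
  fixes h :: "complex^(unit + 'k::finite) \<Rightarrow> 'b"
  assumes "invariant (weightB p q) h" "coprime p q" "cmod c = 1" "cmod d = 1" "d ^ p = c ^ q"
    and "\<And>j. w' $ Inr j = d * w $ Inr j" "w' $ Inl () = inverse c * w $ Inl ()"
  shows "h w' = h w"
proof -
  obtain t where t: "cmod t = 1" "t ^ p = c" "t ^ q = d"
    using unit_root_pair[OF assms(2-5)] .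
  have "w' = tact (weightB p q) (\<lambda>_. t) w"
    by (rule vec_sum_eqI) (use assms(6,7) t in auto)
  then show ?thesis
    using invariantD[OF assms(1), of "\<lambda>_. t" w] t(1) by (simp add: torus_def)
qed

text \<open>The arithmetic behind a Type I matrix, with \<open>m\<close>, \<alpha> and \<beta>
  abstract. Faithfulness of the action is represented by the coprimality of \<alpha> and
  \<beta>.\<close>

locale type_I =
  fixes a n m :: "'l::finite \<Rightarrow> nat" and \<alpha> \<beta> :: nat
  assumes a_pos: "\<And>i. 0 < a i" and n_pos: "\<And>i. 0 < n i" and alpha_pos: "0 < \<alpha>"
    and a_dvd: "\<And>i. a i dvd \<alpha>" and am: "\<And>i. a i * m i = n i * \<alpha>" and msum: "(\<Sum>i\<in>UNIV. m i) = \<beta>"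
    and coprime: "coprime \<alpha> \<beta>"
begin

lemma m_pos: "0 < m i"
  using am[of i] n_pos[of i] alpha_pos by (metis gr0I mult_is_0 neq0_conv)

lemma beta_pos: "0 < \<beta>"
  using msum m_pos by (metis UNIV_I finite gr0I sum_eq_0_iff)

text \<open>The values forced by the shell equations:
  \<open>a i * (c i)^2 = n i * \<alpha> / \<beta>\<close> makes \<open>L\<close> match the two
  shells, and the squares add up to 1, which makes \<open>L\<close> isometric. The constant \<kappa>
  is the product of the \<open>c i ^ m i\<close>.\<close>

definition c :: "'l \<Rightarrow> real" where "c i = sqrt (real (m i) / real \<beta>)"

lemma c_pos: "0 < c i"
  using m_pos[of i] beta_pos by (simp add: c_def)

lemma c_nonzero [simp]: "c i \<noteq> 0"
  using c_pos[of i] by simp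

lemma c_power2: "(c i)\<^sup>2 = real (m i) / real \<beta>"
  by (simp add: c_def)

lemma c_sum: "(\<Sum>i\<in>UNIV. (c i)\<^sup>2) = 1"
  using beta_pos by (simp add: c_power2 sum_divide_distrib[symmetric] of_nat_sum[symmetric] msum)

definition L :: "complex^(unit + 'k::finite) \<Rightarrow> complex^('l + 'k)" where
  "L w = (\<chi> j. case j of Inl i \<Rightarrow> c i *\<^sub>R w $ Inl () | Inr j \<Rightarrow> w $ Inr j)"

lemma L_nth [simp]: "L w $ Inl i = c i *\<^sub>R w $ Inl ()" "L w $ Inr j = w $ Inr j"
  by (simp_all add: L_def)

lemma norm_L [simp]: "norm (L w) = norm w"
proof -
  have "(\<Sum>i\<in>UNIV. (cmod (c i *\<^sub>R w $ Inl ()))\<^sup>2) = (\<Sum>i\<in>UNIV. (c i)\<^sup>2) * (cmod (w $ Inl ()))\<^sup>2"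
    by (simp add: power_mult_distrib sum_distrib_right)
  then have "(norm (L w))\<^sup>2 = (norm w)\<^sup>2"
    unfolding norm_vec_sum_power2 by (simp add: c_sum UNIV_unit)
  then show ?thesis by simp
qed

lemma bounded_linear_L: "bounded_linear L"
  by (rule bounded_linear_intro[of L 1])
    (auto intro!: vec_sum_eqI simp: scaleR_add_right scaleR_left_commute)

abbreviation A :: "'l \<Rightarrow> 'l + 'k \<Rightarrow> int" where "A \<equiv> typeI a n"
abbreviation B :: "unit \<Rightarrow> unit + 'k \<Rightarrow> int" where "B \<equiv> weightB \<alpha> \<beta>"

text \<open>Along this homomorphism all of the first l coordinates are multiplied by the same
  \<open>t ^ (-\<alpha>)\<close>, and the others by \<open>t ^ \<beta>\<close>, since the exponents
  \<open>n i * (\<alpha> div a i) = m i\<close> add up to \<beta>.\<close>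

definition hom :: "(unit \<Rightarrow> complex) \<Rightarrow> 'l \<Rightarrow> complex" where
  "hom t i = t () ^ (\<alpha> div a i)"

lemma m_eq: "m i = n i * (\<alpha> div a i)"
  using am[of i] a_dvd[of i] a_pos[of i] by (auto elim!: dvdE)

lemma torus_hom: "torus t \<Longrightarrow> torus (hom t)"
  by (simp add: torus_def hom_def norm_power)

lemma prod_hom: "(\<Prod>i\<in>UNIV. hom t i ^ n i) = t () ^ \<beta>"
  by (simp add: hom_def power_mult[symmetric] msum[symmetric] power_sum m_eq mult.commute)

lemma hom_power: "hom t i ^ a i = t () ^ \<alpha>"
  using a_dvd[of i] by (simp add: hom_def power_mult[symmetric] dvd_div_mult_self)

lemma tact_L: "tact A (hom t) (L w) = L (tact B t w)"
  by (rule vec_sum_eqI) (simp_all add: hom_power prod_hom)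

lemma invariant_L: "invariant A f \<Longrightarrow> invariant B (\<lambda>w. f (L w))"
  unfolding invariant_def by (metis tact_L torus_hom)

text \<open>Division by \<open>c i\<close> absorbs \<kappa>: the monomial in z_1, ..., z_l that
  occurs in q_s is \<kappa> times \<open>Q\<close>.\<close>

definition Q :: "complex^('l + 'k::finite) \<Rightarrow> complex" where
  "Q z = (\<Prod>i\<in>UNIV. (z $ Inl i / c i) ^ m i)"

text \<open>Because \<open>a i * m i = n i * \<alpha>\<close>, every factor contributes a power of
  the one character by which the last k coordinates are multiplied. On V_B the power
  \<open>w_1 ^ \<beta>\<close> has the same relation to the coordinates w_2, ..., w_(k+1).\<close>

lemma Q_tact: "torus u \<Longrightarrow> Q (tact A u z) = inverse ((\<Prod>i\<in>UNIV. u i ^ n i) ^ \<alpha>) * Q z"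
proof -
  have "(tact A u z $ Inl i / c i) ^ m i = inverse ((u i ^ n i) ^ \<alpha>) * (z $ Inl i / c i) ^ m i" for i
    by (simp add: power_mult_distrib power_divide power_inverse power_mult[symmetric] am)
  then show ?thesis
    by (simp add: Q_def prod.distrib prod_power_distrib prod_inversef[symmetric] o_def)
qed

lemma Q_L: "Q (L w) = w $ Inl () ^ \<beta>"
  by (simp add: Q_def scaleR_conv_of_real msum power_sum[symmetric])

lemma cmod_prod_power: "torus u \<Longrightarrow> cmod (\<Prod>i\<in>UNIV. u i ^ n i) = 1"
  by (simp add: torus_def norm_power prod_norm[symmetric])

text \<open>On \<open>M\<^sub>0\<close> the first coordinate of a point of \<open>V\<^sub>B\<close> matters only through its \<open>\<beta>\<close>-th power,
  and \<open>Q\<close> is the lift of that power to \<open>V\<^sub>A\<close>.\<close>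

lemma join_root_invariant:
  assumes "invariant B h" "x ^ \<beta> = Q z" "y ^ \<beta> = Q (tact A u z)" "torus u"
  shows "h (join y (tact A u z)) = h (join x z)"
proof (cases "x = 0")
  case True
  define d where "d = (\<Prod>i\<in>UNIV. u i ^ n i)"
  have d: "cmod d = 1" unfolding d_def by (rule cmod_prod_power[OF assms(4)])
  \<comment> \<open>With vanishing first coordinate any \<beta>-th root of \<open>d\<close> will do:
    the first coordinate imposes no condition on the group element.\<close>
  obtain t where t: "t ^ \<beta> = d"
    using exists_complex_root[of \<beta> d] beta_pos by auto
  have "Q z = 0"
    using True assms(2) beta_pos by (simp add: zero_power)
  then have "y ^ \<beta> = 0"
    using assms(3) Q_tact[OF assms(4), of z] by simp
  then have "y = 0" by simp
  moreover have "cmod t = 1"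
    using power_eq_iff_eq_base[of \<beta> "cmod t" 1] beta_pos d by (simp add: norm_power[symmetric] t)
  then have "cmod (t ^ \<alpha>) = 1" by (simp add: norm_power)
  moreover have "d ^ \<alpha> = (t ^ \<alpha>) ^ \<beta>"
    by (simp add: t[symmetric] power_mult[symmetric] mult.commute)
  ultimately show ?thesis
    using True d by (intro invariant_weightB[OF assms(1) coprime, of "t ^ \<alpha>" d]) (simp_all add: d_def)
next
  case False
  define d where "d = (\<Prod>i\<in>UNIV. u i ^ n i)"
  have d: "cmod d = 1" unfolding d_def by (rule cmod_prod_power[OF assms(4)])
  have yb: "y ^ \<beta> = inverse (d ^ \<alpha>) * x ^ \<beta>"
    using assms Q_tact[OF assms(4), of z] by (simp add: d_def)
  have "cmod (y ^ \<beta>) = cmod (x ^ \<beta>)"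
    using yb d by (simp add: norm_mult norm_inverse norm_power)
  then have "cmod y = cmod x"
    using beta_pos by (simp add: norm_power power_eq_iff_eq_base)
  with False have "y \<noteq> 0" "cmod (x / y) = 1"
    by (auto simp: norm_divide)
  moreover have "d ^ \<alpha> \<noteq> 0" using d by auto
  then have "d ^ \<alpha> = (x / y) ^ \<beta>"
    unfolding power_divide yb using False by (simp add: divide_inverse)
  ultimately show ?thesis
    using False d
    by (intro invariant_weightB[OF assms(1) coprime, of "x / y" d]) (simp_all add: d_def)
qed

end

subsection \<open>Lifting flat functions\<close>

lemma bounded_linear_join: "bounded_linear (\<lambda>v :: complex^('i::finite + 'k::finite). join (g v) v)"
  if "bounded_linear g"
proof -
  interpret g: bounded_linear g by fact
  have "linear (\<lambda>v :: complex^('i + 'k). join (g v) v)"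
    by (rule linearI) (auto intro!: vec_sum_eqI simp: g.add g.scaleR)
  then show ?thesis by (rule linear_conv_bounded_linear[THEN iffD1])
qed

lemma has_derivative_join:
  fixes g :: "complex^('i::finite + 'k::finite) \<Rightarrow> complex"
  assumes "(g has_derivative g') (at z)"
  shows "((\<lambda>z. join (g z) z) has_derivative (\<lambda>v. join (g' v) v)) (at z)"
proof -
  have lin: "bounded_linear (\<lambda>(x, z :: complex^('i + 'k)). join x z)"
  proof -
    have "linear (\<lambda>(x, z :: complex^('i + 'k)). join x z)"
      by (rule linearI) (auto intro!: vec_sum_eqI)
    then show ?thesis by (rule linear_conv_bounded_linear[THEN iffD1])
  qed
  from has_derivative_compose[OF has_derivative_Pair[OF assms has_derivative_ident]
      bounded_linear_imp_has_derivative[OF lin]]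
  show ?thesis by simp
qed

lemma smooth_Re_nth: "smooth (\<lambda>w :: complex^'n::finite. Re (k * w $ i))"
  and smooth_Im_nth: "smooth (\<lambda>w :: complex^'n::finite. Im (k * w $ i))"
proof -
  have l: "bounded_linear (\<lambda>w :: complex^'n. k * w $ i)"
    by (intro bounded_linear_compose[OF bounded_linear_mult_right] bounded_linear_vec_nth)
  show "smooth (\<lambda>w :: complex^'n. Re (k * w $ i))" "smooth (\<lambda>w :: complex^'n. Im (k * w $ i))"
    by (intro smooth_bounded_linear bounded_linear_compose[OF bounded_linear_Re l]
        bounded_linear_compose[OF bounded_linear_Im l])+
qed

lemma times_fun_one: "(*) (1 :: complex) = (\<lambda>v. v)"
  by auto

section \<open>The multivalued root of \<open>Q\<close> and its derivative\<close>

context type_I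
begin

text \<open>A \<beta>-th root of \<open>Q\<close> on \<open>units\<close> built from principal
  logarithms. It jumps across their cuts, so it is only ever inserted into functions that do not see
  \<beta>-th roots of unity. As an exponential it is nonzero everywhere, even off
  \<open>units\<close>.\<close>

definition root :: "complex^('l + 'k::finite) \<Rightarrow> complex" where
  "root z = exp (\<Sum>i\<in>UNIV. of_real (real (m i) / real \<beta>) * Ln (z $ Inl i / c i))"

text \<open>The logarithmic derivative of the root of \<open>Q\<close> at \<open>z\<close> in
  direction \<open>v\<close>.\<close>

definition dlog :: "complex^('l + 'k::finite) \<Rightarrow> complex^('l + 'k) \<Rightarrow> complex" where
  "dlog v z = (\<Sum>i\<in>UNIV. of_real (real (m i) / real \<beta>) * (v $ Inl i / z $ Inl i))"

definition units :: "(complex^('l + 'k::finite)) set" where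
  "units = {z. \<forall>i. z $ Inl i \<noteq> 0}"

lemma open_units: "open units"
  unfolding units_def Collect_all_eq
  by (intro open_INT ballI open_Collect_neq continuous_intros) auto

lemma root_power: "z \<in> units \<Longrightarrow> root z ^ \<beta> = Q z"
proof -
  assume z: "z \<in> units"
  have "root z ^ \<beta> = exp (\<Sum>i\<in>UNIV. of_nat (m i) * Ln (z $ Inl i / c i))"
    using beta_pos by (simp add: root_def exp_of_nat_mult[symmetric] sum_distrib_left)
  also have "\<dots> = Q z"
    using z by (simp add: exp_sum exp_of_nat_mult Q_def units_def)
  finally show ?thesis .
qed

lemma root_nonzero [simp]: "root z \<noteq> 0"
  by (simp add: root_def)

text \<open>A branch that is differentiable at \<open>z0\<close>: the logarithms are taken of
  quotients that are close to 1 when \<open>z\<close> is close to \<open>z0\<close>. It differs from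
  \<open>root\<close> by a \<beta>-th root of unity on \<open>units\<close>.\<close>

definition branch :: "complex^('l + 'k::finite) \<Rightarrow> complex^('l + 'k) \<Rightarrow> complex" where
  "branch z0 z = root z0 * exp (\<Sum>i\<in>UNIV. of_real (real (m i) / real \<beta>) * Ln (z $ Inl i / z0 $ Inl i))"

lemma branch_self: "z \<in> units \<Longrightarrow> branch z z = root z"
  by (simp add: branch_def units_def)

lemma branch_power:
  assumes "z0 \<in> units" "z \<in> units"
  shows "branch z0 z ^ \<beta> = Q z"
proof -
  have "branch z0 z ^ \<beta> = Q z0 * exp (\<Sum>i\<in>UNIV. of_nat (m i) * Ln (z $ Inl i / z0 $ Inl i))"
    using beta_pos
    by (simp add: branch_def power_mult_distrib root_power[OF assms(1)] exp_of_nat_mult[symmetric] sum_distrib_left)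
  also have "\<dots> = Q z"
    using assms by (simp add: exp_sum exp_of_nat_mult Q_def units_def prod.distrib[symmetric]
        power_mult_distrib[symmetric])
  finally show ?thesis .
qed

lemma has_derivative_branch:
  assumes "z \<in> units"
  shows "(branch z has_derivative (\<lambda>v. root z * dlog v z)) (at z)"
proof -
  have 1: "((\<lambda>y. Ln (y $ Inl i / z $ Inl i)) has_derivative (\<lambda>v. v $ Inl i / z $ Inl i)) (at z)" for i
  proof -
    have "((\<lambda>y. y $ Inl i / z $ Inl i) has_derivative (\<lambda>v. v $ Inl i / z $ Inl i)) (at z)"
      using assms bounded_linear_imp_has_derivative[OF bounded_linear_vec_nth, of "Inl i"]
      by (auto intro!: derivative_eq_intros simp: units_def)
    moreover have "(Ln has_derivative (\<lambda>v. v)) (at (z $ Inl i / z $ Inl i))"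
      using has_field_derivative_Ln[of "z $ Inl i / z $ Inl i"] assms
      by (simp add: units_def has_field_derivative_def times_fun_one)
    ultimately show ?thesis by (rule has_derivative_compose)
  qed
  have "((\<lambda>y. \<Sum>i\<in>UNIV. of_real (real (m i) / real \<beta>) * Ln (y $ Inl i / z $ Inl i))
      has_derivative (\<lambda>v. dlog v z)) (at z)"
    unfolding dlog_def by (intro has_derivative_sum has_derivative_mult_right 1)
  moreover have "(exp has_derivative (\<lambda>v. v))
      (at (\<Sum>i\<in>UNIV. of_real (real (m i) / real \<beta>) * Ln (z $ Inl i / z $ Inl i)))"
    using DERIV_exp[of "0 :: complex"] assms 
    by (simp add: has_field_derivative_def units_def times_fun_one)
  ultimately have "((\<lambda>y. exp (\<Sum>i\<in>UNIV. of_real (real (m i) / real \<beta>) * Ln (y $ Inl i / z $ Inl i)))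
      has_derivative (\<lambda>v. dlog v z)) (at z)"
    by (rule has_derivative_compose)
  then show ?thesis
    unfolding branch_def[abs_def] by (rule has_derivative_mult_right)
qed

section \<open>Functions that do not see the choice of the root\<close>

text \<open>The remnant of circle invariance that survives differentiation: derivatives in the last
  k directions need not be invariant under the circle, but they remain invariant under these
  rotations.\<close>

definition rot_inv :: "(complex^(unit + 'k::finite) \<Rightarrow> real) \<Rightarrow> bool" where
  "rot_inv h \<longleftrightarrow> (\<forall>s w. s ^ \<beta> = 1 \<longrightarrow> h (join (s * w $ Inl ()) w) = h w)"

lemma rot_inv_join: "rot_inv h \<Longrightarrow> x ^ \<beta> = y ^ \<beta> \<Longrightarrow> h (join x z) = h (join y z)"
proof (cases "y = 0")
  case False
  assume "rot_inv h" "x ^ \<beta> = y ^ \<beta>"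
  moreover have "join (x / y * join y z $ Inl ()) (join y z) = join x z"
    using False by (intro vec_sum_eqI) auto
  moreover from calculation(2) False have "(x / y) ^ \<beta> = 1"
    by (simp add: power_divide)
  ultimately show ?thesis
    unfolding rot_inv_def by metis
next
  case True
  assume "x ^ \<beta> = y ^ \<beta>"
  with True have "x ^ \<beta> = 0" using beta_pos by (simp add: zero_power)
  with True show ?thesis by simp
qed

lemma rot_inv_mult: "rot_inv g \<Longrightarrow> rot_inv h \<Longrightarrow> rot_inv (\<lambda>w. g w * h w)"
  by (simp add: rot_inv_def)

lemma rot_inv_dd:
  assumes "smooth h" "rot_inv h" "s ^ \<beta> = 1"
  shows "dd (join (s * v $ Inl ()) v) h (join (s * w $ Inl ()) w) = dd v h w"
proof -
  let ?r = "\<lambda>w. join (s * w $ Inl ()) w"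
  have "bounded_linear ?r"
    by (intro bounded_linear_join bounded_linear_compose[OF bounded_linear_mult_right] bounded_linear_vec_nth)
  from dd_compose_linear[OF smooth_differentiable[OF assms(1)] this, of v w]
  show ?thesis
    using assms(2,3) by (simp add: rot_inv_def)
qed

text \<open>The radial and the angular derivative in the first coordinate, the latter for \<open>k = \<i>\<close>;
  unlike the partial derivatives they preserve invariance under roots of unity.\<close>

definition pol :: "complex \<Rightarrow> (complex^(unit + 'k::finite) \<Rightarrow> real) \<Rightarrow> complex^(unit + 'k) \<Rightarrow> real" where
  "pol k h w = Re (k * w $ Inl ()) * dd (axis (Inl ()) 1) h w + Im (k * w $ Inl ()) * dd (axis (Inl ()) \<i>) h w"

lemma dd_join:
  assumes "smooth h"
  shows "dd (join x v) h w = Re x * dd (axis (Inl ()) 1) h w + Im x * dd (axis (Inl ()) \<i>) h w + dd (join 0 v) h w"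
proof -
  note lin = dd_linear[OF assms, of w]
  have "join x v = Re x *\<^sub>R axis (Inl ()) 1 + Im x *\<^sub>R axis (Inl ()) \<i> + join 0 v"
    by (rule vec_sum_eqI) (auto simp: complex_eq_iff axis_def)
  then show ?thesis
    using linear_add[OF lin] linear_scale[OF lin] by simp
qed

text \<open>\<open>pol k\<close> is the derivative along the linear vector field
  \<open>k * w_1\<close> in the first coordinate, which commutes with rotations of that
  coordinate.\<close>

lemma pol_eq:
  fixes w :: "complex^(unit + 'k::finite)"
  assumes "smooth h"
  shows "pol k h w = dd (join (k * w $ Inl ()) (0 :: complex^(unit + 'k))) h w"
proof -
  have "join 0 (0 :: complex^(unit + 'k)) = 0"
    by (rule vec_sum_eqI) auto
  then show ?thesis
    using dd_join[OF assms, of "k * w $ Inl ()" "0 :: complex^(unit + 'k)" w] linear_0[OF dd_linear[OF assms], of w]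
    by (simp add: pol_def)
qed

text \<open>A tangent vector of the form \<open>x * w\<close> in the first coordinate splits into
  radial and angular parts with coefficients \<open>Re x\<close> and \<open>Im x\<close>. With
  \<open>x\<close> the logarithmic derivative of the root, this writes the derivative of a lift in
  lifts again.\<close>

lemma dd_join_mult:
  assumes "smooth h"
  shows "dd (join (x * w) v) h (join w z)
    = Re x * pol 1 h (join w z) + Im x * pol \<i> h (join w z) + dd (join 0 v) h (join w z)"
  unfolding dd_join[OF assms, of "x * w"] pol_def by (simp add: algebra_simps)

definition good :: "(complex^(unit + 'k::finite) \<Rightarrow> real) \<Rightarrow> bool" where
  "good h \<longleftrightarrow> smooth h \<and> flat h \<and> rot_inv h"

lemma good_pol:
  fixes h :: "complex^(unit + 'k::finite) \<Rightarrow> real"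
  assumes "good h"
  shows "good (pol k h)"
proof -
  have h: "smooth h" "flat h" "rot_inv h" using assms by (auto simp: good_def)
  have "rot_inv (pol k h)"
    unfolding rot_inv_def pol_eq[OF h(1)]
  proof (intro allI impI)
    fix s :: complex and w :: "complex^(unit + 'k)" assume "s ^ \<beta> = 1"
    from rot_inv_dd[OF h(1,3) this, of "join (k * w $ Inl ()) (0 :: complex^(unit + 'k))" w]
    have "dd (join (s * (k * w $ Inl ())) (join (k * w $ Inl ()) (0 :: complex^(unit + 'k)))) h (join (s * w $ Inl ()) w)
        = dd (join (k * w $ Inl ()) (0 :: complex^(unit + 'k))) h w" by simp
    moreover have "join (s * (k * w $ Inl ())) (join (k * w $ Inl ()) (0 :: complex^(unit + 'k)))
        = join (k * join (s * w $ Inl ()) w $ Inl ()) (0 :: complex^(unit + 'k))"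
      by (rule vec_sum_eqI) auto
    ultimately show "dd (join (k * join (s * w $ Inl ()) w $ Inl ()) (0 :: complex^(unit + 'k))) h (join (s * w $ Inl ()) w) =
        dd (join (k * w $ Inl ()) (0 :: complex^(unit + 'k))) h w" by simp
  qed
  moreover have "smooth (pol k h)"
    unfolding pol_def by (intro smooth_add smooth_mult smooth_Re_nth smooth_Im_nth smooth_dd h)
  moreover have "flat (pol k h)"
    unfolding pol_def
    by (intro flat_add flat_mult flat_dd h smooth_continuous smooth_Re_nth smooth_Im_nth)
  ultimately show ?thesis by (simp add: good_def)
qed

lemma good_dd:
  assumes "good h"
  shows "good (dd (join 0 v) h)"
proof -
  have h: "smooth h" "flat h" "rot_inv h" using assms by (auto simp: good_def)
  have "join (s * join 0 v $ Inl ()) (join 0 v) = join 0 v" for s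
    by (rule vec_sum_eqI) auto
  then have "rot_inv (dd (join 0 v) h)"
    using rot_inv_dd[OF h(1,3), where v = "join 0 v"] by (simp add: rot_inv_def)
  then show ?thesis using h by (simp add: good_def smooth_dd flat_dd)
qed

lemma good_mult: "good h \<Longrightarrow> smooth g \<Longrightarrow> rot_inv g \<Longrightarrow> good (\<lambda>w. g w * h w)"
  by (simp add: good_def smooth_mult flat_mult smooth_continuous rot_inv_mult)

text \<open>Computed with the differentiable branch at \<open>z\<close>, then transferred to
  \<open>root\<close>: the two have equal \<beta>-th powers, so a rotation-invariant
  \<open>h\<close> takes the same value on both.\<close>

lemma has_derivative_lift:
  assumes "good h" "z \<in> units"
  shows "((\<lambda>z. h (join (root z) z)) has_derivative
      (\<lambda>v. Re (dlog v z) * pol 1 h (join (root z) z) + Im (dlog v z) * pol \<i> h (join (root z) z)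
        + dd (join 0 v) h (join (root z) z))) (at z)"
proof -
  have h: "smooth h" "rot_inv h" using assms by (auto simp: good_def)
  have "((\<lambda>y. h (join (branch z y) y)) has_derivative
      (\<lambda>v. dd (join (root z * dlog v z) v) h (join (branch z z) z))) (at z)"
    by (rule has_derivative_compose[OF has_derivative_join[OF has_derivative_branch[OF assms(2)]]
          smooth_has_derivative[OF h(1)]])
  then have "((\<lambda>y. h (join (branch z y) y)) has_derivative
      (\<lambda>v. Re (dlog v z) * pol 1 h (join (root z) z) + Im (dlog v z) * pol \<i> h (join (root z) z)
        + dd (join 0 v) h (join (root z) z))) (at z)"
    unfolding branch_self[OF assms(2)] mult.commute[of "root z"] dd_join_mult[OF h(1)] .
  then show ?thesis
    by (rule has_derivative_transform_within_open[OF _ open_units assms(2)])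
      (intro rot_inv_join[OF h(2)], simp add: branch_power[OF assms(2)] root_power)
qed

text \<open>The modulus does not depend on the choice of the root, so \<open>R2\<close> is
  differentiable on \<open>units\<close> although \<open>root\<close> may jump. \<open>R2\<close>
  and \<open>S2\<close> are the two parts of the squared norm of
  \<open>join (root z) z\<close>.\<close>

definition R2 :: "complex^('l + 'k::finite) \<Rightarrow> real" where "R2 z = (cmod (root z))\<^sup>2"

definition S2 :: "complex^('l + 'k::finite) \<Rightarrow> real" where "S2 z = (\<Sum>j\<in>UNIV. (cmod (z $ Inr j))\<^sup>2)"

lemma R2_pos: "0 < R2 z"
  by (simp add: R2_def)

lemma R2_eq_branch: "z0 \<in> units \<Longrightarrow> z \<in> units \<Longrightarrow> R2 z = (cmod (branch z0 z))\<^sup>2"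
  using power_eq_iff_eq_base[of \<beta> "cmod (root z)" "cmod (branch z0 z)"] beta_pos
  by (simp add: R2_def norm_power[symmetric] branch_power root_power)

lemma has_derivative_cmod_power2:
  fixes f :: "'a::real_normed_vector \<Rightarrow> complex"
  assumes "(f has_derivative f') (at x)"
  shows "((\<lambda>x. (cmod (f x))\<^sup>2) has_derivative (\<lambda>v. 2 * Re (cnj (f x) * f' v))) (at x)"
  unfolding power2_norm_eq_inner
  by (rule has_derivative_eq_rhs[OF has_derivative_inner[OF assms assms]])
    (auto simp: inner_complex_def fun_eq_iff)

lemma has_derivative_R2:
  assumes "z \<in> units"
  shows "(R2 has_derivative (\<lambda>v. R2 z * (2 * Re (dlog v z)))) (at z)"
proof -
  have *: "cnj (root z) * (root z * x) = of_real (R2 z) * x" for x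
    using complex_norm_square[of "root z"] by (simp only: R2_def mult_ac)
  have "((\<lambda>y. (cmod (branch z y))\<^sup>2) has_derivative (\<lambda>v. R2 z * (2 * Re (dlog v z)))) (at z)"
    by (rule has_derivative_eq_rhs[OF has_derivative_cmod_power2[OF has_derivative_branch[OF assms]]])
      (simp only: branch_self[OF assms] *, simp add: mult.left_commute)
  then show ?thesis
    by (rule has_derivative_transform_within_open[OF _ open_units assms])
      (simp add: R2_eq_branch[OF assms])
qed

lemma has_derivative_S2:
  "(S2 has_derivative (\<lambda>v. \<Sum>j\<in>UNIV. 2 * Re (cnj (z $ Inr j) * v $ Inr j))) (at z)"
  unfolding S2_def
  by (intro has_derivative_sum has_derivative_cmod_power2 bounded_linear_imp_has_derivative
      bounded_linear_vec_nth)

end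

text \<open>Applied to \<open>S2 / R2\<close> both bounds matter: the upper one controls
  \<open>join (root z) z\<close> by its first coordinate, the lower one keeps that point bounded
  when \<open>z\<close> is.\<close>

definition supp_pos :: "(real \<Rightarrow> real) \<Rightarrow> bool" where
  "supp_pos b \<longleftrightarrow> (\<exists>p q. 0 < p \<and> (\<forall>x. x < p \<or> q < x \<longrightarrow> b x = 0))"

lemma supp_pos_mult: "supp_pos b \<Longrightarrow> supp_pos (\<lambda>x. g x * b x)"
  unfolding supp_pos_def by (metis mult_zero_right)

lemma supp_pos_dd:
  assumes "supp_pos b"
  shows "supp_pos (dd 1 b)"
proof -
  obtain p q where pq: "0 < p" "\<And>x. x < p \<or> q < x \<Longrightarrow> b x = 0"
    using assms unfolding supp_pos_def by blast
  have "dd 1 b x = 0" if "x < p \<or> q < x" for x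
  proof -
    have "(b has_derivative (\<lambda>_. 0)) (at x)"
      by (rule has_derivative_transform_within_open[of "\<lambda>_. 0" "\<lambda>_. 0" _ _ "{..<p} \<union> {q<..}"])
        (use that pq(2) in auto)
    then show ?thesis by (rule dd_eqI)
  qed
  then show ?thesis using pq(1) unfolding supp_pos_def by blast
qed

lemma dd_real: "smooth b \<Longrightarrow> dd x b y = x * dd 1 b (y :: real)"
  using linear_scale[OF dd_linear[of b y], of x 1] by simp

section \<open>A class of lifted flat functions closed under differentiation\<close>

context type_I
begin

text \<open>The rules \<open>div\<close> and \<open>inv\<close> admit the poles that differentiation
  creates, through the logarithmic derivative of the root and through the quotient
  \<open>S2 / R2\<close>. All members vanish off \<open>units\<close>.\<close>

inductive flat_lift :: "(complex^('l + 'k::finite) \<Rightarrow> real) \<Rightarrow> bool" where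
  base: "smooth b \<Longrightarrow> supp_pos b \<Longrightarrow> good h \<Longrightarrow>
    flat_lift (\<lambda>z. if z \<in> units then b (S2 z / R2 z) * h (join (root z) z) else 0)"
| div: "flat_lift f \<Longrightarrow> flat_lift (\<lambda>z. Re (x / z $ Inl i) * f z)"
| inv: "flat_lift f \<Longrightarrow> flat_lift (\<lambda>z. inverse (R2 z) * f z)"
| scale: "flat_lift f \<Longrightarrow> flat_lift (\<lambda>z. r * f z)"
| add: "flat_lift f \<Longrightarrow> flat_lift g \<Longrightarrow> flat_lift (\<lambda>z. f z + g z)"

lemma flat_lift_zero: "flat_lift f \<Longrightarrow> z \<notin> units \<Longrightarrow> f z = 0"
  by (induction rule: flat_lift.induct) auto

text \<open>The member \<open>f\<close> is there for the empty sum: it yields the zero function as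
  \<open>0 * f z\<close>.\<close>

lemma flat_lift_sum:
  fixes f :: "complex^('l + 'k::finite) \<Rightarrow> real" and g :: "'i \<Rightarrow> complex^('l + 'k) \<Rightarrow> real"
  shows "flat_lift f \<Longrightarrow> (\<And>i. i \<in> I \<Longrightarrow> flat_lift (g i)) \<Longrightarrow> flat_lift (\<lambda>z. \<Sum>i\<in>I. g i z)"
proof (induction I rule: infinite_finite_induct)
  case (insert i I)
  then show ?case using flat_lift.add[of "g i"] by simp
qed (use flat_lift.scale[of f 0] in auto)

lemma flat_lift_dlog:
  assumes "flat_lift f"
  shows "flat_lift (\<lambda>z. Re (x * dlog v z) * f z)"
proof -
  have "flat_lift (\<lambda>z. \<Sum>i\<in>UNIV. Re ((x * of_real (real (m i) / real \<beta>) * v $ Inl i) / z $ Inl i) * f z)"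
    by (intro flat_lift_sum[OF assms] flat_lift.div assms)
  then show ?thesis
    by (simp add: dlog_def sum_distrib_left sum_distrib_right mult.assoc)
qed

text \<open>As each \<open>m i\<close> is positive, \<open>Q\<close> is divisible by each of the
  first l coordinates, with a cofactor bounded on balls. So a pole \<open>1 / z_i\<close> costs one
  power of \<open>Q\<close>.\<close>

lemma cmod_Q_bounds:
  obtains D where "0 < D"
    "\<And>(z :: complex^('l + 'k::finite)) i. norm z \<le> K \<Longrightarrow> cmod (Q z) \<le> D * cmod (z $ Inl i)"
    "\<And>z :: complex^('l + 'k). norm z \<le> K \<Longrightarrow> cmod (Q z) \<le> D"
proof -
  define G where "G i z = inverse (c i) * (z $ Inl i / c i) ^ (m i - 1) *
    (\<Prod>j\<in>UNIV - {i}. (z $ Inl j / c j) ^ m j)" for i and z :: "complex^('l + 'k)"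
  have Q: "Q z = G i z * z $ Inl i" for i z
    using m_pos[of i] by (simp add: Q_def G_def prod.remove[of UNIV i] power_eq_if[of _ "m i"] divide_inverse mult_ac)
  have "\<exists>C\<ge>0. \<forall>z. norm z \<le> K \<longrightarrow> \<bar>cmod (G i z)\<bar> \<le> C" for i
    by (rule continuous_bounded_cball[of "\<lambda>z. cmod (G i z)" K])
      (auto simp: G_def intro!: continuous_intros)
  then obtain C where C: "\<And>i. 0 \<le> C i" "\<And>i z. norm z \<le> K \<Longrightarrow> cmod (G i z) \<le> C i"
    by (metis abs_norm_cancel)
  define E where "E = (\<Sum>i\<in>UNIV. C i)"
  have E: "cmod (Q z) \<le> E * cmod (z $ Inl i)" if "norm z \<le> K" for z :: "complex^('l + 'k)" and i
    using C(2)[OF that, of i] member_le_sum[of i UNIV C] C(1)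
    unfolding E_def Q[of z i] norm_mult by (intro mult_right_mono) (auto intro: order_trans)
  have E0: "0 \<le> E" by (simp add: E_def C(1) sum_nonneg)
  show ?thesis
  proof (rule that[of "E * \<bar>K\<bar> + E + 1"])
    fix z :: "complex^('l + 'k)" assume z: "norm z \<le> K"
    show "cmod (Q z) \<le> (E * \<bar>K\<bar> + E + 1) * cmod (z $ Inl i)" for i
      using E[OF z, of i] E0 by (simp add: distrib_right add_increasing add_increasing2)
    have "E * cmod (z $ Inl undefined) \<le> E * \<bar>K\<bar>"
      using Finite_Cartesian_Product.norm_nth_le[of z "Inl undefined"] z E0 by (intro mult_left_mono) auto
    then show "cmod (Q z) \<le> E * \<bar>K\<bar> + E + 1"
      using E[OF z, of undefined] E0 by simp
  qed (use E0 in \<open>simp add: add_nonneg_pos\<close>)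
qed

lemma cmod_Q_pos: "z \<in> units \<Longrightarrow> 0 < cmod (Q z)"
  using root_power[of z] by (metis power_not_zero root_nonzero zero_less_norm_iff)

lemma cmod_root_power: "z \<in> units \<Longrightarrow> cmod (root z) ^ \<beta> = cmod (Q z)"
  by (metis norm_power root_power)

text \<open>Every member is smaller than any power of \<open>Q\<close> on bounded sets. The order
  \<open>N\<close> is generalised in the induction because division by a coordinate uses up one
  power of \<open>Q\<close> and division by \<open>R2\<close> uses up two.\<close>

lemma flat_lift_bound:
  fixes f :: "complex^('l + 'k::finite) \<Rightarrow> real"
  assumes "flat_lift f"
  shows "\<exists>C. \<forall>z\<in>units. norm z \<le> K \<longrightarrow> \<bar>f z\<bar> \<le> C * cmod (Q z) ^ N"
  using assms
proof (induction arbitrary: N)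
  case (base b h)
  obtain p q where pq: "0 < p" "\<And>x. x < p \<or> q < x \<Longrightarrow> b x = 0"
    using base(2) unfolding supp_pos_def by blast
  obtain Cb where Cb: "\<And>x. norm x \<le> \<bar>q\<bar> \<Longrightarrow> \<bar>b x\<bar> \<le> Cb"
    using continuous_bounded_cball[OF smooth_continuous[OF base(1)]] by metis
  \<comment> \<open>On the support of \<open>b\<close> one has \<open>R2 z \<le> S2 z / p\<close>,
    and \<open>S2 z\<close> is at most \<open>K\<close> squared; so the point at which
    \<open>h\<close> is evaluated has norm at most \<open>K'\<close>.\<close>
  define K' where "K' = sqrt (K\<^sup>2 / p + K\<^sup>2)"
  obtain C where C: "0 \<le> C" "\<And>w. norm w \<le> K' \<Longrightarrow> \<bar>h w\<bar> \<le> C * norm w ^ (\<beta> * N)"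
    using flat_bound[of h K' "\<beta> * N"] base(3) smooth_continuous unfolding good_def by blast
  \<comment> \<open>From \<open>S2 z \<le> \<bar>q\<bar> * R2 z\<close> the point has norm at most
    \<open>s * cmod (root z)\<close>, and the \<beta>-th power of \<open>cmod (root z)\<close> is
    \<open>cmod (Q z)\<close>. Hence flatness of order \<open>\<beta> * N\<close> gives the power
    \<open>N\<close> of \<open>Q\<close>.\<close>
  define s where "s = sqrt (1 + \<bar>q\<bar>)"
  show ?case
  proof (intro exI[of _ "\<bar>Cb\<bar> * (C * s ^ (\<beta> * N))"] ballI impI)
    fix z :: "complex^('l + 'k)" assume z: "z \<in> units" "norm z \<le> K"
    let ?w = "join (root z) z"
    show "\<bar>if z \<in> units then b (S2 z / R2 z) * h ?w else 0\<bar> \<le> \<bar>Cb\<bar> * (C * s ^ (\<beta> * N)) * cmod (Q z) ^ N"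
    proof (cases "b (S2 z / R2 z) = 0")
      case True
      then show ?thesis using C(1) by (simp add: s_def)
    next
      case False
      then have x: "p \<le> S2 z / R2 z" "S2 z / R2 z \<le> q" using pq(2) by force+
      have S: "0 \<le> S2 z" "S2 z \<le> K\<^sup>2"
      proof -
        show "0 \<le> S2 z" by (simp add: S2_def sum_nonneg)
        have "S2 z \<le> (norm z)\<^sup>2"
          unfolding norm_vec_sum_power2 S2_def by (simp add: sum_nonneg)
        also have "\<dots> \<le> K\<^sup>2" using z(2) by (intro power_mono) auto
        finally show "S2 z \<le> K\<^sup>2" .
      qed
      have n2: "(norm ?w)\<^sup>2 = R2 z + S2 z"
        unfolding norm_vec_sum_power2 by (simp add: R2_def S2_def UNIV_unit)
      have "R2 z \<le> S2 z / p"
        using x(1) pq(1) R2_pos[of z] by (simp add: field_simps)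
      also have "\<dots> \<le> K\<^sup>2 / p" using S pq(1) by (intro divide_right_mono) auto
      finally have "(norm ?w)\<^sup>2 \<le> K\<^sup>2 / p + K\<^sup>2" using n2 S by simp
      then have K': "norm ?w \<le> K'" unfolding K'_def by (rule real_le_rsqrt)
      have "S2 z \<le> \<bar>q\<bar> * R2 z"
        using x(2) R2_pos[of z] by (simp add: field_simps)
          (metis abs_ge_self mult.commute mult_right_mono order_trans less_imp_le)
      then have "(norm ?w)\<^sup>2 \<le> (1 + \<bar>q\<bar>) * R2 z" using n2 by (simp add: algebra_simps)
      then have "norm ?w \<le> sqrt ((1 + \<bar>q\<bar>) * R2 z)" by (rule real_le_rsqrt)
      also have "\<dots> = s * cmod (root z)"
        by (simp add: s_def R2_def real_sqrt_mult)
      finally have "norm ?w ^ (\<beta> * N) \<le> (s * cmod (root z)) ^ (\<beta> * N)"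
        by (intro power_mono) auto
      also have "\<dots> = s ^ (\<beta> * N) * cmod (Q z) ^ N"
        by (simp add: power_mult_distrib power_mult cmod_root_power[OF z(1)])
      finally have "\<bar>h ?w\<bar> \<le> C * (s ^ (\<beta> * N) * cmod (Q z) ^ N)"
        using C(2)[OF K'] C(1) by (meson mult_left_mono order_trans)
      moreover have "\<bar>b (S2 z / R2 z)\<bar> \<le> \<bar>Cb\<bar>"
        using Cb[of "S2 z / R2 z"] x pq(1) by force
      ultimately have "\<bar>b (S2 z / R2 z) * h ?w\<bar> \<le> \<bar>Cb\<bar> * (C * (s ^ (\<beta> * N) * cmod (Q z) ^ N))"
        unfolding abs_mult by (intro mult_mono) auto
      then show ?thesis using z(1) by (simp add: mult.assoc)
    qed
  qed
next
  case (div f x i)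
  obtain D where D: "0 < D" "\<And>z :: complex^('l + 'k). norm z \<le> K \<Longrightarrow> cmod (Q z) \<le> D * cmod (z $ Inl i)"
    using cmod_Q_bounds[of K] by metis
  obtain C where C: "\<And>z. z \<in> units \<Longrightarrow> norm z \<le> K \<Longrightarrow> \<bar>f z\<bar> \<le> C * cmod (Q z) ^ Suc N"
    using div.IH by blast
  show ?case
  proof (intro exI[of _ "cmod x * D * C"] ballI impI)
    fix z :: "complex^('l + 'k)" assume z: "z \<in> units" "norm z \<le> K"
    have zi: "z $ Inl i \<noteq> 0" using z(1) by (simp add: units_def)
    have "\<bar>Re (x / z $ Inl i)\<bar> \<le> cmod x / cmod (z $ Inl i)"
      using abs_Re_le_cmod[of "x / z $ Inl i"] by (simp add: norm_divide)
    also have "\<dots> \<le> cmod x * (D / cmod (Q z))"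
      using D(2)[OF z(2)] zi cmod_Q_pos[OF z(1)]
      unfolding divide_inverse[of "cmod x"] by (intro mult_left_mono) (auto simp: field_simps)
    finally have "\<bar>Re (x / z $ Inl i) * f z\<bar> \<le> cmod x * (D / cmod (Q z)) * (C * cmod (Q z) ^ Suc N)"
      unfolding abs_mult using C[OF z] by (intro mult_mono) (auto simp: D(1) less_imp_le)
    then show "\<bar>Re (x / z $ Inl i) * f z\<bar> \<le> cmod x * D * C * cmod (Q z) ^ N"
      using cmod_Q_pos[OF z(1)] by simp
  qed
next
  case (inv f)
  obtain D where D: "0 < D" "\<And>z :: complex^('l + 'k). norm z \<le> K \<Longrightarrow> cmod (Q z) \<le> D"
    using cmod_Q_bounds[of K] by metis
  \<comment> \<open>Since \<open>R2 ^ \<beta>\<close> is the squared modulus of \<open>Q\<close>,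
    splitting off one factor \<open>R2\<close> and bounding the others by \<open>E\<close> trades
    \<open>inverse (R2 z)\<close> for two powers of \<open>Q\<close>.\<close>
  define E where "E = (max 1 D)\<^sup>2 ^ \<beta>"
  obtain C where C: "\<And>z. z \<in> units \<Longrightarrow> norm z \<le> K \<Longrightarrow> \<bar>f z\<bar> \<le> C * cmod (Q z) ^ (N + 2)"
    using inv.IH by blast
  show ?case
  proof (intro exI[of _ "E * C"] ballI impI)
    fix z :: "complex^('l + 'k)" assume z: "z \<in> units" "norm z \<le> K"
    have r: "cmod (root z) \<le> max 1 D"
    proof (rule ccontr)
      assume "\<not> ?thesis"
      then have *: "max 1 D < cmod (root z)" by (simp only: not_le)
      then have "cmod (root z) ^ 1 \<le> cmod (root z) ^ \<beta>"
        using beta_pos by (intro power_increasing) auto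
      then show False
        using * D(2)[OF z(2)] cmod_root_power[OF z(1)] by simp
    qed
    have "cmod (Q z) ^ 2 = R2 z ^ \<beta>"
      by (simp add: cmod_root_power[OF z(1), symmetric] R2_def power_mult[symmetric] mult.commute)
    also have "\<dots> = R2 z * R2 z ^ (\<beta> - 1)"
      using beta_pos by (simp add: power_eq_if)
    also have "\<dots> \<le> R2 z * E"
    proof (intro mult_left_mono)
      have "R2 z ^ (\<beta> - 1) \<le> (max 1 D)\<^sup>2 ^ (\<beta> - 1)"
        using r by (intro power_mono) (auto simp: R2_def intro: power_mono)
      also have "\<dots> \<le> E"
        unfolding E_def by (intro power_increasing) auto
      finally show "R2 z ^ (\<beta> - 1) \<le> E" .
    qed (use R2_pos less_imp_le in blast)
    finally have "inverse (R2 z) \<le> E / cmod (Q z) ^ 2"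
      using R2_pos[of z] cmod_Q_pos[OF z(1)] by (simp add: field_simps)
    then have "\<bar>inverse (R2 z) * f z\<bar> \<le> E / cmod (Q z) ^ 2 * (C * cmod (Q z) ^ (N + 2))"
      unfolding abs_mult using C[OF z] R2_pos[of z]
      by (intro mult_mono) (auto simp: E_def)
    then show "\<bar>inverse (R2 z) * f z\<bar> \<le> E * C * cmod (Q z) ^ N"
      using cmod_Q_pos[OF z(1)] by (simp add: power_add power2_eq_square)
  qed
next
  case (scale f r)
  obtain C where "\<And>z. z \<in> units \<Longrightarrow> norm z \<le> K \<Longrightarrow> \<bar>f z\<bar> \<le> C * cmod (Q z) ^ N"
    using scale.IH by blast
  then show ?case
    by (intro exI[of _ "\<bar>r\<bar> * C"]) (simp add: abs_mult mult.assoc mult_left_mono)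
next
  case (add f g)
  obtain C D where "\<And>z. z \<in> units \<Longrightarrow> norm z \<le> K \<Longrightarrow> \<bar>f z\<bar> \<le> C * cmod (Q z) ^ N"
    "\<And>z. z \<in> units \<Longrightarrow> norm z \<le> K \<Longrightarrow> \<bar>g z\<bar> \<le> D * cmod (Q z) ^ N"
    using add.IH by metis
  then show ?case
    by (intro exI[of _ "C + D"])
      (auto simp: distrib_right intro!: abs_triangle_ineq[THEN order_trans] add_mono)
qed

lemma flat_lift_derivative:
  fixes f :: "complex^('l + 'k::finite) \<Rightarrow> real"
  assumes "flat_lift f"
  shows "\<exists>f'. (\<forall>v. flat_lift (f' v)) \<and> (\<forall>z\<in>units. (f has_derivative (\<lambda>v. f' v z)) (at z))"
  using assms
proof induction
  case (base b h)
  define F where "F b h z = (if z \<in> units then b (S2 z / R2 z) * h (join (root z) z) else 0)"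
    for b :: "real \<Rightarrow> real" and h and z :: "complex^('l + 'k)"
  \<comment> \<open>The derivative of \<open>S2\<close> in direction \<open>v\<close>, read as a
    function on V_B. It is smooth and does not involve w_1, so it can be absorbed into
    \<open>h\<close>.\<close>
  define p where "p v w = (\<Sum>j\<in>UNIV. 2 * Re (cnj (v $ Inr j) * w $ Inr j))"
    for v :: "complex^('l + 'k)" and w :: "complex^(unit + 'k)"
  have h: "smooth h" using base(3) by (simp add: good_def)
  have F: "flat_lift (F b h)" if "smooth b" "supp_pos b" "good h" for b h
    unfolding F_def using that by (rule flat_lift.base)
  have p: "good (\<lambda>w. p v w * h w)" for v
  proof (rule good_mult[OF base(3)])
    show "smooth (p v)"
      unfolding p_def by (intro smooth_sum smooth_mult smooth_const smooth_Re_nth)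
    show "rot_inv (p v)" by (simp add: rot_inv_def p_def)
  qed
  have xb: "smooth (\<lambda>x. x * dd 1 b x)" "supp_pos (\<lambda>x. x * dd 1 b x)"
    by (intro smooth_mult smooth_bounded_linear bounded_linear_ident smooth_dd base supp_pos_mult supp_pos_dd)+
  \<comment> \<open>The first two terms differentiate \<open>S2 / R2\<close> inside
    \<open>b\<close>, the other three come from \<open>has_derivative_lift\<close>. The imaginary
    part of the logarithmic derivative is written as the real part of \<open>- \<i>\<close> times
    it, the shape that \<open>flat_lift_dlog\<close> accepts.\<close>
  define f' where "f' v z = inverse (R2 z) * F (dd 1 b) (\<lambda>w. p v w * h w) z
      + (Re (-2 * dlog v z) * F (\<lambda>x. x * dd 1 b x) h z
      + (Re (1 * dlog v z) * F b (pol 1 h) z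
      + (Re (- \<i> * dlog v z) * F b (pol \<i> h) z + F b (dd (join 0 v) h) z)))" for v z
  have "flat_lift (f' v)" for v
    unfolding f'_def
    by (intro flat_lift.add flat_lift.inv flat_lift_dlog F smooth_dd supp_pos_dd xb p base good_pol good_dd)
  moreover have "(F b h has_derivative (\<lambda>v. f' v z)) (at z)" if z: "z \<in> units" for z
  proof -
    have "((\<lambda>z. S2 z / R2 z) has_derivative (\<lambda>v. inverse (R2 z) * p v (join (root z) z)
        - S2 z / R2 z * (2 * Re (dlog v z)))) (at z)"
    proof (rule has_derivative_eq_rhs[OF has_derivative_divide'[OF has_derivative_S2 has_derivative_R2[OF z]]])
      show "R2 z \<noteq> 0" using R2_pos[of z] by simp
      then show "(\<lambda>v. ((\<Sum>j\<in>UNIV. 2 * Re (cnj (z $ Inr j) * v $ Inr j)) * R2 z - S2 z * (R2 z * (2 * Re (dlog v z))))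
          / (R2 z * R2 z))
          = (\<lambda>v. inverse (R2 z) * p v (join (root z) z) - S2 z / R2 z * (2 * Re (dlog v z)))"
        by (auto simp: p_def field_simps fun_eq_iff)
    qed
    from has_derivative_compose[OF this smooth_has_derivative[OF base(1)]]
    have "((\<lambda>z. b (S2 z / R2 z)) has_derivative (\<lambda>v. (inverse (R2 z) * p v (join (root z) z)
        - S2 z / R2 z * (2 * Re (dlog v z))) * dd 1 b (S2 z / R2 z))) (at z)"
      by (subst (asm) dd_real[OF base(1)])
    from has_derivative_mult[OF this has_derivative_lift[OF base(3) z]]
    have "((\<lambda>z. b (S2 z / R2 z) * h (join (root z) z)) has_derivative (\<lambda>v. f' v z)) (at z)"
      by (rule has_derivative_eq_rhs) (auto simp: fun_eq_iff f'_def F_def z algebra_simps)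
    then show ?thesis
      by (rule has_derivative_transform_within_open[OF _ open_units z]) (simp add: F_def)
  qed
  ultimately show ?case unfolding F_def by blast
next
  case (div f x i)
  then obtain f' where f': "\<And>v. flat_lift (f' v)"
    "\<And>z. z \<in> units \<Longrightarrow> (f has_derivative (\<lambda>v. f' v z)) (at z)" by blast
  \<comment> \<open>The derivative of \<open>x / z_i\<close> has a double pole;
    \<open>Re (p * q) = Re p * Re q - Re (- \<i> * p) * Re (- \<i> * q)\<close> splits it into
    products of simple poles, so that the rule \<open>div\<close> applies twice.\<close>
  define g where "g v z = (Re ((- x * v $ Inl i) / z $ Inl i) * (Re (1 / z $ Inl i) * f z)
      + - 1 * (Re ((\<i> * x * v $ Inl i) / z $ Inl i) * (Re (- \<i> / z $ Inl i) * f z)))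
      + Re (x / z $ Inl i) * f' v z" for v z
  have "flat_lift (g v)" for v
    unfolding g_def by (intro flat_lift.add flat_lift.div flat_lift.scale f' div)
  moreover have "((\<lambda>z. Re (x / z $ Inl i) * f z) has_derivative (\<lambda>v. g v z)) (at z)" if z: "z \<in> units" for z
  proof -
    have zi: "z $ Inl i \<noteq> 0" using z by (simp add: units_def)
    have "((\<lambda>z. x / z $ Inl i) has_derivative (\<lambda>v. (- x * v $ Inl i) / z $ Inl i * (1 / z $ Inl i))) (at z)"
      using zi bounded_linear_imp_has_derivative[OF bounded_linear_vec_nth, of "Inl i"]
      by (auto intro!: derivative_eq_intros simp: fun_eq_iff field_simps)
    from has_derivative_mult[OF has_derivative_Re[OF this] f'(2)[OF z]]
    show ?thesis
    proof (rule has_derivative_eq_rhs)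
      have *: "Re (p * q) = Re p * Re q - Re (- \<i> * p) * Re (- \<i> * q)" for p q by simp
      have **: "- \<i> * ((- x * y) / z $ Inl i) = (\<i> * x * y) / z $ Inl i"
        "- \<i> * (1 / z $ Inl i) = - \<i> / z $ Inl i" for y
        by auto
      show "(\<lambda>v. Re (x / z $ Inl i) * f' v z + Re ((- x * v $ Inl i) / z $ Inl i * (1 / z $ Inl i)) * f z)
          = (\<lambda>v. g v z)"
        unfolding *[of "_ / z $ Inl i"] ** g_def by (auto simp: fun_eq_iff algebra_simps)
    qed
  qed
  ultimately show ?case by blast
next
  case (inv f)
  then obtain f' where f': "\<And>v. flat_lift (f' v)"
    "\<And>z. z \<in> units \<Longrightarrow> (f has_derivative (\<lambda>v. f' v z)) (at z)" by blast
  define g where "g v z = inverse (R2 z) * (Re (-2 * dlog v z) * f z) + inverse (R2 z) * f' v z" for v z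
  have "flat_lift (g v)" for v
    unfolding g_def by (intro flat_lift.add flat_lift.inv flat_lift_dlog f' inv)
  moreover have "((\<lambda>z. inverse (R2 z) * f z) has_derivative (\<lambda>v. g v z)) (at z)" if z: "z \<in> units" for z
  proof -
    have R: "R2 z \<noteq> 0" using R2_pos[of z] by simp
    from has_derivative_mult[OF has_derivative_compose[OF has_derivative_R2[OF z] has_derivative_inverse'[OF R]]
        f'(2)[OF z]]
    show ?thesis
      by (rule has_derivative_eq_rhs) (use R in \<open>auto simp: fun_eq_iff g_def field_simps\<close>)
  qed
  ultimately show ?case by blast
next
  case (scale f r)
  then obtain f' where f': "\<And>v. flat_lift (f' v)"
    "\<And>z. z \<in> units \<Longrightarrow> (f has_derivative (\<lambda>v. f' v z)) (at z)" by blast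
  then show ?case
    by (intro exI[of _ "\<lambda>v z. r * f' v z"]) (auto intro: flat_lift.scale has_derivative_mult_right)
next
  case (add f g)
  then obtain f' g' where "\<And>v. flat_lift (f' v)" "\<And>v. flat_lift (g' v)"
    "\<And>z. z \<in> units \<Longrightarrow> (f has_derivative (\<lambda>v. f' v z)) (at z)"
    "\<And>z. z \<in> units \<Longrightarrow> (g has_derivative (\<lambda>v. g' v z)) (at z)" by metis
  then show ?case
    by (intro exI[of _ "\<lambda>v z. f' v z + g' v z"]) (auto intro: flat_lift.add has_derivative_add)
qed

text \<open>If z_i = 0, then near \<open>z\<close> the function is bounded by the square of
  \<open>Q\<close>, hence by the square of the i-th coordinate, hence by the squared distance to
  \<open>z\<close>.\<close>

lemma flat_lift_derivative_zero:
  fixes f :: "complex^('l + 'k::finite) \<Rightarrow> real"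
  assumes "flat_lift f" "z \<notin> units"
  shows "(f has_derivative (\<lambda>_. 0)) (at z)"
proof -
  define K where "K = norm z + 1"
  obtain i where i: "z $ Inl i = 0" using assms(2) by (auto simp: units_def)
  obtain C where C: "\<And>z. z \<in> units \<Longrightarrow> norm z \<le> K \<Longrightarrow> \<bar>f z\<bar> \<le> C * cmod (Q z) ^ 2"
    using flat_lift_bound[OF assms(1), of K 2] by blast
  obtain D where D: "\<And>z :: complex^('l + 'k). norm z \<le> K \<Longrightarrow> cmod (Q z) \<le> D * cmod (z $ Inl i)" "0 < D"
    using cmod_Q_bounds[of K] by metis
  show ?thesis
  proof (rule has_derivative_at_flat[of _ _ 1 "\<bar>C\<bar> * D\<^sup>2"])
    show "f z = 0" by (rule flat_lift_zero[OF assms])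
    fix y assume y: "dist y z < 1"
    have yK: "norm y \<le> K"
      using y norm_triangle_sub[of y z] by (simp add: K_def dist_norm)
    show "norm (f y) \<le> \<bar>C\<bar> * D\<^sup>2 * (dist y z)\<^sup>2"
    proof (cases "y \<in> units")
      case True
      have "cmod (y $ Inl i) \<le> dist y z"
        using Finite_Cartesian_Product.norm_nth_le[of "y - z" "Inl i"] i by (simp add: dist_norm)
      then have "cmod (Q y) \<le> D * dist y z"
        using D(1)[OF yK] D(2) by (meson less_imp_le mult_left_mono order_trans)
      then have "cmod (Q y) ^ 2 \<le> (D * dist y z)\<^sup>2" by (intro power_mono) auto
      then have "\<bar>C\<bar> * cmod (Q y) ^ 2 \<le> \<bar>C\<bar> * (D * dist y z)\<^sup>2" by (intro mult_left_mono) auto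
      moreover have "\<bar>f y\<bar> \<le> \<bar>C\<bar> * cmod (Q y) ^ 2"
        using C[OF True yK] abs_ge_self[of C] by (meson mult_right_mono order_trans zero_le_power norm_ge_zero)
      ultimately show ?thesis by (simp add: power_mult_distrib mult.assoc)
    qed (simp add: flat_lift_zero[OF assms(1)])
  qed simp
qed

lemma flat_lift_smooth:
  fixes f :: "complex^('l + 'k::finite) \<Rightarrow> real"
  assumes "flat_lift f"
  shows "smooth f"
proof (rule smooth_coinduct[where S = flat_lift])
  fix f :: "complex^('l + 'k) \<Rightarrow> real" assume f: "flat_lift f"
  obtain f' where f': "\<And>v. flat_lift (f' v)" "\<And>z. z \<in> units \<Longrightarrow> (f has_derivative (\<lambda>v. f' v z)) (at z)"
    using flat_lift_derivative[OF f] by blast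
  have "(f has_derivative (\<lambda>v. f' v z)) (at z)" for z
    using f'(2)[of z] flat_lift_derivative_zero[OF f, of z] flat_lift_zero[OF f'(1), of z]
    by (cases "z \<in> units") auto
  with f'(1) show "\<exists>f'. (\<forall>x. (f has_derivative (\<lambda>v. f' v x)) (at x)) \<and> (\<forall>v. flat_lift (f' v))"
    by blast
qed (rule assms)

section \<open>Shell equations and lifts of flat invariants\<close>

lemma Zset_B_iff:
  fixes w :: "complex^(unit + 'k::finite)"
  shows "w \<in> Zset B \<longleftrightarrow> real \<alpha> * (cmod (w $ Inl ()))\<^sup>2 = real \<beta> * (\<Sum>j\<in>UNIV. (cmod (w $ Inr j))\<^sup>2)"
  by (auto simp: Zset_def moment_def UNIV_Plus_UNIV[symmetric] sum.Plus UNIV_unit sum_distrib_left simp del: UNIV_Plus_UNIV)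

lemma Zset_A_iff:
  fixes z :: "complex^('l + 'k::finite)"
  shows "z \<in> Zset A \<longleftrightarrow> (\<forall>i. real (a i) * (cmod (z $ Inl i))\<^sup>2 = real (n i) * (\<Sum>j\<in>UNIV. (cmod (z $ Inr j))\<^sup>2))"
proof -
  have "(\<Sum>j\<in>UNIV. (if i = j then - real (a i) else 0) * (cmod (z $ Inl j))\<^sup>2) = - (real (a i) * (cmod (z $ Inl i))\<^sup>2)" for i
    by (subst sum.cong[OF refl, of _ _ "\<lambda>j. if j = i then - (real (a i) * (cmod (z $ Inl i))\<^sup>2) else 0"]) auto
  then show ?thesis
    by (auto simp: Zset_def moment_def UNIV_Plus_UNIV[symmetric] sum.Plus if_distrib[of real_of_int] sum_distrib_left
        cong: if_cong simp del: UNIV_Plus_UNIV)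
qed

lemma Zset_B_zero:
  assumes "w \<in> Zset B" "w $ Inl () = 0"
  shows "w = 0"
proof -
  have "(\<Sum>j\<in>UNIV. (cmod (w $ Inr j))\<^sup>2) = 0"
    using assms beta_pos by (simp add: Zset_B_iff)
  then have "w $ Inr j = 0" for j
    by (subst (asm) sum_nonneg_eq_0_iff) auto
  with assms(2) show ?thesis by (intro vec_sum_eqI) (auto simp: old.unit.exhaust)
qed

lemma invariant_rot_inv:
  fixes h :: "complex^(unit + 'k::finite) \<Rightarrow> real"
  shows "invariant B h \<Longrightarrow> rot_inv h"
  unfolding rot_inv_def
proof (intro allI impI)
  fix s :: complex and w :: "complex^(unit + 'k)"
  assume h: "invariant B h" and s: "s ^ \<beta> = 1"
  have "cmod s ^ \<beta> = 1" using s by (metis norm_one norm_power)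
  then have "cmod s = 1" using beta_pos power_eq_iff_eq_base[of \<beta> "cmod s" 1] by simp
  then show "h (join (s * w $ Inl ()) w) = h w"
    using s by (intro invariant_weightB[OF h coprime, of "inverse s" 1]) (auto simp: norm_inverse power_inverse)
qed

text \<open>At \<open>L w\<close> with \<open>w\<close> on the shell and w_1 nonzero,
  \<open>S2 / R2\<close> equals \<open>\<alpha> / \<beta>\<close>, where the bump is 1, and the root
  agrees with w_1 up to a \<beta>-th root of unity. If w_1 = 0 then \<open>w = 0\<close>, and both
  sides vanish.\<close>

lemma flat_lifting:
  fixes h :: "complex^(unit + 'k::finite) \<Rightarrow> real"
  assumes "smooth h" "flat h" "invariant B h"
  obtains f :: "complex^('l + 'k) \<Rightarrow> real"
  where "smooth f" "invariant A f" "\<And>w. w \<in> Zset B \<Longrightarrow> f (L w) = h w"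
proof -
  have ab: "0 < real \<alpha> / real \<beta>" using alpha_pos beta_pos by simp
  obtain b :: "real \<Rightarrow> real" where b: "smooth b" "b (real \<alpha> / real \<beta>) = 1"
    "\<And>x. x \<le> real \<alpha> / real \<beta> / 2 \<Longrightarrow> b x = 0" "\<And>x. 2 * (real \<alpha> / real \<beta>) \<le> x \<Longrightarrow> b x = 0"
    using smooth_bump[OF ab] by metis
  have sb: "supp_pos b"
    unfolding supp_pos_def using b(3,4) ab
    by (intro exI[of _ "real \<alpha> / real \<beta> / 2"] exI[of _ "2 * (real \<alpha> / real \<beta>)"]) auto
  have good: "good h" using assms by (simp add: good_def invariant_rot_inv)
  define f where "f z = (if z \<in> units then b (S2 z / R2 z) * h (join (root z) z) else 0)"
    for z :: "complex^('l + 'k)"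
  show ?thesis
  proof (rule that[of f])
    show "smooth f"
      unfolding f_def by (intro flat_lift_smooth flat_lift.base b sb good)
    show "invariant A f"
    proof (rule invariantI)
      fix u :: "'l \<Rightarrow> complex" and z :: "complex^('l + 'k)" assume u: "torus u"
      have u0: "u i \<noteq> 0" for i using u by (metis norm_zero torus_def zero_neq_one)
      then have iff: "tact A u z \<in> units \<longleftrightarrow> z \<in> units" by (simp add: units_def)
      show "f (tact A u z) = f z"
      proof (cases "z \<in> units")
        case True
        have "S2 (tact A u z) = S2 z"
          by (simp add: S2_def norm_mult cmod_prod_power[OF u])
        moreover have "cmod (Q (tact A u z)) = cmod (Q z)"
          by (simp add: Q_tact[OF u] norm_mult norm_inverse norm_power cmod_prod_power[OF u])
        then have "cmod (root (tact A u z)) = cmod (root z)"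
          using cmod_root_power[of z] cmod_root_power[of "tact A u z"] True iff beta_pos
            power_eq_iff_eq_base[of \<beta> "cmod (root z)" "cmod (root (tact A u z))"] by simp
        then have "R2 (tact A u z) = R2 z" by (simp add: R2_def)
        moreover have "h (join (root (tact A u z)) (tact A u z)) = h (join (root z) z)"
          using True iff by (intro join_root_invariant[OF assms(3) _ _ u]) (simp_all add: root_power)
        ultimately show ?thesis using True iff by (simp add: f_def)
      qed (simp add: f_def iff)
    qed
    fix w :: "complex^(unit + 'k)" assume w: "w \<in> Zset B"
    show "f (L w) = h w"
    proof (cases "w $ Inl () = 0")
      case True
      then have "w = 0" by (rule Zset_B_zero[OF w])
      then show ?thesis using flat_zero[OF assms(2)] by (simp add: f_def units_def)
    next
      case False
      then have U: "L w \<in> units" by (simp add: units_def)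
      have r: "root (L w) ^ \<beta> = w $ Inl () ^ \<beta>" using root_power[OF U] by (simp add: Q_L)
      then have "cmod (root (L w)) ^ \<beta> = cmod (w $ Inl ()) ^ \<beta>" by (metis norm_power)
      then have "R2 (L w) = (cmod (w $ Inl ()))\<^sup>2"
        using beta_pos by (simp add: R2_def power_eq_iff_eq_base)
      then have "S2 (L w) / R2 (L w) = real \<alpha> / real \<beta>"
        using w False beta_pos by (simp add: Zset_B_iff S2_def field_simps)
      moreover have "join (w $ Inl ()) (L w) = w"
        by (rule vec_sum_eqI) auto
      then have "h (join (root (L w)) (L w)) = h w"
        using rot_inv_join[OF invariant_rot_inv[OF assms(3)] r, of "L w"] by simp
      ultimately show ?thesis using U by (simp add: f_def b(2))
    qed
  qed
qed

end

subsection \<open>Polynomials\<close>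

lemma hpoly_polyfun: "hpoly d f \<Longrightarrow> polyfun f"
  by (induction rule: hpoly.induct) (auto intro: polyfun.intros)

lemma hpoly_cong: "hpoly d f \<Longrightarrow> d = e \<Longrightarrow> f = g \<Longrightarrow> hpoly e g"
  by simp

lemma hpoly_cmult: "hpoly d f \<Longrightarrow> hpoly d (\<lambda>z. x * f z)"
  using hmult[OF hconst[of x], of d f] by simp

lemma hpoly_power: "hpoly d f \<Longrightarrow> hpoly (k * d) (\<lambda>z. f z ^ k)"
proof (induction k)
  case 0
  then show ?case using hconst[of 1] by simp
next
  case (Suc k)
  then show ?case using hmult[of d f "k * d" "\<lambda>z. f z ^ k"] by simp
qed

lemma hpoly_prod:
  "finite I \<Longrightarrow> (\<And>i. i \<in> I \<Longrightarrow> hpoly (d i) (f i)) \<Longrightarrow> hpoly (\<Sum>i\<in>I. d i) (\<lambda>z. \<Prod>i\<in>I. f i z)"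
proof (induction I rule: finite_induct)
  case empty
  then show ?case using hconst[of 1] by simp
next
  case (insert i I)
  then show ?case using hmult[of "d i" "f i" "sum d I" "\<lambda>z. \<Prod>i\<in>I. f i z"] by simp
qed

lemma hpoly_zero: "hpoly d (\<lambda>_. 0)"
  using hpoly_cmult[OF hpoly_power[OF hvar, of d], of 0] by simp

lemma hpoly_sum:
  "(\<And>i. i \<in> I \<Longrightarrow> hpoly d (f i)) \<Longrightarrow> hpoly d (\<lambda>z. \<Sum>i\<in>I. f i z)"
  by (induction I rule: infinite_finite_induct) (auto intro: hpoly_zero hadd)

lemma hpoly_cnj: "hpoly d f \<Longrightarrow> hpoly d (\<lambda>z. cnj (f z))"
  by (induction rule: hpoly.induct) (auto intro: hpoly.intros simp del: One_nat_def)

lemma polyfun_cnj: "polyfun f \<Longrightarrow> polyfun (\<lambda>z. cnj (f z))"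
  by (induction rule: polyfun.induct) (auto intro: polyfun.intros)

lemma polyfun_cmult: "polyfun f \<Longrightarrow> polyfun (\<lambda>z. x * f z)"
  by (rule pmult[OF pconst])

lemma smooth_polyfun: "polyfun f \<Longrightarrow> smooth (\<lambda>z. Re (f z)) \<and> smooth (\<lambda>z. Im (f z))"
proof (induction rule: polyfun.induct)
  case (pvar j)
  then show ?case using smooth_Re_nth[of 1 j] smooth_Im_nth[of 1 j] by simp
next
  case (pcvar j)
  then show ?case using smooth_Re_nth[of 1 j] smooth_uminus[OF smooth_Im_nth[of 1 j]] by simp
qed (auto intro: smooth_add smooth_mult smooth_diff)

lemma hpoly_homogeneous: "hpoly d f \<Longrightarrow> f (r *\<^sub>R z) = of_real r ^ d * f z"
proof (induction rule: hpoly.induct)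
  case (hvar j)
  show ?case by (simp add: scaleR_conv_of_real[where 'a = complex] vector_scaleR_component)
next
  case (hcvar j)
  show ?case by (simp add: scaleR_conv_of_real[where 'a = complex] vector_scaleR_component)
qed (auto simp: algebra_simps power_add)

lemma hpoly_inner_Basis:
  assumes "b \<in> Basis"
  shows "hpoly 1 (\<lambda>w :: complex^'n::finite. complex_of_real (w \<bullet> b))"
proof -
  obtain j u where b: "b = axis j u" "u \<in> Basis"
    using assms by (auto simp: Basis_vec_def)
  have re: "complex_of_real (Re x) = 1/2 * (x + cnj x)"
    and im: "complex_of_real (Im x) = - \<i> / 2 * (x + (- 1) * cnj x)" for x
    by (simp_all add: complex_eq_iff)
  consider "u = 1" | "u = \<i>" using b(2) by (auto simp: Basis_complex_def)
  then show ?thesis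
  proof cases
    case 1
    then have "w \<bullet> b = Re (w $ j)" for w :: "complex^'n"
      by (simp add: b inner_axis inner_complex_def)
    then show ?thesis
      by (simp only: re) (intro hpoly_cmult hadd hvar hcvar)
  next
    case 2
    then have "w \<bullet> b = Im (w $ j)" for w :: "complex^'n"
      by (simp add: b inner_axis inner_complex_def)
    then show ?thesis
      by (simp only: im) (intro hpoly_cmult hadd hvar hcvar)
  qed
qed

text \<open>As a function of the direction \<open>w\<close>, the d-th iterated derivative is a form
  of degree \<open>d\<close>.\<close>

lemma hpoly_taylor:
  fixes g :: "complex^'n::finite \<Rightarrow> real"
  assumes "smooth g"
  shows "hpoly d (\<lambda>w. complex_of_real ((dd w ^^ d) g y))"
  using assms
proof (induction d arbitrary: g)
  case 0
  show ?case using hconst[of "complex_of_real (g y)"] by simp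
next
  case (Suc d)
  have "hpoly (1 + d) (\<lambda>w. \<Sum>b\<in>Basis. complex_of_real (w \<bullet> b) * complex_of_real ((dd w ^^ d) (dd b g) y))"
    by (intro hpoly_sum hmult hpoly_inner_Basis Suc.IH smooth_dd Suc.prems)
  then show ?case
    unfolding dd_power_Suc_Basis[OF Suc.prems] by simp
qed

text \<open>For \<open>r\<close> a torus element, which fixes 0, this gives the invariance of each
  Taylor polynomial at 0 of an invariant function.\<close>

lemma dd_power_compose_linear:
  assumes "smooth g" "bounded_linear r"
  shows "(dd w ^^ d) (\<lambda>x. g (r x)) = (\<lambda>x. (dd (r w) ^^ d) g (r x))"
proof (induction d)
  case (Suc d)
  show ?case
    using dd_compose_linear[OF smooth_differentiable[OF smooth_dd_power[OF assms(1)]] assms(2)]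
    by (simp add: Suc fun_eq_iff)
qed simp

lemma bounded_linear_tact: "bounded_linear (tact W t)"
proof -
  have "linear (tact W t)"
    by (rule linearI) (auto simp: tact_def vec_eq_iff algebra_simps)
  then show ?thesis by (rule linear_conv_bounded_linear[THEN iffD1])
qed

lemma norm_tact: "torus t \<Longrightarrow> norm (tact W t z) = norm z"
  by (simp add: norm_vec_def tact_def norm_mult prod_norm[symmetric] norm_power_int torus_def)

section \<open>Spans of monomials on V_B\<close>

definition mon :: "nat \<Rightarrow> nat \<Rightarrow> ('k \<Rightarrow> nat) \<Rightarrow> ('k \<Rightarrow> nat) \<Rightarrow> complex^(unit + 'k::finite) \<Rightarrow> complex" where
  "mon p q s t w = w $ Inl () ^ p * cnj (w $ Inl ()) ^ q
    * (\<Prod>j\<in>UNIV. w $ Inr j ^ s j) * (\<Prod>j\<in>UNIV. cnj (w $ Inr j) ^ t j)"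

text \<open>The set \<open>D\<close> of admissible degrees lets one induction serve both the graded
  case, a singleton, and the ungraded case, \<open>UNIV\<close>.\<close>

inductive mspan :: "nat set \<Rightarrow> (complex^(unit + 'k::finite) \<Rightarrow> complex) \<Rightarrow> bool" for D where
  mono: "p + q + sum s UNIV + sum t UNIV \<in> D \<Longrightarrow> mspan D (\<lambda>w. x * mon p q s t w)"
| add: "mspan D f \<Longrightarrow> mspan D g \<Longrightarrow> mspan D (\<lambda>w. f w + g w)"

lemma mspan_mult:
  assumes "mspan D f" "mspan E g" "\<And>d e. d \<in> D \<Longrightarrow> e \<in> E \<Longrightarrow> d + e \<in> H"
  shows "mspan H (\<lambda>w. f w * g w)"
  using assms(1)
proof induction
  case (mono p q s t x)
  show ?case
    using assms(2)
  proof induction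
    case (mono p' q' s' t' x')
    have "mspan H (\<lambda>w. (x * x') * mon (p + p') (q + q') (\<lambda>j. s j + s' j) (\<lambda>j. t j + t' j) w)"
      using assms(3)[OF \<open>p + q + sum s UNIV + sum t UNIV \<in> D\<close> mono]
      by (intro mspan.mono) (simp add: sum.distrib algebra_simps)
    then show ?case
      by (simp add: mon_def power_add prod.distrib mult_ac)
  next
    case (add f g)
    then show ?case using mspan.add by (simp add: distrib_left) blast
  qed
next
  case (add f g)
  then show ?case using mspan.add by (simp add: distrib_right) blast
qed

lemma mspan_var:
  fixes j :: "unit + 'k::finite"
  assumes "1 \<in> D"
  shows "mspan D (\<lambda>w. w $ j)" "mspan D (\<lambda>w. cnj (w $ j))"
proof -
  have p: "(\<Prod>j\<in>UNIV. f j ^ (if j = i then 1 else 0)) = f i" for f :: "'k \<Rightarrow> complex" and i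
    by (simp add: if_distrib[of "\<lambda>n. _ ^ n"] cong: if_cong)
  have "mspan D (\<lambda>w. w $ j) \<and> mspan D (\<lambda>w. cnj (w $ j))"
  proof (cases j)
    case (Inl u)
    then show ?thesis
      using mspan.mono[of 1 0 "\<lambda>_. 0" "\<lambda>_. 0" D 1] mspan.mono[of 0 1 "\<lambda>_. 0" "\<lambda>_. 0" D 1] assms
      by (simp add: mon_def)
  next
    case (Inr i)
    then show ?thesis
      using mspan.mono[of 0 0 "\<lambda>j. if j = i then 1 else 0" "\<lambda>_. 0" D 1]
        mspan.mono[of 0 0 "\<lambda>_. 0" "\<lambda>j. if j = i then 1 else 0" D 1] assms
      by (simp add: mon_def p)
  qed
  then show "mspan D (\<lambda>w. w $ j)" "mspan D (\<lambda>w. cnj (w $ j))" by auto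
qed

lemma mspan_const: "0 \<in> D \<Longrightarrow> mspan D (\<lambda>_. x)"
  using mspan.mono[of 0 0 "\<lambda>_. 0" "\<lambda>_. 0" D x] by (simp add: mon_def)

lemma hpoly_mspan: "hpoly d f \<Longrightarrow> mspan {d} f"
  by (induction rule: hpoly.induct)
    (auto intro: mspan_const mspan_var mspan.add mspan_mult simp del: One_nat_def)

lemma polyfun_mspan: "polyfun f \<Longrightarrow> mspan UNIV f"
  by (induction rule: polyfun.induct) (auto intro: mspan_const mspan_var mspan.add mspan_mult)

text \<open>Orthogonality of characters: averaging over the circle retains exactly the monomials of
  weight zero.\<close>

lemma has_integral_cis_int:
  "((\<lambda>x. cis (of_int N * x)) has_integral (if N = 0 then complex_of_real (2 * pi) else 0)) {0..2 * pi}"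
proof (cases "N = 0")
  case True
  then show ?thesis
    using has_integral_const_real[of "1 :: complex" 0 "2 * pi"] by (simp add: scaleR_conv_of_real)
next
  case False
  have "((\<lambda>x. cis (of_int N * x)) has_integral
      cis (of_int N * (2 * pi)) / (\<i> * of_int N) - cis (of_int N * 0) / (\<i> * of_int N)) {0..2 * pi}"
  proof (rule fundamental_theorem_of_calculus)
    fix x
    have "((\<lambda>x. exp (\<i> * of_int N * x)) has_field_derivative exp (\<i> * of_int N * of_real x) * (\<i> * of_int N)) (at (of_real x))"
      by (auto intro!: derivative_eq_intros)
    then have "((\<lambda>x. exp (\<i> * of_int N * x) / (\<i> * of_int N)) has_field_derivative exp (\<i> * of_int N * of_real x)) (at (of_real x))"
      using False by (auto dest: DERIV_cdivide[where c = "\<i> * of_int N"])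
    from has_vector_derivative_real_field[OF this, of "{0..2 * pi}"]
    show "((\<lambda>x. cis (of_int N * x) / (\<i> * of_int N)) has_vector_derivative cis (of_int N * x)) (at x within {0..2 * pi})"
      by (simp add: cis_conv_exp mult.assoc)
  qed simp
  moreover have "cis (of_int N * (2 * pi)) = 1"
    using cis_multiple_2pi[of "of_int N"] by (simp add: mult_ac)
  ultimately show ?thesis using False by simp
qed

section \<open>Lifting invariant polynomials by averaging\<close>

context type_I
begin

definition wt :: "nat \<Rightarrow> nat \<Rightarrow> ('k::finite \<Rightarrow> nat) \<Rightarrow> ('k \<Rightarrow> nat) \<Rightarrow> int" where
  "wt p q s t = int \<alpha> * (int q - int p) + int \<beta> * (int (sum s UNIV) - int (sum t UNIV))"

lemma mon_tact: "mon p q s t (tact B (\<lambda>_. cis x) w) = cis (of_int (wt p q s t) * x) * mon p q s t w"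
proof -
  have 1: "(inverse (cis x ^ \<alpha>) * y) ^ p = cis (- (real \<alpha> * real p * x)) * y ^ p" for y
    by (simp add: power_mult_distrib Complex.DeMoivre mult_ac)
  have 2: "cnj (inverse (cis x ^ \<alpha>) * y) ^ q = cis (real \<alpha> * real q * x) * cnj y ^ q" for y
    by (simp add: power_mult_distrib Complex.DeMoivre cis_cnj mult_ac)
  have p: "(\<Prod>j\<in>UNIV. (d * y j) ^ s j) = d ^ sum s UNIV * (\<Prod>j\<in>UNIV. y j ^ s j)"
    for d :: complex and y and s :: "'a \<Rightarrow> nat"
    by (simp add: power_mult_distrib prod.distrib power_sum)
  have 3: "(\<Prod>j\<in>UNIV. (cis x ^ \<beta> * y j) ^ s j)
      = cis (real \<beta> * real (sum s UNIV) * x) * (\<Prod>j\<in>UNIV. y j ^ s j)" for y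
    unfolding p by (simp add: Complex.DeMoivre mult_ac del: of_nat_sum)
  have 4: "(\<Prod>j\<in>UNIV. cnj (cis x ^ \<beta> * y j) ^ t j)
      = cis (- (real \<beta> * real (sum t UNIV) * x)) * (\<Prod>j\<in>UNIV. cnj (y j) ^ t j)" for y
    unfolding complex_cnj_mult p by (simp add: Complex.DeMoivre cis_cnj mult_ac del: of_nat_sum)
  have "cis (of_int (wt p q s t) * x) = cis (- (real \<alpha> * real p * x)) * cis (real \<alpha> * real q * x)
      * cis (real \<beta> * real (sum s UNIV) * x) * cis (- (real \<beta> * real (sum t UNIV) * x))"
    by (simp add: wt_def cis_mult algebra_simps del: of_nat_sum)
  then show ?thesis
    unfolding mon_def tact_weightB 1 2 3 4 by (simp only: mult_ac)
qed

lemma hpoly_Q: "hpoly \<beta> Q"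
proof -
  have "hpoly (\<Sum>i\<in>UNIV. m i * 1) (\<lambda>z. \<Prod>i\<in>UNIV. (inverse (c i) * z $ Inl i) ^ m i)"
    by (intro hpoly_prod hpoly_power hpoly_cmult hvar) simp
  then show ?thesis
    by (simp add: msum Q_def[abs_def] divide_inverse mult.commute of_real_inverse)
qed

text \<open>An invariant lift of \<open>w_1 * cnj w_1\<close>, because the squares of the
  \<open>c i\<close> add up to 1.\<close>

definition X :: "complex^('l + 'k::finite) \<Rightarrow> complex" where
  "X z = (\<Sum>i\<in>UNIV. z $ Inl i * cnj (z $ Inl i))"

lemma hpoly_X: "hpoly 2 X"
proof -
  have "hpoly (1 + 1) X"
    unfolding X_def by (intro hpoly_sum hmult hvar hcvar)
  then show ?thesis by (simp only: one_add_one)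
qed

lemma X_L: "X (L w) = w $ Inl () * cnj (w $ Inl ())"
proof -
  have "X (L w) = of_real (\<Sum>i\<in>UNIV. (c i)\<^sup>2) * (w $ Inl () * cnj (w $ Inl ()))"
    by (simp add: X_def scaleR_conv_of_real[where 'a = complex] power2_eq_square sum_distrib_right sum_distrib_left mult_ac)
  then show ?thesis by (simp add: c_sum)
qed

lemma mult_cnj_cmod1: "cmod x = 1 \<Longrightarrow> x * cnj x = 1"
  by (simp add: complex_norm_square[symmetric])

lemma X_tact: "torus u \<Longrightarrow> X (tact A u z) = X z"
proof -
  assume u: "torus u"
  have "(inverse (u i ^ a i) * y) * cnj (inverse (u i ^ a i) * y) = y * cnj y" for i y
  proof -
    have "inverse (u i ^ a i) * cnj (inverse (u i ^ a i)) = 1"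
      using u by (intro mult_cnj_cmod1) (simp add: torus_def norm_inverse norm_power)
    then have "(inverse (u i ^ a i) * cnj (inverse (u i ^ a i))) * (y * cnj y) = y * cnj y" by simp
    then show ?thesis by (simp only: complex_cnj_mult mult_ac)
  qed
  then show ?thesis by (simp only: X_def tact_typeI)
qed

definition mon_lift :: "nat \<Rightarrow> nat \<Rightarrow> ('k \<Rightarrow> nat) \<Rightarrow> ('k \<Rightarrow> nat) \<Rightarrow> complex^('l + 'k::finite) \<Rightarrow> complex" where
  "mon_lift k q s t z = Q z ^ k * X z ^ q * (\<Prod>j\<in>UNIV. z $ Inr j ^ s j) * (\<Prod>j\<in>UNIV. cnj (z $ Inr j) ^ t j)"

lemma hpoly_mon_lift: "hpoly (k * \<beta> + q * 2 + sum s UNIV + sum t UNIV) (mon_lift k q s t)"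
  unfolding mon_lift_def
  using hpoly_prod[of UNIV s "\<lambda>j z. z $ Inr j ^ s j"] hpoly_prod[of UNIV t "\<lambda>j z. cnj (z $ Inr j) ^ t j"]
    hpoly_power[OF hvar] hpoly_power[OF hcvar]
  by (intro hmult hpoly_power hpoly_Q hpoly_X) (auto simp del: One_nat_def simp: mult.commute)

lemma mon_lift_L: "mon_lift k q s t (L w) = mon (q + k * \<beta>) q s t w"
  by (simp only: mon_lift_def Q_L X_L L_nth mon_def power_add power_mult_distrib power_mult[symmetric] mult_ac)

lemma mon_lift_invariant:
  fixes s t :: "'k::finite \<Rightarrow> nat"
  assumes "sum s UNIV = sum t UNIV + \<alpha> * k"
  shows "invariant A (mon_lift k q s t)"
proof (rule invariantI)
  fix u :: "'l \<Rightarrow> complex" and z :: "complex^('l + 'k)" assume u: "torus u"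
  define d where "d = (\<Prod>i\<in>UNIV. u i ^ n i)"
  have d: "d * cnj d = 1" unfolding d_def by (intro mult_cnj_cmod1 cmod_prod_power u)
  then have d0: "d \<noteq> 0" by auto
  have 1: "(\<Prod>j\<in>UNIV. (d * y j) ^ s j) = d ^ sum s UNIV * (\<Prod>j\<in>UNIV. y j ^ s j)" for y
    by (simp add: power_mult_distrib prod.distrib power_sum)
  have 2: "(\<Prod>j\<in>UNIV. cnj (d * y j) ^ t j) = cnj d ^ sum t UNIV * (\<Prod>j\<in>UNIV. cnj (y j) ^ t j)" for y
    by (simp add: power_mult_distrib prod.distrib power_sum)
  have 3: "inverse (d ^ \<alpha>) ^ k * d ^ sum s UNIV * cnj d ^ sum t UNIV = 1"
  proof -
    have "inverse (d ^ \<alpha>) ^ k * d ^ sum s UNIV * cnj d ^ sum t UNIV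
      = (inverse (d ^ (\<alpha> * k)) * d ^ (\<alpha> * k)) * (d * cnj d) ^ sum t UNIV"
      unfolding assms by (simp add: power_add power_mult power_mult_distrib power_inverse mult_ac)
    then show ?thesis using d0 d by simp
  qed
  have "mon_lift k q s t (tact A u z) = (inverse (d ^ \<alpha>) ^ k * d ^ sum s UNIV * cnj d ^ sum t UNIV) * mon_lift k q s t z"
    unfolding mon_lift_def Q_tact[OF u] X_tact[OF u] tact_typeI d_def[symmetric] 1 2 power_mult_distrib[of _ "Q z"]
    by (simp only: mult_ac)
  then show "mon_lift k q s t (tact A u z) = mon_lift k q s t z" by (simp add: 3)
qed

text \<open>Weight zero means \<open>\<alpha> * (p - q) = \<beta> * (S - T)\<close> for the total
  exponents \<open>S\<close>, \<open>T\<close> of the last coordinates. By coprimality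
  \<open>p - q = k * \<beta>\<close> and \<open>S - T = \<alpha> * k\<close>, so the surplus of w_1
  is a power of \<open>w_1 ^ \<beta>\<close>, which \<open>Q\<close> lifts. For \<open>p < q\<close>
  the conjugate monomial is lifted.\<close>

lemma mon_lift_exists:
  assumes "wt p q s t = 0"
  obtains f :: "complex^('l + 'k::finite) \<Rightarrow> complex"
  where "hpoly (p + q + sum s UNIV + sum t UNIV) f" "invariant A f" "\<And>w. f (L w) = mon p q s t w"
proof -
  have key: "\<exists>k. p = q + k * \<beta> \<and> S = T + \<alpha> * k"
    if eq: "int \<alpha> * (int q - int p) + int \<beta> * (int S - int T) = 0" and le: "q \<le> p" for p q S T :: nat
  proof -
    obtain e where e: "p = q + e" using le le_Suc_ex by blast
    have "int (\<alpha> * e) = int \<beta> * (int S - int T)" using eq by (simp add: e algebra_simps)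
    then have "int \<beta> dvd int (\<alpha> * e)" by simp
    then have "\<beta> dvd \<alpha> * e" by (simp only: int_dvd_int_iff)
    then have "\<beta> dvd e" using coprime by (simp add: coprime_commute coprime_dvd_mult_right_iff)
    then obtain k where k: "e = k * \<beta>" by (metis dvd_def mult.commute)
    have "int \<beta> * (int \<alpha> * int k) = int \<beta> * (int S - int T)"
      using \<open>int (\<alpha> * e) = _\<close> by (simp add: k mult_ac)
    then have "int S = int (T + \<alpha> * k)" using beta_pos by simp
    then have "S = T + \<alpha> * k" by (simp only: int_int_eq)
    then show ?thesis using e k by blast
  qed
  show ?thesis
  proof (cases "q \<le> p")
    case True
    then obtain k where k: "p = q + k * \<beta>" "sum s UNIV = sum t UNIV + \<alpha> * k"
      using key[of q p "sum s UNIV" "sum t UNIV"] assms unfolding wt_def by blast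
    show ?thesis
    proof (rule that[of "mon_lift k q s t"])
      show "hpoly (p + q + sum s UNIV + sum t UNIV) (mon_lift k q s t)"
        by (rule hpoly_cong[OF hpoly_mon_lift _ refl]) (simp add: k)
    qed (simp_all add: mon_lift_L k mon_lift_invariant)
  next
    case False
    then obtain k where k: "q = p + k * \<beta>" "sum t UNIV = sum s UNIV + \<alpha> * k"
      using key[of p q "sum t UNIV" "sum s UNIV"] assms unfolding wt_def by (force simp: algebra_simps)
    have "cnj (mon q p t s w) = mon p q s t w" for w :: "complex^(unit + 'k)"
      by (simp add: mon_def mult_ac)
    note cnj_mon = this
    show ?thesis
    proof (rule that[of "\<lambda>z. cnj (mon_lift k p t s z)"])
      show "hpoly (p + q + sum s UNIV + sum t UNIV) (\<lambda>z. cnj (mon_lift k p t s z))"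
        by (rule hpoly_cong[OF hpoly_cnj[OF hpoly_mon_lift] _ refl]) (simp add: k)
      show "invariant A (\<lambda>z. cnj (mon_lift k p t s z))"
        using mon_lift_invariant[OF k(2), of p] by (simp add: invariant_def)
      show "cnj (mon_lift k p t s (L w)) = mon p q s t w" for w
        by (simp add: mon_lift_L cnj_mon k(1)[symmetric])
    qed
  qed
qed

text \<open>It is the circle average of \<open>g\<close> that is lifted, not \<open>g\<close>. The
  average is linear and defined for every summand, so the induction over the span needs neither
  invariance of the summands nor uniqueness of the expansion into monomials.\<close>

lemma poly_average_lift:
  fixes g :: "complex^(unit + 'k::finite) \<Rightarrow> complex"
  assumes "mspan D g"
  shows "\<exists>f :: complex^('l + 'k) \<Rightarrow> complex. polyfun f \<and> (\<forall>d. D = {d} \<longrightarrow> hpoly d f) \<and> invariant A f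
    \<and> (\<forall>w. ((\<lambda>x. g (tact B (\<lambda>_. cis x) w)) has_integral complex_of_real (2 * pi) * f (L w)) {0..2 * pi})"
  using assms
proof induction
  case (mono p q s t x)
  have int: "((\<lambda>\<theta>. x * mon p q s t (tact B (\<lambda>_. cis \<theta>) w)) has_integral
      x * ((if wt p q s t = 0 then complex_of_real (2 * pi) else 0) * mon p q s t w)) {0..2 * pi}" for w
    unfolding mon_tact
    by (intro has_integral_mult_right has_integral_mult_left has_integral_cis_int)
  show ?case
  proof (cases "wt p q s t = 0")
    case True
    obtain f :: "complex^('l + 'k) \<Rightarrow> complex" where f: "hpoly (p + q + sum s UNIV + sum t UNIV) f"
      "invariant A f" "\<And>w. f (L w) = mon p q s t w"
      using mon_lift_exists[OF True] by metis
    show ?thesis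
    proof (intro exI[of _ "\<lambda>z. x * f z"] conjI allI impI)
      show "polyfun (\<lambda>z. x * f z)" by (intro polyfun_cmult hpoly_polyfun[OF f(1)])
      show "hpoly d (\<lambda>z. x * f z)" if "D = {d}" for d
        using f(1) mono that by (intro hpoly_cmult) auto
      show "invariant A (\<lambda>z. x * f z)" using f(2) by (simp add: invariant_def)
      show "((\<lambda>\<theta>. x * mon p q s t (tact B (\<lambda>_. cis \<theta>) w)) has_integral
          complex_of_real (2 * pi) * (x * f (L w))) {0..2 * pi}" for w
        using int[of w] True by (simp add: f(3) mult_ac)
    qed
  next
    case False
    then show ?thesis
      using int by (intro exI[of _ "\<lambda>_. 0"]) (auto simp: invariant_def intro: polyfun.intros hpoly_zero)
  qed
next
  case (add g g')
  obtain f :: "complex^('l + 'k) \<Rightarrow> complex" where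
    f: "polyfun f" "\<And>d. D = {d} \<Longrightarrow> hpoly d f" "invariant A f"
    "\<And>w. ((\<lambda>x. g (tact B (\<lambda>_. cis x) w)) has_integral complex_of_real (2 * pi) * f (L w)) {0..2 * pi}"
    using add.IH(1) by blast
  obtain f' :: "complex^('l + 'k) \<Rightarrow> complex" where
    f': "polyfun f'" "\<And>d. D = {d} \<Longrightarrow> hpoly d f'" "invariant A f'"
    "\<And>w. ((\<lambda>x. g' (tact B (\<lambda>_. cis x) w)) has_integral complex_of_real (2 * pi) * f' (L w)) {0..2 * pi}"
    using add.IH(2) by blast
  show ?case
  proof (intro exI[of _ "\<lambda>z. f z + f' z"] conjI allI impI)
    show "((\<lambda>x. g (tact B (\<lambda>_. cis x) w) + g' (tact B (\<lambda>_. cis x) w)) has_integral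
        complex_of_real (2 * pi) * (f (L w) + f' (L w))) {0..2 * pi}" for w
      using has_integral_add[OF f(4) f'(4)] by (simp add: distrib_left)
  qed (use f f' in \<open>auto simp: invariant_def intro: padd hadd\<close>)
qed

lemma poly_lifting_mspan:
  fixes g :: "complex^(unit + 'k::finite) \<Rightarrow> complex"
  assumes "mspan D g" "real_inv_poly B g"
  obtains f :: "complex^('l + 'k) \<Rightarrow> complex"
  where "real_inv_poly A f" "\<And>d. D = {d} \<Longrightarrow> hpoly d f" "\<And>w. f (L w) = g w"
proof -
  have g: "invariant B g" "\<And>w. Im (g w) = 0" using assms(2) by (auto simp: real_inv_poly_def)
  obtain f :: "complex^('l + 'k) \<Rightarrow> complex" where f: "polyfun f" "\<And>d. D = {d} \<Longrightarrow> hpoly d f" "invariant A f"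
    "\<And>w. ((\<lambda>x. g (tact B (\<lambda>_. cis x) w)) has_integral complex_of_real (2 * pi) * f (L w)) {0..2 * pi}"
    using poly_average_lift[OF assms(1)] by blast
  have fL: "f (L w) = g w" for w
  proof -
    have "g (tact B (\<lambda>_. cis x) w) = g w" for x
      using g(1) by (intro invariantD) (auto simp: torus_def)
    then have "((\<lambda>x. g w) has_integral complex_of_real (2 * pi) * f (L w)) {0..2 * pi}"
      using f(4)[of w] by simp
    moreover have "((\<lambda>x. g w) has_integral complex_of_real (2 * pi) * g w) {0..2 * pi}"
      using has_integral_const_real[of "g w" 0 "2 * pi"] by (simp add: scaleR_conv_of_real)
    ultimately have "complex_of_real (2 * pi) * f (L w) = complex_of_real (2 * pi) * g w"
      by (rule has_integral_unique)
    then show ?thesis by simp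
  qed
  show ?thesis
  \<comment> \<open>Taking the real part makes the lift real; the restriction is unaffected because
    \<open>g\<close> is real already.\<close>
  proof (rule that[of "\<lambda>z. 1/2 * (f z + cnj (f z))"])
    show "real_inv_poly A (\<lambda>z. 1/2 * (f z + cnj (f z)))"
      unfolding real_inv_poly_def
    proof (intro conjI)
      show "polyfun (\<lambda>z. 1/2 * (f z + cnj (f z)))"
        by (intro polyfun_cmult padd polyfun_cnj f(1))
      show "invariant A (\<lambda>z. 1/2 * (f z + cnj (f z)))"
        using f(3) by (simp add: invariant_def)
    qed simp
    show "hpoly d (\<lambda>z. 1/2 * (f z + cnj (f z)))" if "D = {d}" for d
      by (intro hpoly_cmult hadd hpoly_cnj f(2) that)
    show "1/2 * (f (L w) + cnj (f (L w))) = g w" for w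
      using g(2)[of w] by (simp add: fL complex_eq_iff)
  qed
qed

lemma poly_lifting:
  fixes g :: "complex^(unit + 'k::finite) \<Rightarrow> complex"
  assumes "real_inv_poly B g"
  obtains f :: "complex^('l + 'k) \<Rightarrow> complex" where "real_inv_poly A f" "\<And>w. f (L w) = g w"
proof -
  have "polyfun g" using assms by (simp add: real_inv_poly_def)
  then show ?thesis
    by (rule poly_lifting_mspan[OF polyfun_mspan assms]) (rule that)
qed

lemma hpoly_lifting:
  fixes g :: "complex^(unit + 'k::finite) \<Rightarrow> complex"
  assumes "real_inv_poly B g" "hpoly d g"
  obtains f :: "complex^('l + 'k) \<Rightarrow> complex" where "real_inv_poly A f" "hpoly d f" "\<And>w. f (L w) = g w"
  by (rule poly_lifting_mspan[OF hpoly_mspan[OF assms(2)] assms(1)]) (rule that; simp)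

subsection \<open>Lifting smooth functions\<close>

lemma smooth_lifting:
  fixes g :: "complex^(unit + 'k::finite) \<Rightarrow> real"
  assumes "smooth g" "invariant B g"
  obtains f :: "complex^('l + 'k) \<Rightarrow> real"
  where "smooth f" "invariant A f" "\<And>w. w \<in> Zset B \<Longrightarrow> f (L w) = g w"
proof -
  \<comment> \<open>The Taylor polynomial of degree \<open>d\<close> at 0, made complex-valued so
    that \<open>hpoly\<close> applies to it.\<close>
  define T where "T d w = inverse (complex_of_real (fact d)) * complex_of_real ((dd w ^^ d) g 0)" for d w
  have hT: "hpoly d (T d)" for d
    unfolding T_def by (intro hpoly_cmult hpoly_taylor assms)
  have "real_inv_poly B (T d)" for d
    unfolding real_inv_poly_def
  proof (intro conjI)
    show "polyfun (T d)" by (rule hpoly_polyfun[OF hT])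
    show "invariant B (T d)"
    proof (rule invariantI)
      fix t :: "unit \<Rightarrow> complex" and w :: "complex^(unit + 'k)" assume t: "torus t"
      have "(\<lambda>x. g (tact B t x)) = g"
        using invariantD[OF assms(2) t] by auto
      then have "(dd w ^^ d) g 0 = (dd (tact B t w) ^^ d) g (tact B t 0)"
        using dd_power_compose_linear[OF assms(1) bounded_linear_tact[of B t], of d w] by simp
      also have "tact B t 0 = 0" by (simp add: tact_def vec_eq_iff)
      finally show "T d (tact B t w) = T d w" by (simp add: T_def)
    qed
  qed (simp add: T_def)
  then have "\<forall>d. \<exists>f :: complex^('l + 'k) \<Rightarrow> complex. real_inv_poly A f \<and> hpoly d f \<and> (\<forall>w. f (L w) = T d w)"
    using hpoly_lifting[OF _ hT] by blast
  then obtain F :: "nat \<Rightarrow> complex^('l + 'k) \<Rightarrow> complex" where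
    "\<forall>d. real_inv_poly A (F d) \<and> hpoly d (F d) \<and> (\<forall>w. F d (L w) = T d w)"
    by (rule choice[THEN exE])
  then have F: "\<And>d. real_inv_poly A (F d)" "\<And>d. hpoly d (F d)" "\<And>d w. F d (L w) = T d w"
    by blast+
  have smF: "smooth (\<lambda>z. Re (F d z))" for d
    using F(1) smooth_polyfun by (auto simp: real_inv_poly_def)
  have homF: "Re (F d (r *\<^sub>R z)) = r ^ d * Re (F d z)" for d r z
    by (simp add: hpoly_homogeneous[OF F(2)] flip: of_real_power)
  obtain G where G: "smooth G"
    "\<forall>T. (\<forall>z. norm (T z) = norm z) \<and> (\<forall>d z. Re (F d (T z)) = Re (F d z)) \<longrightarrow> G \<circ> T = G"
    "\<And>N. \<exists>C r. r > 0 \<and> (\<forall>z. norm z < r \<longrightarrow> \<bar>G z - (\<Sum>d<N. Re (F d z))\<bar> \<le> C * norm z ^ N)"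
    by (rule borel[of "\<lambda>d z. Re (F d z)", OF smF homF]) (rule that; assumption)
  have invG: "invariant A G"
  proof (rule invariantI)
    fix u :: "'l \<Rightarrow> complex" and z :: "complex^('l + 'k)" assume u: "torus u"
    have "Re (F d (tact A u z)) = Re (F d z)" for d z
      using F(1) u by (auto simp: real_inv_poly_def invariant_def)
    then have "G \<circ> tact A u = G"
      using G(2) norm_tact[OF u] by blast
    then show "G (tact A u z) = G z" by (metis o_apply)
  qed
  \<comment> \<open>By construction \<open>g\<close> and \<open>G\<close> composed with
    \<open>L\<close> have the same Taylor polynomials at 0, so the difference is flat.\<close>
  define h where "h w = g w - G (L w)" for w
  have sh: "smooth h"
    unfolding h_def by (intro smooth_diff assms(1) smooth_compose_linear[OF G(1) bounded_linear_L])
  have ih: "invariant B h"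
    using assms(2) invariant_L[OF invG] by (simp add: invariant_def h_def)
  have fh: "flat h"
    unfolding flat_def
  proof
    fix N
    obtain C r where C: "r > 0" "\<And>z. norm z < r \<Longrightarrow> \<bar>G z - (\<Sum>d<N. Re (F d z))\<bar> \<le> C * norm z ^ N"
      using G(3)[of N] by blast
    obtain C' where C': "\<And>w. norm w \<le> 1 \<Longrightarrow> \<bar>g w - (\<Sum>d<N. (dd w ^^ d) g 0 / fact d)\<bar> \<le> C' * norm w ^ N"
      using taylor_remainder[OF assms(1)] by blast
    show "\<exists>C r. r > 0 \<and> (\<forall>w. norm w < r \<longrightarrow> \<bar>h w\<bar> \<le> C * norm w ^ N)"
    proof (rule exI[of _ "C + C'"], rule exI[of _ "min r 1"], intro conjI allI impI)
      fix w :: "complex^(unit + 'k)" assume w: "norm w < min r 1"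
      have "T d w = complex_of_real ((dd w ^^ d) g 0 / fact d)" for d
        by (simp add: T_def divide_inverse)
      then have "Re (F d (L w)) = (dd w ^^ d) g 0 / fact d" for d
        by (simp only: F(3) Re_complex_of_real)
      then have "\<bar>G (L w) - (\<Sum>d<N. (dd w ^^ d) g 0 / fact d)\<bar> \<le> C * norm w ^ N"
        using C(2)[of "L w"] w by simp
      with C'[of w] w show "\<bar>h w\<bar> \<le> (C + C') * norm w ^ N"
        by (simp add: h_def distrib_right)
    qed (use C(1) in simp)
  qed
  obtain f :: "complex^('l + 'k) \<Rightarrow> real" where f: "smooth f" "invariant A f" "\<And>w. w \<in> Zset B \<Longrightarrow> f (L w) = h w"
    using flat_lifting[OF sh fh ih] by blast
  show ?thesis
  proof (rule that[of "\<lambda>z. G z + f z"])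
    show "invariant A (\<lambda>z. G z + f z)" using f(2) invG by (simp add: invariant_def)
  qed (use f G(1) in \<open>auto intro: smooth_add simp: h_def\<close>)
qed

end

subsection \<open>Poisson brackets\<close>

lemma pbracket_dd:
  "pbracket f g z = (\<Sum>j\<in>UNIV. dd (axis j 1) f z * dd (axis j \<i>) g z - dd (axis j \<i>) f z * dd (axis j 1) g z)"
  by (simp add: pbracket_def dd_def)

lemma pbracket_swap: "pbracket f g z = - pbracket g f z"
  by (simp add: pbracket_dd sum_negf[symmetric] mult.commute)

lemma dd_diff: "smooth f \<Longrightarrow> smooth g \<Longrightarrow> dd v (\<lambda>x. f x - g x) x = dd v f x - dd v g x"
  by (intro dd_eqI has_derivative_diff smooth_has_derivative)

lemma pbracket_diff:
  "smooth e \<Longrightarrow> smooth f \<Longrightarrow> pbracket (\<lambda>x. e x - f x) g z = pbracket e g z - pbracket f g z"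
  by (simp add: pbracket_dd dd_diff algebra_simps sum_subtractf sum.distrib)

text \<open>Infinitesimal invariance: \<open>x\<close> is an element of the Lie algebra of the
  torus, and the direction is the velocity at 0 of the curve through \<open>z\<close> that it
  generates.\<close>

lemma orbit_derivative:
  fixes f :: "complex^'c::finite \<Rightarrow> real" and W :: "'l::finite \<Rightarrow> 'c \<Rightarrow> int"
  assumes "smooth f" "invariant W f"
  shows "dd (\<chi> j. \<i> * of_real (\<Sum>i\<in>UNIV. of_int (W i j) * x i) * z $ j) f z = 0"
proof -
  define s where "s j = (\<Sum>i\<in>UNIV. of_int (W i j) * x i)" for j
  define curve where "curve t = (\<chi> j. exp (\<i> * of_real t * of_real (s j)) * z $ j)" for t
  have curve_eq: "curve t = tact W (\<lambda>i. cis (t * x i)) z" for t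
  proof -
    have "(\<Prod>i\<in>UNIV. cis (t * x i) powi W i j) = exp (\<i> * of_real t * of_real (s j))" for j
    proof -
      have "cis (t * x i) powi W i j = exp (\<i> * of_real (of_int (W i j) * (t * x i)))" for i
        by (subst cis_power_int, subst cis_conv_exp, rule refl)
      then show ?thesis
        by (simp add: exp_sum[symmetric] s_def sum_distrib_left mult_ac)
    qed
    then show ?thesis by (simp add: curve_def tact_def)
  qed
  have "f (curve t) = f z" for t
    unfolding curve_eq using assms(2) by (intro invariantD) (auto simp: torus_def)
  then have const: "((\<lambda>t. f (curve t)) has_derivative (\<lambda>_. 0)) (at 0)" by simp
  have comp: "((\<lambda>t. exp (\<i> * of_real t * of_real (s j)) * z $ j) has_derivative
      (\<lambda>t. t *\<^sub>R (\<i> * of_real (s j) * z $ j))) (at 0)" for j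
  proof -
    have "((\<lambda>t. t *\<^sub>R (\<i> * of_real (s j))) has_derivative (\<lambda>t. t *\<^sub>R (\<i> * of_real (s j)))) (at 0)"
      by (intro bounded_linear_imp_has_derivative bounded_linear_scaleR_left)
    moreover have "(exp has_derivative (\<lambda>v. v)) (at (0 *\<^sub>R (\<i> * of_real (s j))))"
      using DERIV_exp[of "0 :: complex"] by (simp add: has_field_derivative_def times_fun_one)
    ultimately have "((\<lambda>t. exp (t *\<^sub>R (\<i> * of_real (s j)))) has_derivative (\<lambda>t. t *\<^sub>R (\<i> * of_real (s j)))) (at 0)"
      by (rule has_derivative_compose)
    from has_derivative_mult_left[OF this, of "z $ j"] show ?thesis
      by (simp add: scaleR_conv_of_real[where 'a = complex] mult_ac)
  qed
  have "(curve has_derivative (\<lambda>t. t *\<^sub>R (\<chi> j. \<i> * of_real (s j) * z $ j))) (at 0)"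
    unfolding has_derivative_componentwise_within[of curve] curve_def
  proof
    fix b :: "complex^'c" assume "b \<in> Basis"
    then obtain j u where b: "b = axis j u" by (auto simp: Basis_vec_def)
    show "((\<lambda>t. (\<chi> j. exp (\<i> * of_real t * of_real (s j)) * z $ j) \<bullet> b) has_derivative
        (\<lambda>t. (t *\<^sub>R (\<chi> j. \<i> * of_real (s j) * z $ j)) \<bullet> b)) (at 0)"
      using has_derivative_inner_left[OF comp[of j], of u] by (simp add: b inner_axis)
  qed
  from has_derivative_compose[OF this smooth_has_derivative[OF assms(1)]]
  have "((\<lambda>t. f (curve t)) has_derivative (\<lambda>t. dd (t *\<^sub>R (\<chi> j. \<i> * of_real (s j) * z $ j)) f z)) (at 0)"
    by (simp add: curve_def)
  from has_derivative_unique[OF this const]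
  have "dd (1 *\<^sub>R (\<chi> j. \<i> * of_real (s j) * z $ j)) f z = 0" by metis
  then show ?thesis by (simp add: s_def)
qed

lemma dd_tact:
  assumes "smooth f" "invariant W f" "torus t"
  shows "dd (tact W t v) f (tact W t z) = dd v f z"
proof -
  have "(\<lambda>x. f (tact W t x)) = f" using invariantD[OF assms(2,3)] by auto
  then show ?thesis
    using dd_compose_linear[OF smooth_differentiable[OF assms(1)] bounded_linear_tact[of W t], of v z] by simp
qed

lemma tact_axis: "tact W t (axis j u) = axis j ((\<Prod>i\<in>UNIV. t i powi W i j) * u)"
  by (auto simp: tact_def axis_def vec_eq_iff)

lemma linear_dd_axis:
  fixes f :: "complex^'n::finite \<Rightarrow> real"
  assumes "smooth f"
  shows "linear (\<lambda>u. dd (axis j u) f z)"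
proof -
  have "linear (\<lambda>u. axis j u :: complex^'n)"
    by (rule linearI) (auto simp: axis_def vec_eq_iff)
  from linear_compose[OF this dd_linear[OF assms]] show ?thesis by (simp add: o_def)
qed

text \<open>Some group element acts on the \<open>j\<close>-th coordinate by \<open>- 1\<close>.\<close>

lemma invariant_dd_zero:
  assumes "smooth f" "invariant W f" "W i j \<noteq> 0"
  shows "dd (axis j u) f 0 = 0"
proof -
  define t where "t k = (if k = i then cis (pi / of_int (W i j)) else 1)" for k
  have t: "torus t" by (simp add: torus_def t_def)
  have "(\<Prod>k\<in>UNIV. t k powi W k j) = (\<Prod>k\<in>UNIV. if k = i then - 1 else 1)"
    using assms(3) by (intro prod.cong) (auto simp: t_def cis_power_int)
  then have "tact W t (axis j u) = axis j (- u)" by (simp add: tact_axis)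
  moreover have "tact W t 0 = 0" by (simp add: tact_def vec_eq_iff)
  ultimately have "dd (axis j (- u)) f 0 = dd (axis j u) f 0"
    using dd_tact[OF assms(1,2) t, of "axis j u" 0] by simp
  then show ?thesis
    using linear_neg[OF linear_dd_axis[OF assms(1), of j 0], of u] by simp
qed

text \<open>A two-by-two determinant transforms by the determinant of the change of real basis from
  1, \<open>\<i>\<close> to \<open>s\<close>, \<open>\<i> * s\<close>, which is the squared modulus
  of \<open>s\<close>.\<close>

lemma linear_complex_bracket:
  fixes D G :: "complex \<Rightarrow> real"
  assumes "linear D" "linear G"
  shows "D s * G (\<i> * s) - D (\<i> * s) * G s = (cmod s)\<^sup>2 * (D 1 * G \<i> - D \<i> * G 1)"
proof -
  have ex: "H u = Re u * H 1 + Im u * H \<i>" if "linear H" for H :: "complex \<Rightarrow> real" and u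
  proof -
    have "u = Re u *\<^sub>R 1 + Im u *\<^sub>R \<i>" by (simp add: complex_eq_iff)
    then show ?thesis using linear_add[OF that] linear_scale[OF that] by (metis real_scaleR_def)
  qed
  show ?thesis
    unfolding ex[OF assms(1), of s] ex[OF assms(2), of s] ex[OF assms(1), of "\<i> * s"] ex[OF assms(2), of "\<i> * s"]
      cmod_power2
    by (simp add: algebra_simps power2_eq_square)
qed

lemma pbracket_invariant:
  assumes "smooth f" "smooth g" "invariant W f" "invariant W g" "torus t"
  shows "pbracket f g (tact W t z) = pbracket f g z"
proof -
  define s where "s j = (\<Prod>i\<in>UNIV. t i powi W i j)" for j
  have s: "cmod (s j) = 1" for j
    using assms(5) by (simp add: s_def prod_norm[symmetric] norm_power_int torus_def)
  have d: "dd (axis j u) h z = dd (axis j (s j * u)) h (tact W t z)" if "smooth h" "invariant W h" for h j u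
    using dd_tact[OF that assms(5), of "axis j u" z] by (simp add: tact_axis s_def)
  have "dd (axis j 1) f z * dd (axis j \<i>) g z - dd (axis j \<i>) f z * dd (axis j 1) g z
    = dd (axis j 1) f (tact W t z) * dd (axis j \<i>) g (tact W t z)
      - dd (axis j \<i>) f (tact W t z) * dd (axis j 1) g (tact W t z)" for j
    unfolding d[OF assms(1,3)] d[OF assms(2,4)]
    using linear_complex_bracket[OF linear_dd_axis[OF assms(1), of j "tact W t z"]
        linear_dd_axis[OF assms(2), of j "tact W t z"], of "s j"]
    by (simp add: s mult.commute)
  then show ?thesis by (simp add: pbracket_dd)
qed

lemma sum_UNIV_Plus: "(\<Sum>j\<in>UNIV. f j) = (\<Sum>i\<in>UNIV. f (Inl i)) + (\<Sum>j\<in>UNIV. f (Inr j))"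
  for f :: "'i::finite + 'j::finite \<Rightarrow> 'a::comm_monoid_add"
  by (simp add: UNIV_Plus_UNIV[symmetric] sum.Plus del: UNIV_Plus_UNIV)

lemma vec_axis_expand: "(\<chi> j. x j) = (\<Sum>j\<in>UNIV. axis j (x j))"
  by (simp add: vec_eq_iff axis_def)

lemma dd_axis_expand: "smooth f \<Longrightarrow> dd (\<chi> j. x j) f z = (\<Sum>j\<in>UNIV. dd (axis j (x j)) f z)"
  unfolding vec_axis_expand using linear_sum[OF dd_linear] by blast

section \<open>Brackets on the shell and under the embedding\<close>

context type_I
begin

text \<open>Away from 0 the shell is a smooth hypersurface, so \<open>e\<close> has differential
  proportional to that of the moment map. The bracket with the moment map differentiates along the
  circle orbit, which kills \<open>g\<close>. At 0 all first derivatives of invariants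
  vanish.\<close>

lemma pbracket_zero:
  fixes e g :: "complex^(unit + 'k::finite) \<Rightarrow> real"
  assumes "smooth e" "smooth g" "invariant B e" "invariant B g"
    and vanish: "\<And>w. w \<in> Zset B \<Longrightarrow> e w = 0" and w: "w \<in> Zset B"
  shows "pbracket e g w = 0"
proof (cases "w = 0")
  case True
  have "B () j \<noteq> 0" for j :: "unit + 'k"
    using alpha_pos beta_pos by (cases j) auto
  then show ?thesis
    using True invariant_dd_zero[OF assms(1,3)] by (simp add: pbracket_dd)
next
  case False
  then have w1: "w $ Inl () \<noteq> 0" using Zset_B_zero[OF w] by blast
  define S where "S w = (\<Sum>j\<in>UNIV. (cmod (w $ Inr j))\<^sup>2)" for w :: "complex^(unit + 'k)"
  define q where "q w = (real \<beta> * S w) / (real \<alpha> * (cmod (w $ Inl ()))\<^sup>2)" for w :: "complex^(unit + 'k)"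
  \<comment> \<open>A retraction near \<open>w\<close> onto the shell that rescales only the first
    coordinate. As \<open>e\<close> vanishes on the shell, its composition with \<open>r\<close> has
    derivative zero.\<close>
  define r where "r v = join (sqrt (q v) *\<^sub>R v $ Inl ()) v" for v :: "complex^(unit + 'k)"
  \<comment> \<open>The differential of the moment map at \<open>w\<close>.\<close>
  define l where "l v = (\<Sum>j\<in>UNIV. of_int (B () j) * Re (cnj (w $ j) * v $ j))" for v
  define U where "U = {v :: complex^(unit + 'k). v $ Inl () \<noteq> 0}"
  have U: "open U" "w \<in> U"
    using w1 unfolding U_def by (auto intro!: open_Collect_neq continuous_intros)
  define N where "N = real \<alpha> * (cmod (w $ Inl ()))\<^sup>2"
  have eq: "N = real \<beta> * S w"
    using w by (simp add: Zset_B_iff S_def N_def)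
  have pos: "N \<noteq> 0" using w1 alpha_pos by (simp add: N_def)
  then have qw: "q w = 1" using pos by (simp add: q_def N_def[symmetric] eq[symmetric])
  have nth: "((\<lambda>v. v $ j) has_derivative (\<lambda>v. v $ j)) (at w)" for j
    by (intro bounded_linear_imp_has_derivative bounded_linear_vec_nth)
  have "(q has_derivative (\<lambda>v. ((real \<beta> * (\<Sum>j\<in>UNIV. 2 * Re (cnj (w $ Inr j) * v $ Inr j))) * N
      - (real \<beta> * S w) * (real \<alpha> * (2 * Re (cnj (w $ Inl ()) * v $ Inl ()))))
      / (N * N))) (at w)"
    unfolding q_def S_def N_def
    by (intro has_derivative_divide' has_derivative_mult_right has_derivative_sum has_derivative_cmod_power2 nth)
      (use pos N_def in simp)
  moreover have "((real \<beta> * (\<Sum>j\<in>UNIV. 2 * Re (cnj (w $ Inr j) * v $ Inr j))) * N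
      - (real \<beta> * S w) * (real \<alpha> * (2 * Re (cnj (w $ Inl ()) * v $ Inl ()))))
      / (N * N)
      = 2 / N * l v" for v
    unfolding eq[symmetric] l_def sum_UNIV_Plus N_def using w1 alpha_pos
    by (simp add: UNIV_unit field_simps power2_eq_square sum_distrib_left sum_distrib_right)
  ultimately have "(q has_derivative (\<lambda>v. 2 / N * l v)) (at w)" by simp
  from has_derivative_real_sqrt[OF _ this]
  have "((\<lambda>v. sqrt (q v)) has_derivative (\<lambda>v. 1 / N * l v)) (at w)"
    by (simp add: qw)
  from has_derivative_join[OF has_derivative_scaleR[OF this nth]]
  have "(r has_derivative (\<lambda>v. join (v $ Inl () + (1 / N * l v) *\<^sub>R w $ Inl ()) v)) (at w)"
    unfolding r_def[abs_def] by (simp add: qw)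
  from has_derivative_compose[OF this smooth_has_derivative[OF assms(1)]]
  have "((\<lambda>v. e (r v)) has_derivative
      (\<lambda>v. dd (join (v $ Inl () + (1 / N * l v) *\<^sub>R w $ Inl ()) v) e w)) (at w)"
    by (simp add: r_def qw)
  moreover have "((\<lambda>v. e (r v)) has_derivative (\<lambda>_. 0)) (at w)"
  proof (rule has_derivative_transform_within_open[OF has_derivative_const U])
    fix v assume v: "v \<in> U"
    have "0 \<le> q v" unfolding q_def S_def by (intro divide_nonneg_nonneg mult_nonneg_nonneg sum_nonneg) auto
    then have "r v \<in> Zset B"
      using v alpha_pos by (simp add: Zset_B_iff r_def power_mult_distrib q_def S_def U_def)
    then show "0 = e (r v)" by (simp add: vanish)
  qed
  ultimately have z: "dd (join (v $ Inl () + (1 / N * l v) *\<^sub>R w $ Inl ()) v) e w = 0" for v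
    by (rule fun_cong[OF has_derivative_unique])
  \<comment> \<open>Solving the vanishing of the derivative of \<open>e\<close> along
    \<open>r\<close> for \<open>dd v e w\<close> gives this factor of proportionality.\<close>
  define K where "K = - dd (axis (Inl ()) (w $ Inl ())) e w / N"
  have de: "dd v e w = K * l v" for v
  proof -
    note lin = dd_linear[OF assms(1), of w]
    have "join (v $ Inl () + (1 / N * l v) *\<^sub>R w $ Inl ()) v
        = v + (1 / N * l v) *\<^sub>R axis (Inl ()) (w $ Inl ())"
      by (rule vec_sum_eqI) (auto simp: axis_def)
    then show ?thesis
      using z[of v] linear_add[OF lin] linear_scale[OF lin] by (simp add: K_def field_simps)
  qed
  have l_axis: "l (axis j u) = of_int (B () j) * Re (cnj (w $ j) * u)" for j u
  proof -
    have "l (axis j u) = (\<Sum>i\<in>UNIV. if i = j then of_int (B () j) * Re (cnj (w $ j) * u) else 0)"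
      unfolding l_def by (intro sum.cong) (auto simp: axis_def)
    then show ?thesis by simp
  qed
  have "dd (axis j 1) e w * dd (axis j \<i>) g w - dd (axis j \<i>) e w * dd (axis j 1) g w
    = K * dd (axis j (\<i> * of_real (of_int (B () j)) * w $ j)) g w" for j
  proof -
    note lin = linear_dd_axis[OF assms(2), of j w]
    have "\<i> * of_real (of_int (B () j)) * w $ j
        = (of_int (B () j) * Re (w $ j)) *\<^sub>R \<i> + (- (of_int (B () j) * Im (w $ j))) *\<^sub>R 1"
      by (simp add: complex_eq_iff)
    then have "dd (axis j (\<i> * of_real (of_int (B () j)) * w $ j)) g w
        = of_int (B () j) * Re (w $ j) * dd (axis j \<i>) g w + - (of_int (B () j) * Im (w $ j)) * dd (axis j 1) g w"
      by (simp only: linear_add[OF lin] linear_scale[OF lin] real_scaleR_def)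
    note eq = this
    show ?thesis unfolding eq by (simp add: de l_axis algebra_simps)
  qed
  then have "pbracket e g w = K * dd (\<chi> j. \<i> * of_real (of_int (B () j)) * w $ j) g w"
    by (simp add: pbracket_dd dd_axis_expand[OF assms(2)] sum_distrib_left)
  then show ?thesis
    using orbit_derivative[OF assms(2,4), of "\<lambda>_. 1" w] by (simp add: UNIV_unit)
qed

text \<open>For arbitrary functions the two brackets differ: on V_A there is a sum of l
  determinants, on V_B the single determinant of \<open>c\<close>-weighted sums. Invariance under
  each circle factor makes the angular derivatives proportional to \<open>c\<close>, and then the
  two expressions agree.\<close>

lemma pbracket_L:
  fixes f g :: "complex^('l + 'k::finite) \<Rightarrow> real"
  assumes "smooth f" "smooth g" "invariant A f" "invariant A g" "w \<in> Zset B"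
  shows "pbracket (\<lambda>w. f (L w)) (\<lambda>w. g (L w)) w = pbracket f g (L w)"
proof (cases "w = 0")
  case True
  have "\<exists>i. A i j \<noteq> 0" for j :: "'l + 'k"
    using a_pos n_pos by (cases j) (auto intro!: exI[of _ "SOME i. True"])
  then have "dd (axis j u) f 0 = 0" for j u
    using invariant_dd_zero[OF assms(1,3)] by metis
  moreover have "B () j \<noteq> 0" for j :: "unit + 'k"
    using alpha_pos beta_pos by (cases j) auto
  then have "dd (axis j u) (\<lambda>w. f (L w)) 0 = 0" for j u
    using invariant_dd_zero[OF smooth_compose_linear[OF assms(1) bounded_linear_L] invariant_L[OF assms(3)]] by metis
  moreover have "L (0 :: complex^(unit + 'k)) = 0" by (rule vec_sum_eqI) auto
  ultimately show ?thesis using True by (simp add: pbracket_dd)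
next
  case False
  then have w1: "w $ Inl () \<noteq> 0" using Zset_B_zero[OF assms(5)] by blast
  define z where "z = L w"
  have dL: "dd v (\<lambda>w. h (L w)) w = dd (L v) h z" if "smooth h" for h v
    unfolding z_def by (rule dd_compose_linear[OF smooth_differentiable[OF that] bounded_linear_L])
  have Inr: "L (axis (Inr j) u) = axis (Inr j) u" for j u
    by (rule vec_sum_eqI) (auto simp: axis_def)
  have Inl: "dd (L (axis (Inl ()) u)) h z = (\<Sum>i\<in>UNIV. c i * dd (axis (Inl i) u) h z)" if "smooth h" for h u
  proof -
    note lin = dd_linear[OF that, of z]
    have "L (axis (Inl ()) u :: complex^(unit + 'k)) = (\<Sum>i\<in>UNIV. c i *\<^sub>R axis (Inl i) u)"
      by (rule vec_sum_eqI) (auto simp: axis_def if_distrib cong: if_cong)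
    then show ?thesis
      using linear_sum[OF lin, of "\<lambda>i. c i *\<^sub>R axis (Inl i) u" UNIV] linear_scale[OF lin] by simp
  qed
  have orb: "\<exists>K. \<forall>i. dd (axis (Inl i) (\<i> * w $ Inl ())) h z = K * c i" if "smooth h" "invariant A h" for h
  proof -
    \<comment> \<open>The derivative along the simultaneous rotation of the last k coordinates.
      Invariance under the i-th circle balances \<open>a i\<close> times the i-th angular derivative
      against \<open>n i * T\<close>, with the same \<open>T\<close> for every i.\<close>
    define T where "T = (\<Sum>j\<in>UNIV. dd (axis (Inr j) (\<i> * w $ Inr j)) h z)"
    have "dd (axis (Inl i) (\<i> * w $ Inl ())) h z = real \<beta> / real \<alpha> * T * c i" for i
    proof -
      have s: "(\<Sum>k\<in>UNIV. of_int (A k j) * (if k = i then 1 else 0)) = real_of_int (A i j)" for j :: "'l + 'k"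
        by (simp add: if_distrib cong: if_cong)
      have scale: "dd (axis j (of_real r * u)) h z = r * dd (axis j u) h z" for j r u
        using linear_scale[OF linear_dd_axis[OF that(1), of j z], of r u]
        by (simp add: scaleR_conv_of_real[where 'a = complex])
      have zero: "dd (axis j 0) h z = 0" for j
        using linear_0[OF linear_dd_axis[OF that(1)]] .
      have "0 = (\<Sum>j\<in>UNIV. dd (axis j (\<i> * of_real (of_int (A i j)) * z $ j)) h z)"
        using orbit_derivative[OF that, of "\<lambda>k. if k = i then 1 else 0" z]
        unfolding s dd_axis_expand[OF that(1)] by simp
      also have "\<dots> = (\<Sum>j\<in>UNIV. of_int (A i j) * dd (axis j (\<i> * z $ j)) h z)"
      proof (intro sum.cong refl)
        fix j
        have "\<i> * of_real (of_int (A i j)) * z $ j = of_real (of_int (A i j)) * (\<i> * z $ j)"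
          by simp
        then show "dd (axis j (\<i> * of_real (of_int (A i j)) * z $ j)) h z
            = of_int (A i j) * dd (axis j (\<i> * z $ j)) h z"
          by (simp only: scale)
      qed
      also have "\<dots> = - real (a i) * dd (axis (Inl i) (\<i> * z $ Inl i)) h z + real (n i) * T"
      proof -
        have "(\<Sum>k\<in>UNIV. of_int (A i (Inl k)) * dd (axis (Inl k) (\<i> * z $ Inl k)) h z)
            = (\<Sum>k\<in>UNIV. if k = i then - real (a i) * dd (axis (Inl i) (\<i> * z $ Inl i)) h z else 0)"
          by (intro sum.cong) auto
        then show ?thesis
          unfolding sum_UNIV_Plus by (simp add: T_def sum_distrib_left z_def)
      qed
      also have "dd (axis (Inl i) (\<i> * z $ Inl i)) h z = c i * dd (axis (Inl i) (\<i> * w $ Inl ())) h z"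
        using scale[of "Inl i" "c i" "\<i> * w $ Inl ()"] by (simp add: z_def scaleR_conv_of_real[where 'a = complex] mult_ac)
      finally have 1: "real (a i) * c i * dd (axis (Inl i) (\<i> * w $ Inl ())) h z = real (n i) * T"
        by simp
      have "real (a i) * real (m i) = real (n i) * real \<alpha>"
        using am[of i] by (metis of_nat_mult)
      then have "real (n i) = real (a i) * (c i)\<^sup>2 * real \<beta> / real \<alpha>"
        using alpha_pos beta_pos by (simp add: c_power2 field_simps)
      with 1 have "real (a i) * c i * dd (axis (Inl i) (\<i> * w $ Inl ())) h z
          = real (a i) * c i * (real \<beta> / real \<alpha> * T * c i)"
        by (simp add: power2_eq_square mult_ac)
      moreover have "real (a i) * c i \<noteq> 0" using a_pos[of i] by simp
      ultimately show ?thesis using mult_left_cancel by blast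
    qed
    then show ?thesis by blast
  qed
  obtain K where K: "\<And>i. dd (axis (Inl i) (\<i> * w $ Inl ())) f z = K * c i" using orb[OF assms(1,3)] by blast
  obtain M where M: "\<And>i. dd (axis (Inl i) (\<i> * w $ Inl ())) g z = M * c i" using orb[OF assms(2,4)] by blast
  define P where "P u i = dd (axis (Inl i) u) f z" for u i
  define R where "R u i = dd (axis (Inl i) u) g z" for u i
  have lP: "linear (\<lambda>u. P u i)" and lR: "linear (\<lambda>u. R u i)" for i
    unfolding P_def R_def by (intro linear_dd_axis assms)+
  have lP': "linear (\<lambda>u. \<Sum>i\<in>UNIV. c i * P u i)" and lR': "linear (\<lambda>u. \<Sum>i\<in>UNIV. c i * R u i)"
    using linear_add[OF lP] linear_scale[OF lP] linear_add[OF lR] linear_scale[OF lR]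
    by (auto intro!: linearI simp: sum.distrib distrib_left sum_distrib_left mult_ac)
  let ?s = "w $ Inl ()"
  have cc: "(\<Sum>i\<in>UNIV. c i * (k * c i)) = k" for k
    using c_sum by (simp add: power2_eq_square mult.left_commute sum_distrib_left[symmetric])
  \<comment> \<open>In the basis \<open>?s\<close>, \<open>\<i> * ?s\<close> the angular derivatives
    are \<open>K * c i\<close> and \<open>M * c i\<close>. These constants leave the sum, and
    \<open>cc\<close> turns each of them back into a \<open>c\<close>-weighted sum.\<close>
  have "(cmod ?s)\<^sup>2 * (\<Sum>i\<in>UNIV. P 1 i * R \<i> i - P \<i> i * R 1 i)
      = (\<Sum>i\<in>UNIV. P ?s i * R (\<i> * ?s) i - P (\<i> * ?s) i * R ?s i)"
    unfolding sum_distrib_left by (intro sum.cong refl linear_complex_bracket[OF lP lR, symmetric])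
  also have "\<dots> = (\<Sum>i\<in>UNIV. c i * P ?s i) * M - K * (\<Sum>i\<in>UNIV. c i * R ?s i)"
    by (simp add: P_def R_def K M sum_subtractf sum_distrib_left sum_distrib_right mult_ac)
  also have "\<dots> = (\<Sum>i\<in>UNIV. c i * P ?s i) * (\<Sum>i\<in>UNIV. c i * R (\<i> * ?s) i)
      - (\<Sum>i\<in>UNIV. c i * P (\<i> * ?s) i) * (\<Sum>i\<in>UNIV. c i * R ?s i)"
    by (simp add: P_def R_def K M cc)
  also have "\<dots> = (cmod ?s)\<^sup>2 * ((\<Sum>i\<in>UNIV. c i * P 1 i) * (\<Sum>i\<in>UNIV. c i * R \<i> i)
      - (\<Sum>i\<in>UNIV. c i * P \<i> i) * (\<Sum>i\<in>UNIV. c i * R 1 i))"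
    by (rule linear_complex_bracket[OF lP' lR'])
  finally have "(\<Sum>i\<in>UNIV. P 1 i * R \<i> i - P \<i> i * R 1 i)
      = (\<Sum>i\<in>UNIV. c i * P 1 i) * (\<Sum>i\<in>UNIV. c i * R \<i> i)
      - (\<Sum>i\<in>UNIV. c i * P \<i> i) * (\<Sum>i\<in>UNIV. c i * R 1 i)"
    using w1 by simp
  then show ?thesis
    unfolding pbracket_dd dL[OF assms(1)] dL[OF assms(2)] sum_UNIV_Plus z_def[symmetric]
    by (simp add: UNIV_unit Inr Inl assms P_def R_def)
qed

text \<open>The two arguments are exchanged one at a time; each time the difference vanishes on the
  shell, so \<open>pbracket_zero\<close> applies.\<close>

lemma pbracket_transfer:
  fixes f g :: "complex^('l + 'k::finite) \<Rightarrow> real" and f' g' :: "complex^(unit + 'k) \<Rightarrow> real"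
  assumes f: "smooth f" "invariant A f" and g: "smooth g" "invariant A g"
    and f': "smooth f'" "invariant B f'" and g': "smooth g'" "invariant B g'"
    and eq: "\<And>w. w \<in> Zset B \<Longrightarrow> f' w = f (L w)" "\<And>w. w \<in> Zset B \<Longrightarrow> g' w = g (L w)"
    and w: "w \<in> Zset B"
  shows "pbracket f' g' w = pbracket f g (L w)"
proof -
  have L: "smooth (\<lambda>w. h (L w))" "invariant B (\<lambda>w. h (L w))" if "smooth h" "invariant A h"
    for h :: "complex^('l + 'k) \<Rightarrow> real"
    using smooth_compose_linear[OF that(1) bounded_linear_L] invariant_L[OF that(2)] by auto
  have inv: "invariant B (\<lambda>w. h w - k w)" if "invariant B h" "invariant B k" for h k :: "complex^(unit + 'k) \<Rightarrow> real"
    using that by (simp add: invariant_def)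
  have "pbracket (\<lambda>w. f' w - f (L w)) g' w = 0"
    by (rule pbracket_zero[OF smooth_diff[OF f'(1) L(1)[OF f]] g'(1) inv[OF f'(2) L(2)[OF f]] g'(2) _ w])
      (simp add: eq)
  then have "pbracket f' g' w = pbracket (\<lambda>w. f (L w)) g' w"
    by (simp add: pbracket_diff[OF f'(1) L(1)[OF f]])
  moreover have "pbracket (\<lambda>w. g' w - g (L w)) (\<lambda>w. f (L w)) w = 0"
    by (rule pbracket_zero[OF smooth_diff[OF g'(1) L(1)[OF g]] L(1)[OF f] inv[OF g'(2) L(2)[OF g]] L(2)[OF f] _ w])
      (simp add: eq)
  then have "pbracket g' (\<lambda>w. f (L w)) w = pbracket (\<lambda>w. g (L w)) (\<lambda>w. f (L w)) w"
    by (simp add: pbracket_diff[OF g'(1) L(1)[OF g]])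
  ultimately have "pbracket f' g' w = pbracket (\<lambda>w. f (L w)) (\<lambda>w. g (L w)) w"
    using pbracket_swap[of "\<lambda>w. f (L w)" g' w] pbracket_swap[of "\<lambda>w. f (L w)" "\<lambda>w. g (L w)" w] by simp
  also have "\<dots> = pbracket f g (L w)" by (rule pbracket_L[OF f(1) g(1) f(2) g(2) w])
  finally show ?thesis .
qed

end

subsection \<open>Orbit spaces\<close>

lemma tact_tact: "torus t \<Longrightarrow> torus s \<Longrightarrow> tact W s (tact W t z) = tact W (\<lambda>i. s i * t i) z"
  by (simp add: tact_def power_int_mult_distrib prod.distrib mult.assoc)

lemma tact_one [simp]: "tact W (\<lambda>_. 1) z = z"
  by (simp add: tact_def)

lemma torus_mult: "torus s \<Longrightarrow> torus t \<Longrightarrow> torus (\<lambda>i. s i * t i)"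
  by (simp add: torus_def norm_mult)

lemma torus_inverse: "torus t \<Longrightarrow> torus (\<lambda>i. inverse (t i))"
  by (simp add: torus_def norm_inverse)

lemma torus_one: "torus (\<lambda>_. 1)"
  by (simp add: torus_def)

lemma tact_inverse: "torus t \<Longrightarrow> tact W (\<lambda>i. inverse (t i)) (tact W t z) = z"
proof -
  assume t: "torus t"
  have "t i \<noteq> 0" for i using t by (metis norm_zero torus_def zero_neq_one)
  then show ?thesis using t by (simp add: tact_tact torus_inverse)
qed

lemma orbit_self: "z \<in> orbit W z"
  unfolding orbit_def using tact_one[of W z, symmetric] torus_one by blast

lemma orbit_tact:
  assumes "torus t"
  shows "orbit W (tact W t z) = orbit W z"
proof (intro set_eqI iffI)
  fix x assume "x \<in> orbit W (tact W t z)"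
  then obtain s where "torus s" "x = tact W s (tact W t z)" by (auto simp: orbit_def)
  then show "x \<in> orbit W z"
    unfolding orbit_def using assms torus_mult by (auto simp: tact_tact)
next
  fix x assume "x \<in> orbit W z"
  then obtain s where s: "torus s" "x = tact W s z" by (auto simp: orbit_def)
  then have "x = tact W s (tact W (\<lambda>i. inverse (t i)) (tact W t z))"
    using tact_inverse[OF assms, of W z] by simp
  then have "x = tact W (\<lambda>i. s i * inverse (t i)) (tact W t z)"
    by (simp only: tact_tact[OF torus_inverse[OF assms] s(1)])
  then show "x \<in> orbit W (tact W t z)"
    unfolding orbit_def using torus_mult[OF s(1) torus_inverse[OF assms]] by blast
qed

lemma orbit_eq_iff: "orbit W x = orbit W y \<longleftrightarrow> (\<exists>t. torus t \<and> x = tact W t y)"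
proof
  assume "orbit W x = orbit W y"
  then have "x \<in> orbit W y" using orbit_self by blast
  then show "\<exists>t. torus t \<and> x = tact W t y" by (auto simp: orbit_def)
qed (auto simp: orbit_tact)

lemma cmod_tact: "torus t \<Longrightarrow> cmod (tact W t z $ j) = cmod (z $ j)"
  by (simp add: tact_def norm_mult prod_norm[symmetric] norm_power_int torus_def)

lemma tact_Zset: "torus t \<Longrightarrow> tact W t z \<in> Zset W \<longleftrightarrow> z \<in> Zset W"
  by (simp add: Zset_def moment_def cmod_tact)

lemma Union_M0_subset: "U \<subseteq> M0 W \<Longrightarrow> \<Union>U = {z \<in> Zset W. orbit W z \<in> U}"
proof (intro set_eqI iffI)
  assume U: "U \<subseteq> M0 W"
  fix x assume "x \<in> \<Union>U"
  then obtain P where P: "x \<in> P" "P \<in> U" by blast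
  with U obtain y where y: "y \<in> Zset W" "P = orbit W y" unfolding M0_def by blast
  with P(1) obtain t where "torus t" "x = tact W t y" by (auto simp: orbit_def)
  then have "x \<in> Zset W" "orbit W x = P" using y by (simp_all add: tact_Zset orbit_tact)
  then show "x \<in> {z \<in> Zset W. orbit W z \<in> U}" using P(2) by simp
next
  fix x assume "x \<in> {z \<in> Zset W. orbit W z \<in> U}"
  then show "x \<in> \<Union>U" using orbit_self[of x W] by blast
qed

text \<open>\<open>M0top\<close> is given through \<open>topology\<close>, so the axioms have to be
  verified. Closure under intersection rests on orbits being disjoint or equal: only then does the
  union of \<open>S \<inter> T\<close> equal the intersection of the unions.\<close>

lemma openin_M0top: "openin (M0top W) U \<longleftrightarrow> U \<subseteq> M0 W \<and> openin (top_of_set (Zset W)) (\<Union>U)"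
proof -
  have "istopology (\<lambda>U. U \<subseteq> M0 W \<and> openin (top_of_set (Zset W)) (\<Union>U))"
    unfolding istopology_def
  proof (intro conjI allI impI)
    fix S T assume ST: "S \<subseteq> M0 W \<and> openin (top_of_set (Zset W)) (\<Union>S)" "T \<subseteq> M0 W \<and> openin (top_of_set (Zset W)) (\<Union>T)"
    then show "S \<inter> T \<subseteq> M0 W" by blast
    then have "\<Union>(S \<inter> T) = {z \<in> Zset W. orbit W z \<in> S \<inter> T}"
      by (rule Union_M0_subset)
    also have "\<dots> = {z \<in> Zset W. orbit W z \<in> S} \<inter> {z \<in> Zset W. orbit W z \<in> T}" by blast
    also have "\<dots> = \<Union>S \<inter> \<Union>T" using Union_M0_subset[of S W] Union_M0_subset[of T W] ST by simp
    finally have "\<Union>(S \<inter> T) = \<Union>S \<inter> \<Union>T" .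
    then show "openin (top_of_set (Zset W)) (\<Union>(S \<inter> T))" using ST by (simp add: openin_Int)
  next
    fix K assume K: "\<forall>S\<in>K. S \<subseteq> M0 W \<and> openin (top_of_set (Zset W)) (\<Union>S)"
    then show "\<Union>K \<subseteq> M0 W" by blast
    have "\<Union>(\<Union>K) = \<Union>(Union ` K)" by blast
    moreover have "openin (top_of_set (Zset W)) (\<Union>(Union ` K))"
      using K by (intro openin_Union) blast
    ultimately show "openin (top_of_set (Zset W)) (\<Union>(\<Union>K))" by simp
  qed
  then show ?thesis by (simp add: M0top_def topology_inverse')
qed

lemma topspace_M0top: "topspace (M0top W) = M0 W"
proof -
  have "\<Union>(M0 W) = Zset W"
    using Union_M0_subset[of "M0 W" W] by (auto simp: M0_def)
  then have "openin (M0top W) (M0 W)" by (simp add: openin_M0top)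
  then show ?thesis
    by (metis openin_M0top openin_subset openin_topspace subset_antisym)
qed

lemma quotient_map_orbit: "quotient_map (top_of_set (Zset W)) (M0top W) (orbit W)"
  unfolding quotient_map_def topspace_M0top
  by (auto simp: openin_M0top Union_M0_subset M0_def)

text \<open>Torus elements are plain functions; vectors are used here to give them a
  topology.\<close>

lemma compact_torus: "compact {u :: complex^'l::finite. torus (($) u)}"
proof -
  have "closed {u :: complex^'l. torus (($) u)}"
    unfolding torus_def Collect_all_eq
    by (intro closed_INT ballI closed_Collect_eq continuous_intros)
  moreover have "norm u \<le> real CARD('l)" if "torus (($) u)" for u :: "complex^'l"
  proof -
    have "norm u \<le> (\<Sum>i\<in>UNIV. norm (u $ i))"
      unfolding norm_vec_def by (rule L2_set_le_sum) simp
    then show ?thesis using that by (simp add: torus_def)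
  qed
  then have "bounded {u :: complex^'l. torus (($) u)}"
    unfolding bounded_iff by blast
  ultimately show ?thesis by (simp add: compact_eq_bounded_closed)
qed

lemma continuous_on_tact:
  "continuous_on ({u :: complex^'l::finite. torus (($) u)} \<times> S) (\<lambda>(u, z). tact W (($) u) z)"
proof -
  have "u $ i \<noteq> 0" if "torus (($) u)" for u :: "complex^'l" and i
    using that by (metis norm_zero torus_def zero_neq_one)
  then show ?thesis
    unfolding tact_def case_prod_beta
    by (intro continuous_on_vec_lambda continuous_on_mult continuous_on_prod' continuous_on_power_int
        continuous_intros) auto
qed

lemma closed_Zset: "closed (Zset W)"
  unfolding Zset_def moment_def Collect_all_eq
  by (intro closed_INT ballI closed_Collect_eq continuous_intros)

section \<open>The induced homeomorphism of the quotients\<close>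

context type_I
begin

lemma polyfun_L: "polyfun f \<Longrightarrow> polyfun (\<lambda>w. f (L w))"
proof (induction rule: polyfun.induct)
  case (pvar j)
  then show ?case
    by (cases j) (simp_all add: scaleR_conv_of_real polyfun_cmult polyfun.intros)
next
  case (pcvar j)
  then show ?case
    by (cases j) (simp_all add: scaleR_conv_of_real polyfun_cmult polyfun.intros)
qed (auto intro: polyfun.intros)

lemma hpoly_L: "hpoly d f \<Longrightarrow> hpoly d (\<lambda>w. f (L w))"
proof (induction rule: hpoly.induct)
  case (hvar j)
  then show ?case
    by (cases j) (simp_all add: scaleR_conv_of_real hpoly_cmult hpoly.intros del: One_nat_def)
next
  case (hcvar j)
  then show ?case
    by (cases j) (simp_all add: scaleR_conv_of_real hpoly_cmult hpoly.intros del: One_nat_def)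
qed (auto intro: hpoly.intros)

lemma real_inv_poly_L: "real_inv_poly A f \<Longrightarrow> real_inv_poly B (\<lambda>w. f (L w))"
  by (simp add: real_inv_poly_def polyfun_L invariant_L)

lemma L_Zset: "L w \<in> Zset A \<longleftrightarrow> w \<in> Zset B"
proof -
  have "real (a i) * (c i)\<^sup>2 = real (n i) * real \<alpha> / real \<beta>" for i
    using am[of i] by (simp add: c_power2 flip: of_nat_mult)
  then have *: "real (a i) * (c i * cmod (w $ Inl ()))\<^sup>2 = real (n i) * (real \<alpha> * (cmod (w $ Inl ()))\<^sup>2 / real \<beta>)" for i
    by (simp add: power_mult_distrib mult.assoc[symmetric])
  have "L w \<in> Zset A \<longleftrightarrow> (\<forall>i. real (a i) * (c i * cmod (w $ Inl ()))\<^sup>2 = real (n i) * (\<Sum>j\<in>UNIV. (cmod (w $ Inr j))\<^sup>2))"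
    using c_pos by (simp add: Zset_A_iff abs_of_pos)
  also have "\<dots> \<longleftrightarrow> real \<alpha> * (cmod (w $ Inl ()))\<^sup>2 / real \<beta> = (\<Sum>j\<in>UNIV. (cmod (w $ Inr j))\<^sup>2)"
    unfolding * using n_pos by (simp only: mult_cancel_left of_nat_eq_0_iff) auto
  finally show ?thesis
    using beta_pos by (auto simp: Zset_B_iff field_simps)
qed

text \<open>The shell equations force the moduli \<open>c i * r\<close> with a common
  \<open>r\<close>. The i-th circle acts on the i-th coordinate with weight \<open>- a i\<close>, so
  the phases can be removed one by one by taking \<open>a i\<close>-th roots; the effect on the last
  k coordinates is undone in \<open>w\<close>.\<close>

lemma Zset_A_orbit:
  fixes z :: "complex^('l + 'k::finite)"
  assumes "z \<in> Zset A"
  obtains w where "w \<in> Zset B" "orbit A z = orbit A (L w)"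
proof -
  define S where "S = (\<Sum>j\<in>UNIV. (cmod (z $ Inr j))\<^sup>2)"
  define r where "r = sqrt (real \<beta> * S / real \<alpha>)"
  have S: "0 \<le> S" by (simp add: S_def sum_nonneg)
  then have r: "0 \<le> r" "r\<^sup>2 = real \<beta> * S / real \<alpha>" by (simp_all add: r_def)
  have zi: "cmod (z $ Inl i) = c i * r" for i
  proof -
    have "real (a i) * (cmod (z $ Inl i))\<^sup>2 = real (n i) * S"
      using assms by (simp add: Zset_A_iff S_def)
    moreover have "real (a i) * real (m i) = real (n i) * real \<alpha>"
      using am[of i] by (metis of_nat_mult)
    ultimately have "real (a i) * (cmod (z $ Inl i))\<^sup>2 = real (a i) * (c i * r)\<^sup>2"
      using alpha_pos beta_pos by (simp add: power_mult_distrib c_power2 r field_simps)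
    then have "(cmod (z $ Inl i))\<^sup>2 = (c i * r)\<^sup>2" using a_pos[of i] by simp
    then show ?thesis using r(1) c_pos[of i] by (simp add: less_imp_le)
  qed
  have "\<exists>u. cmod u = 1 \<and> inverse (u ^ a i) * of_real (c i * r) = z $ Inl i" for i
  proof -
    \<comment> \<open>The phase to be removed; a vanishing coordinate has none, and 1 is as good as
      any unit.\<close>
    define s where "s = (if z $ Inl i = 0 then 1 else of_real (c i * r) / z $ Inl i)"
    obtain u where u: "s = u ^ a i"
      using exists_complex_root[of "a i" s] a_pos[of i] by auto
    have s: "cmod s = 1"
      using zi[of i] c_pos[of i] r(1) by (auto simp: s_def norm_divide norm_mult abs_of_pos abs_of_nonneg)
    have "cmod u ^ a i = 1 ^ a i" using s u by (simp add: norm_power[symmetric])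
    then have "cmod u = 1" using a_pos[of i] power_eq_iff_eq_base[of "a i" "cmod u" 1] by simp
    moreover have "inverse s * of_real (c i * r) = z $ Inl i"
      using zi[of i] by (auto simp: s_def)
    ultimately show ?thesis using u by auto
  qed
  then obtain u where u: "\<And>i. cmod (u i) = 1" "\<And>i. inverse (u i ^ a i) * of_real (c i * r) = z $ Inl i"
    by metis
  define d where "d = (\<Prod>i\<in>UNIV. u i ^ n i)"
  have tu: "torus u" using u(1) by (simp add: torus_def)
  have d: "cmod d = 1" unfolding d_def by (rule cmod_prod_power[OF tu])
  then have d0: "d \<noteq> 0" by auto
  \<comment> \<open>\<open>join\<close> reads only the last k coordinates of its second argument, so
    all of \<open>z\<close> may be scaled.\<close>
  define w :: "complex^(unit + 'k)" where "w = join (of_real r) (\<chi> j. inverse d * z $ j)"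
  have z: "z = tact A u (L w)"
    using u(2) d0 by (intro vec_sum_eqI) (auto simp: w_def scaleR_conv_of_real d_def[symmetric] mult_ac)
  show ?thesis
  proof (rule that[of w])
    have "L w \<in> Zset A" using assms z tact_Zset[OF tu] by metis
    then show "w \<in> Zset B" by (simp add: L_Zset)
    show "orbit A z = orbit A (L w)" using z orbit_tact[OF tu] by metis
  qed
qed

text \<open>If w_1 is nonzero, all \<open>u i ^ a i\<close> coincide, and then
  \<open>d ^ \<alpha>\<close> is the \<beta>-th power of their common value. Coprimality turns this
  pair into one circle element; \<open>invariant_weightB\<close> is applied to the orbit
  map.\<close>

lemma orbit_L_inj:
  fixes w w' :: "complex^(unit + 'k::finite)"
  assumes "w \<in> Zset B" "w' \<in> Zset B" "orbit A (L w') = orbit A (L w)"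
  shows "orbit B w' = orbit B w"
proof -
  obtain u where u: "torus u" "L w' = tact A u (L w)"
    using assms(3) unfolding orbit_eq_iff by blast
  define d where "d = (\<Prod>i\<in>UNIV. u i ^ n i)"
  have u0: "u i \<noteq> 0" for i using u(1) by (metis norm_zero torus_def zero_neq_one)
  have 1: "w' $ Inl () = inverse (u i ^ a i) * w $ Inl ()" for i
    using arg_cong[OF u(2), of "\<lambda>z. z $ Inl i"] by (simp add: scaleR_conv_of_real mult_ac)
  have 2: "w' $ Inr j = d * w $ Inr j" for j
    using arg_cong[OF u(2), of "\<lambda>z. z $ Inr j"] by (simp add: d_def)
  show ?thesis
  proof (cases "w $ Inl () = 0")
    case True
    then have "w' $ Inl () = 0" using 1[of undefined] by simp
    with True have "w = 0" "w' = 0" using Zset_B_zero assms(1,2) by blast+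
    then show ?thesis by simp
  next
    case False
    define i0 :: 'l where "i0 = undefined"
    have eq: "u i ^ a i = u i0 ^ a i0" for i
      using 1[of i] 1[of i0] False by simp
    have "d ^ \<alpha> = (\<Prod>i\<in>UNIV. (u i ^ a i) ^ m i)"
      by (simp add: d_def prod_power_distrib power_mult[symmetric] am)
    also have "\<dots> = (\<Prod>i\<in>UNIV. (u i0 ^ a i0) ^ m i)"
      by (intro prod.cong refl arg_cong[of _ _ "\<lambda>x. x ^ _"] eq)
    also have "\<dots> = (u i0 ^ a i0) ^ \<beta>"
      by (simp only: msum power_sum[symmetric])
    finally have pw: "d ^ \<alpha> = (u i0 ^ a i0) ^ \<beta>" .
    have "invariant B (orbit B :: complex^(unit + 'k) \<Rightarrow> _)"
      by (simp add: invariant_def orbit_tact)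
    moreover have "cmod (u i0 ^ a i0) = 1" using u(1) by (simp add: torus_def norm_power)
    moreover have "cmod d = 1" unfolding d_def by (rule cmod_prod_power[OF u(1)])
    ultimately show ?thesis
      using pw 1[of i0] 2 by (intro invariant_weightB[OF _ coprime, of "orbit B" "u i0 ^ a i0" d])
  qed
qed

text \<open>A union instead of a chosen representative: by equivariance of \<open>L\<close> all
  members of the union are the same orbit.\<close>

definition F :: "(complex^(unit + 'k::finite)) set \<Rightarrow> (complex^('l + 'k)) set" where
  "F P = (\<Union>w\<in>P. orbit A (L w))"

lemma F_orbit: "F (orbit B w) = orbit A (L w)"
proof -
  have "orbit A (L x) = orbit A (L w)" if "x \<in> orbit B w" for x
    using that by (auto simp: orbit_def[of B] tact_L[symmetric] orbit_tact torus_hom)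
  then show ?thesis unfolding F_def using orbit_self by blast
qed

lemma inj_L: "inj (L :: complex^(unit + 'k::finite) \<Rightarrow> _)"
proof (rule injI)
  fix x y :: "complex^(unit + 'k)" assume eq: "L x = L y"
  have "L (x - y) = L x - L y"
    by (rule linear_diff[OF bounded_linear.linear[OF bounded_linear_L]])
  then have "norm (x - y) = 0" using eq norm_L[of "x - y"] by simp
  then show "x = y" by simp
qed

lemma quotient_map_orbit_L:
  "quotient_map (top_of_set (Zset B)) (M0top A) (\<lambda>w :: complex^(unit + 'k::finite). orbit A (L w))"
proof (rule continuous_closed_imp_quotient_map)
  have "continuous_map (top_of_set (Zset B)) (top_of_set (Zset A)) (L :: complex^(unit + 'k) \<Rightarrow> _)"
    using linear_continuous_on[OF bounded_linear_L] by (auto simp: L_Zset)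
  from continuous_map_compose[OF this quotient_imp_continuous_map[OF quotient_map_orbit]]
  show "continuous_map (top_of_set (Zset B)) (M0top A) (\<lambda>w :: complex^(unit + 'k). orbit A (L w))"
    by (simp add: o_def)
  show "(\<lambda>w :: complex^(unit + 'k). orbit A (L w)) ` topspace (top_of_set (Zset B)) = topspace (M0top A)"
  proof -
    have "orbit A (L w) \<in> M0 A" if "w \<in> Zset B" for w :: "complex^(unit + 'k)"
      using that by (simp add: M0_def L_Zset)
    moreover have "X \<in> (\<lambda>w :: complex^(unit + 'k). orbit A (L w)) ` Zset B" if X: "X \<in> M0 A"
      for X :: "(complex^('l + 'k)) set"
    proof -
      obtain z where z: "z \<in> Zset A" "X = orbit A z" using X by (auto simp: M0_def)
      obtain w :: "complex^(unit + 'k)" where "w \<in> Zset B" "orbit A z = orbit A (L w)"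
        using Zset_A_orbit[OF z(1)] .
      then show ?thesis using z(2) by blast
    qed
    ultimately show ?thesis by (auto simp: topspace_M0top)
  qed
  show "closed_map (top_of_set (Zset B)) (M0top A) (\<lambda>w :: complex^(unit + 'k). orbit A (L w))"
    unfolding closed_map_def
  proof (intro allI impI)
    fix C :: "(complex^(unit + 'k)) set" assume "closedin (top_of_set (Zset B)) C"
    then have C: "closed C" "C \<subseteq> Zset B"
      using closed_Zset closedin_closed_trans closedin_imp_subset by blast+
    let ?T = "{u :: complex^'l. torus (($) u)}"
    let ?P = "{z. \<exists>u. u \<in> ?T \<and> (u, z) \<in> (?T \<times> Zset A) \<inter> (\<lambda>(u, z). tact A (($) u) z) -` (L ` C)}"
    let ?V = "(\<lambda>w. orbit A (L w)) ` C"
    have LC: "closed (L ` C)"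
      by (intro closed_injective_linear_image C inj_L bounded_linear.linear bounded_linear_L)
    have "closedin (top_of_set (?T \<times> Zset A)) ((?T \<times> Zset A) \<inter> (\<lambda>(u, z). tact A (($) u) z) -` (L ` C))"
      by (intro continuous_closedin_preimage continuous_on_tact LC)
    from closedin_compact_projection[OF compact_torus this]
    have "closedin (top_of_set (Zset A)) (?P)" .
    moreover have "?P = {z \<in> Zset A. orbit A z \<in> ?V}"
    proof (intro set_eqI iffI)
      fix z assume "z \<in> ?P"
      then obtain u w where *: "torus (($) u)" "z \<in> Zset A" "w \<in> C" "tact A (($) u) z = L w" by auto
      then have "orbit A z = orbit A (L w)" using orbit_tact by metis
      then show "z \<in> {z \<in> Zset A. orbit A z \<in> ?V}" using * by auto
    next
      fix z assume "z \<in> {z \<in> Zset A. orbit A z \<in> ?V}"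
      then obtain w where w: "z \<in> Zset A" "w \<in> C" "orbit A (L w) = orbit A z" by auto
      then obtain t where t: "torus t" "L w = tact A t z" unfolding orbit_eq_iff by blast
      moreover have "tact A t z \<in> L ` C" unfolding t(2)[symmetric] using w(2) by blast
      moreover have "($) (\<chi> i. t i) = t" by auto
      ultimately have "((\<chi> i. t i), z) \<in> (?T \<times> Zset A) \<inter> (\<lambda>(u, z). tact A (($) u) z) -` (L ` C)"
        using w by auto
      then show "z \<in> ?P" by blast
    qed
    moreover have "?V \<subseteq> M0 A" using C(2) by (auto simp: M0_def L_Zset)
    ultimately show "closedin (M0top A) ?V"
      using quotient_map_orbit[of A, unfolded quotient_map_closedin] by (auto simp: topspace_M0top)
  qed
qed

lemma homeomorphic_map_F:
  "homeomorphic_map (M0top B) (M0top A) (F :: (complex^(unit + 'k::finite)) set \<Rightarrow> _)"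
  unfolding homeomorphic_map_def
proof
  have eq: "F \<circ> orbit B = (\<lambda>w :: complex^(unit + 'k). orbit A (L w))"
    by (auto simp: F_orbit)
  have q: "quotient_map (top_of_set (Zset B)) (M0top A) (F \<circ> (orbit B :: complex^(unit + 'k) \<Rightarrow> _))"
    unfolding eq by (rule quotient_map_orbit_L)
  show "quotient_map (M0top B) (M0top A) (F :: (complex^(unit + 'k)) set \<Rightarrow> _)"
    using quotient_map_orbit[of B] q quotient_imp_continuous_map[OF q]
    by (intro quotient_map_from_composition[OF quotient_imp_continuous_map[OF quotient_map_orbit[of B]] _ q]
        continuous_compose_quotient_map[OF quotient_map_orbit[of B]])
  show "inj_on F (topspace (M0top B :: (complex^(unit + 'k)) set topology))"
  proof (rule inj_onI)
    fix X Y :: "(complex^(unit + 'k)) set"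
    assume "X \<in> topspace (M0top B)" "Y \<in> topspace (M0top B)" "F X = F Y"
    then obtain x y where "x \<in> Zset B" "y \<in> Zset B" "X = orbit B x" "Y = orbit B y" "F X = F Y"
      by (auto simp: topspace_M0top M0_def)
    then show "X = Y" using orbit_L_inj[of y x] by (simp add: F_orbit)
  qed
qed

section \<open>Pull-back of the function algebras and of the bracket\<close>

text \<open>Every orbit in Z_A meets the image of Z_B, so an invariant function on Z_A is determined
  by its values there.\<close>

lemma lifts_L:
  fixes f :: "complex^('l + 'k::finite) \<Rightarrow> 'b"
  assumes "invariant A f"
  shows "lifts A f \<phi> \<longleftrightarrow> lifts B (\<lambda>w. f (L w)) (\<phi> \<circ> F)"
proof
  assume "lifts A f \<phi>"
  then show "lifts B (\<lambda>w. f (L w)) (\<phi> \<circ> F)" by (simp add: lifts_def F_orbit L_Zset)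
next
  assume l: "lifts B (\<lambda>w. f (L w)) (\<phi> \<circ> F)"
  show "lifts A f \<phi>"
    unfolding lifts_def
  proof
    fix z :: "complex^('l + 'k)" assume "z \<in> Zset A"
    then obtain w :: "complex^(unit + 'k)" where w: "w \<in> Zset B" "orbit A z = orbit A (L w)"
      by (rule Zset_A_orbit)
    then have "f z = f (L w)"
      using invariantD[OF assms] unfolding orbit_eq_iff by auto
    then show "\<phi> (orbit A z) = f z" using l w by (simp add: lifts_def F_orbit)
  qed
qed

lemma smooth_M0_F:
  fixes \<phi> :: "(complex^('l + 'k::finite)) set \<Rightarrow> real"
  shows "smooth_M0 A \<phi> \<longleftrightarrow> smooth_M0 B (\<phi> \<circ> F)"
proof
  assume "smooth_M0 A \<phi>"
  then obtain f where "smooth f" "invariant A f" "lifts A f \<phi>" by (auto simp: smooth_M0_def)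
  then show "smooth_M0 B (\<phi> \<circ> F)"
    unfolding smooth_M0_def
    using smooth_compose_linear[OF _ bounded_linear_L] invariant_L lifts_L by blast
next
  assume "smooth_M0 B (\<phi> \<circ> F)"
  then obtain g where g: "smooth g" "invariant B g" "lifts B g (\<phi> \<circ> F)" by (auto simp: smooth_M0_def)
  obtain f :: "complex^('l + 'k) \<Rightarrow> real" where f: "smooth f" "invariant A f" "\<And>w. w \<in> Zset B \<Longrightarrow> f (L w) = g w"
    using smooth_lifting[OF g(1,2)] by blast
  have "lifts B (\<lambda>w. f (L w)) (\<phi> \<circ> F)" using g(3) f(3) by (simp add: lifts_def)
  then show "smooth_M0 A \<phi>" unfolding smooth_M0_def using f lifts_L by blast
qed

text \<open>The predicates \<open>P\<close> and \<open>R\<close> stand for a side condition on the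
  degree, or for none, so that the graded and the ungraded statement share one proof.\<close>

lemma real_inv_poly_lifts_F:
  fixes \<phi> :: "(complex^('l + 'k::finite)) set \<Rightarrow> real"
  assumes "\<And>f. P f \<Longrightarrow> R (\<lambda>w. f (L w))"
    and "\<And>g. real_inv_poly B g \<Longrightarrow> R g \<Longrightarrow> \<exists>f. real_inv_poly A f \<and> P f \<and> (\<forall>w. f (L w) = g w)"
  shows "(\<exists>f. real_inv_poly A f \<and> P f \<and> lifts A (\<lambda>z. Re (f z)) \<phi>) \<longleftrightarrow>
    (\<exists>g. real_inv_poly B g \<and> R g \<and> lifts B (\<lambda>w. Re (g w)) (\<phi> \<circ> F))"
proof -
  have l: "lifts A (\<lambda>z. Re (f z)) \<phi> \<longleftrightarrow> lifts B (\<lambda>w. Re (f (L w))) (\<phi> \<circ> F)"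
    if "real_inv_poly A f" for f :: "complex^('l + 'k) \<Rightarrow> complex"
    using that by (intro lifts_L) (auto simp: real_inv_poly_def invariant_def)
  show ?thesis
  proof
    assume "\<exists>f. real_inv_poly A f \<and> P f \<and> lifts A (\<lambda>z. Re (f z)) \<phi>"
    then show "\<exists>g. real_inv_poly B g \<and> R g \<and> lifts B (\<lambda>w. Re (g w)) (\<phi> \<circ> F)"
      using l real_inv_poly_L assms(1) by blast
  next
    assume "\<exists>g. real_inv_poly B g \<and> R g \<and> lifts B (\<lambda>w. Re (g w)) (\<phi> \<circ> F)"
    then obtain g where g: "real_inv_poly B g" "R g" "lifts B (\<lambda>w. Re (g w)) (\<phi> \<circ> F)" by blast
    obtain f where "real_inv_poly A f" "P f" "\<And>w. f (L w) = g w"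
      using assms(2)[OF g(1,2)] by blast
    with g(3) l[of f] show "\<exists>f. real_inv_poly A f \<and> P f \<and> lifts A (\<lambda>z. Re (f z)) \<phi>" by auto
  qed
qed

lemma Rpoly_M0_F:
  fixes \<phi> :: "(complex^('l + 'k::finite)) set \<Rightarrow> real"
  shows "Rpoly_M0 A \<phi> \<longleftrightarrow> Rpoly_M0 B (\<phi> \<circ> F)"
    and "Rpoly_deg_M0 A d \<phi> \<longleftrightarrow> Rpoly_deg_M0 B d (\<phi> \<circ> F)"
proof -
  have "\<exists>f :: complex^('l + 'k) \<Rightarrow> complex. real_inv_poly A f \<and> True \<and> (\<forall>w. f (L w) = g w)"
    if "real_inv_poly B g" for g
    by (rule poly_lifting[OF that]) blast
  from real_inv_poly_lifts_F[OF _ this, of "\<lambda>_. True" \<phi>]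
  show "Rpoly_M0 A \<phi> \<longleftrightarrow> Rpoly_M0 B (\<phi> \<circ> F)"
    unfolding Rpoly_M0_def by simp
  have "\<exists>f :: complex^('l + 'k) \<Rightarrow> complex. real_inv_poly A f \<and> hpoly d f \<and> (\<forall>w. f (L w) = g w)"
    if "real_inv_poly B g" "hpoly d g" for g
    by (rule hpoly_lifting[OF that]) blast
  from real_inv_poly_lifts_F[OF hpoly_L this]
  show "Rpoly_deg_M0 A d \<phi> \<longleftrightarrow> Rpoly_deg_M0 B d (\<phi> \<circ> F)"
    unfolding Rpoly_deg_M0_def .
qed

lemma graded_regular_symplecto_F:
  "graded_regular_symplecto B A (F :: (complex^(unit + 'k::finite)) set \<Rightarrow> _)"
  unfolding graded_regular_symplecto_def
proof (intro conjI allI impI ballI homeomorphic_map_F smooth_M0_F Rpoly_M0_F)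
  fix f g :: "complex^('l + 'k) \<Rightarrow> real" and f' g' :: "complex^(unit + 'k) \<Rightarrow> real"
    and w :: "complex^(unit + 'k)" and z :: "complex^('l + 'k)"
  assume *: "smooth f \<and> invariant A f \<and> smooth g \<and> invariant A g \<and> smooth f' \<and> invariant B f'
      \<and> smooth g' \<and> invariant B g' \<and> (\<forall>w\<in>Zset B. \<forall>z\<in>Zset A. F (orbit B w) = orbit A z \<longrightarrow> f' w = f z \<and> g' w = g z)"
    and w: "w \<in> Zset B" and F: "F (orbit B w) = orbit A z"
  have "f' w = f (L w) \<and> g' w = g (L w)" if "w \<in> Zset B" for w
    using * that by (auto simp: F_orbit L_Zset)
  then have "pbracket f' g' w = pbracket f g (L w)"
    using * w by (intro pbracket_transfer) auto
  also obtain t where "torus t" "L w = tact A t z"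
    using F unfolding F_orbit orbit_eq_iff by blast
  then have "pbracket f g (L w) = pbracket f g z"
    using * by (auto intro: pbracket_invariant)
  finally show "pbracket f' g' w = pbracket f g z" .
qed

end

subsection \<open>Coprimality of \<open>\<alpha>\<close> and \<open>\<beta>\<close>\<close>

lemma cis_root_dvd:
  assumes "0 < g" "cis (2 * pi / real g) ^ k = 1"
  shows "g dvd k"
proof -
  have "cis (real k * (2 * pi / real g)) = 1"
    using assms(2) by (simp only: Complex.DeMoivre)
  then have "exp (\<i> * complex_of_real (real k * (2 * pi / real g))) = 1"
    by (simp only: cis_conv_exp)
  then obtain j :: int where "real k * (2 * pi / real g) = of_int (2 * j) * pi"
    unfolding exp_eq_1 by auto
  then have "real k = of_int j * real g"
    using assms(1) by (simp add: field_simps)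
  then have "int k = j * int g"
    by (metis of_int_eq_iff of_int_mult of_int_of_nat_eq)
  then have "int g dvd int k" by simp
  then show ?thesis by (simp only: int_dvd_int_iff)
qed

lemma alphaA_pos:
  fixes a :: "'l::finite \<Rightarrow> nat"
  assumes "\<And>i. 0 < a i"
  shows "0 < alphaA a"
proof -
  have "0 \<notin> range a" using assms by (metis less_irrefl rangeE)
  then have "Lcm (range a) \<noteq> 0" by (subst Lcm_0_iff_nat) auto
  then show ?thesis unfolding alphaA_def by (rule neq0_conv[THEN iffD1])
qed

lemma mA_eq: "mA a n i = n i * (alphaA a div a i)"
proof -
  have "a i dvd alphaA a" by (simp add: alphaA_def)
  then show ?thesis by (simp add: mA_def div_mult_swap)
qed

text \<open>If \<open>g\<close> divides both \<open>\<alpha>\<close> and \<open>\<beta>\<close> and \<open>x\<close> is a primitive \<open>g\<close>-th root of unity, then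
  \<open>(x ^ (\<alpha> / a i))\<close> acts trivially.\<close>

lemma coprime_alphaA_betaA:
  fixes a n :: "'l::finite \<Rightarrow> nat"
  assumes a_pos: "\<And>i. 0 < a i"
    and faith: "faithful (typeI a n :: 'l \<Rightarrow> ('l + 'k::finite) \<Rightarrow> int)"
  shows "coprime (alphaA a) (betaA a n)"
proof -
  define g where "g = gcd (alphaA a) (betaA a n)"
  define x where "x = cis (2 * pi / real g)"
  define u where "u i = x ^ (alphaA a div a i)" for i
  have dvd: "a i dvd alphaA a" for i by (simp add: alphaA_def)
  have al: "0 < alphaA a" by (rule alphaA_pos[OF a_pos])
  then have g: "0 < g" by (simp add: g_def)
  have xg: "x ^ g = 1"
    using g by (simp add: x_def Complex.DeMoivre)
  have x1: "x ^ k = 1" if "g dvd k" for k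
    using that xg by (auto simp: power_mult)
  have "torus u" by (simp add: torus_def u_def x_def norm_power)
  moreover have "(\<Prod>i\<in>UNIV. u i powi typeI a n i j) = 1" for j :: "'l + 'k"
  proof (cases j)
    case (Inl i)
    have "u k ^ a k = 1" for k
      using x1[of "alphaA a"] dvd[of k] by (simp add: u_def power_mult[symmetric] g_def)
    then have "u k powi typeI a n k (Inl i :: 'l + 'k) = 1" for k
      by (simp add: power_int_minus)
    then show ?thesis by (simp add: Inl)
  next
    case (Inr k)
    have "(\<Prod>i\<in>UNIV. u i ^ n i) = x ^ betaA a n"
      by (simp add: u_def power_mult[symmetric] betaA_def mA_eq power_sum mult.commute)
    then show ?thesis using x1[of "betaA a n"] by (simp add: Inr g_def)
  qed
  ultimately have "u i = 1" for i using faith unfolding faithful_def by blast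
  \<comment> \<open>Faithfulness makes every \<open>u i\<close> trivial, and \<open>x\<close> has
    exact order \<open>g\<close>. Then each \<open>a i\<close> divides
    \<open>alphaA a div g\<close>, so minimality of the least common multiple leaves only
    \<open>g = 1\<close>.\<close>
  then have gd: "g dvd alphaA a div a i" for i
    using cis_root_dvd[OF g] by (simp add: u_def x_def)
  have "a i dvd alphaA a div g" for i
  proof -
    obtain q where q: "alphaA a = a i * q" using dvd[of i] by (elim dvdE)
    then have "g dvd q" using gd[of i] a_pos[of i] by simp
    then obtain p where "q = g * p" by (elim dvdE)
    then show ?thesis using q g by simp
  qed
  then have "alphaA a dvd alphaA a div g"
    unfolding alphaA_def[of a] by (intro Lcm_least) (auto simp: alphaA_def)
  moreover have "0 < alphaA a div g"
    using al g by (simp add: g_def div_greater_zero_iff dvd_imp_le)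
  ultimately have "alphaA a \<le> alphaA a div g" by (rule dvd_imp_le)
  then have "g = 1"
    using al g div_less_dividend[of g "alphaA a"] by (metis linorder_not_less nat_neq_iff less_one)
  then show ?thesis by (simp add: g_def coprime_iff_gcd_eq_1)
qed

lemma type_I_typeI:
  fixes a n :: "'l::finite \<Rightarrow> nat"
  assumes "\<forall>i. a i > 0" "\<forall>i. n i > 0"
    and "faithful (typeI a n :: 'l \<Rightarrow> ('l + 'k::finite) \<Rightarrow> int)"
  shows "type_I a n (mA a n) (alphaA a) (betaA a n)"
proof
  show "coprime (alphaA a) (betaA a n)"
    using assms by (intro coprime_alphaA_betaA) auto
  show "a i dvd alphaA a" for i by (simp add: alphaA_def)
  then show "a i * mA a n i = n i * alphaA a" for i
    by (simp add: mA_eq)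
  show "0 < alphaA a" using assms(1) by (intro alphaA_pos) simp
qed (use assms in \<open>auto simp: betaA_def\<close>)

theorem theorem4p5:
  fixes a n :: "'l::finite \<Rightarrow> nat"
  assumes apos: "\<forall>i. a i > 0"
    and npos: "\<forall>i. n i > 0"
    and faith: "faithful (typeI a n :: 'l \<Rightarrow> ('l + 'k::finite) \<Rightarrow> int)"
  defines "A \<equiv> (typeI a n :: 'l \<Rightarrow> ('l + 'k) \<Rightarrow> int)"
    and "B \<equiv> (weightB (alphaA a) (betaA a n) :: unit \<Rightarrow> (unit + 'k) \<Rightarrow> int)"
    and "\<alpha> \<equiv> alphaA a" and "\<beta> \<equiv> betaA a n" and "m \<equiv> mA a n" and "\<kappa> \<equiv> kappaA a n"
  shows "\<exists>\<Phi> :: (complex^('l + 'k) \<Rightarrow> complex) \<Rightarrow> (complex^(unit + 'k) \<Rightarrow> complex).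
     \<comment> \<open>Phi is a well-defined algebra homomorphism between invariant polynomial algebras\<close>
     (\<forall>f. polyfun f \<and> invariant A f \<longrightarrow> polyfun (\<Phi> f) \<and> invariant B (\<Phi> f))
   \<and> (\<forall>c. \<Phi> (\<lambda>_. c) = (\<lambda>_. c))
   \<and> (\<forall>f g. polyfun f \<and> invariant A f \<and> polyfun g \<and> invariant A g \<longrightarrow>
        \<Phi> (\<lambda>z. f z + g z) = (\<lambda>w. \<Phi> f w + \<Phi> g w)
      \<and> \<Phi> (\<lambda>z. f z * g z) = (\<lambda>w. \<Phi> f w * \<Phi> g w))
     \<comment> \<open>values on the generators r_i, p_ij, q_s, conj q_s\<close>
   \<and> (\<forall>i. \<Phi> (\<lambda>z. z $ Inl i * cnj (z $ Inl i))
          = (\<lambda>w. complex_of_real (real (m i) / real \<beta>) * (w $ Inl () * cnj (w $ Inl ()))))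
   \<and> (\<forall>i j. \<Phi> (\<lambda>z. z $ Inr i * cnj (z $ Inr j)) = (\<lambda>w. w $ Inr i * cnj (w $ Inr j)))
   \<and> (\<forall>s :: 'k \<Rightarrow> nat. (\<Sum>j\<in>UNIV. s j) = \<alpha> \<longrightarrow>
        \<Phi> (\<lambda>z. (\<Prod>i\<in>UNIV. z $ Inl i ^ m i) * (\<Prod>j\<in>UNIV. z $ Inr j ^ s j))
          = (\<lambda>w. complex_of_real \<kappa> * w $ Inl () ^ \<beta> * (\<Prod>j\<in>UNIV. w $ Inr j ^ s j))
      \<and> \<Phi> (\<lambda>z. (\<Prod>i\<in>UNIV. cnj (z $ Inl i) ^ m i) * (\<Prod>j\<in>UNIV. cnj (z $ Inr j) ^ s j))
          = (\<lambda>w. complex_of_real \<kappa> * cnj (w $ Inl ()) ^ \<beta> * (\<Prod>j\<in>UNIV. cnj (w $ Inr j) ^ s j)))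
     \<comment> \<open>Phi induces an isomorphism R[M_0(A)] -> R[M_0(B)]\<close>
   \<and> (\<forall>f. real_inv_poly A f \<longrightarrow> real_inv_poly B (\<Phi> f))
   \<and> (\<forall>f. real_inv_poly A f \<longrightarrow>
        ((\<forall>z\<in>Zset A. f z = 0) \<longleftrightarrow> (\<forall>w\<in>Zset B. \<Phi> f w = 0)))
   \<and> (\<forall>g. real_inv_poly B g \<longrightarrow> (\<exists>f. real_inv_poly A f \<and> (\<forall>w\<in>Zset B. \<Phi> f w = g w)))
     \<comment> \<open>and a graded regular symplectomorphism whose pull-back on R[M_0(A)] is that isomorphism\<close>
   \<and> (\<exists>F. graded_regular_symplecto B A F
        \<and> (\<forall>f. real_inv_poly A f \<longrightarrow>
             (\<forall>z\<in>Zset A. \<forall>w\<in>Zset B. F (orbit B w) = orbit A z \<longrightarrow> \<Phi> f w = f z)))"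
proof -
  interpret T: type_I a n m \<alpha> \<beta>
    using type_I_typeI[OF apos npos faith] by (simp add: m_def \<alpha>_def \<beta>_def)
  have B: "B = weightB \<alpha> \<beta>" by (simp add: B_def \<alpha>_def \<beta>_def)
  \<comment> \<open>Both sides are nonnegative and have equal squares, because the
    \<open>m i\<close> add up to \<beta>.\<close>
  have \<kappa>: "\<kappa> = (\<Prod>i\<in>UNIV. T.c i ^ m i)"
  proof -
    have "(\<Prod>i\<in>UNIV. T.c i ^ m i)\<^sup>2 = (\<Prod>i\<in>UNIV. ((T.c i)\<^sup>2) ^ m i)"
      by (simp add: prod_power_distrib power_mult[symmetric] mult.commute)
    also have "\<dots> = (\<Prod>i\<in>UNIV. real (m i) ^ m i) / (\<Prod>i\<in>UNIV. real \<beta> ^ m i)"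
      by (simp add: T.c_power2 power_divide prod_dividef)
    also have "(\<Prod>i\<in>UNIV. real \<beta> ^ m i) = real \<beta> ^ \<beta>"
      by (simp add: power_sum[symmetric] T.msum)
    finally have "inverse (real \<beta> ^ \<beta>) * (\<Prod>i\<in>UNIV. real (m i) ^ m i) = (\<Prod>i\<in>UNIV. T.c i ^ m i)\<^sup>2"
      by (simp add: divide_inverse)
    moreover have "0 \<le> (\<Prod>i\<in>UNIV. T.c i ^ m i)"
      using T.c_pos by (intro prod_nonneg) (simp add: less_imp_le)
    ultimately show ?thesis
      by (simp add: \<kappa>_def kappaA_def m_def \<beta>_def)
  qed
  have prod_c: "(\<Prod>i\<in>UNIV. (T.c i *\<^sub>R x) ^ m i) = complex_of_real \<kappa> * x ^ \<beta>" for x :: complex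
    by (simp add: \<kappa> scaleR_conv_of_real power_mult_distrib prod.distrib power_sum[symmetric] T.msum)
  have r: "(T.c i *\<^sub>R x) * cnj (T.c i *\<^sub>R x) = complex_of_real (real (m i) / real \<beta>) * (x * cnj x)" for i x
  proof -
    have "(T.c i *\<^sub>R x) * cnj (T.c i *\<^sub>R x) = complex_of_real ((T.c i)\<^sup>2) * (x * cnj x)"
      by (simp add: scaleR_conv_of_real power2_eq_square mult_ac)
    then show ?thesis by (simp only: T.c_power2)
  qed
  have orbits: "f (T.L w) = f z" if "invariant A f" "orbit A z = orbit A (T.L w)"
    for f :: "complex^('l + 'k) \<Rightarrow> complex" and w z
    using that(2) invariantD[OF that(1)] unfolding orbit_eq_iff by auto
  show ?thesis
  \<comment> \<open>Composition with \<open>L\<close> is defined on all functions, not just on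
    polynomials in the generators, so being well defined and multiplicative is automatic, and the
    values on generators are read off coordinatewise.\<close>
  proof (rule exI[of _ "\<lambda>f w. f (T.L w)"], intro conjI allI impI)
    fix f :: "complex^('l + 'k) \<Rightarrow> complex"
    show "polyfun (\<lambda>w. f (T.L w))" "invariant B (\<lambda>w. f (T.L w))" if "polyfun f \<and> invariant A f"
      using that T.polyfun_L T.invariant_L[of f] by (auto simp: A_def B)
    show "real_inv_poly B (\<lambda>w. f (T.L w))" if "real_inv_poly A f"
      using that T.real_inv_poly_L[of f] by (simp add: A_def B)
    show "(\<forall>z\<in>Zset A. f z = 0) \<longleftrightarrow> (\<forall>w\<in>Zset B. f (T.L w) = 0)" if "real_inv_poly A f"
    proof
      assume "\<forall>z\<in>Zset A. f z = 0"
      then show "\<forall>w\<in>Zset B. f (T.L w) = 0" by (simp add: A_def B T.L_Zset)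
    next
      assume 0: "\<forall>w\<in>Zset B. f (T.L w) = 0"
      show "\<forall>z\<in>Zset A. f z = 0"
      proof
        fix z assume "z \<in> Zset A"
        then obtain w :: "complex^(unit + 'k)" where w: "w \<in> Zset B" "orbit A z = orbit A (T.L w)"
          unfolding A_def B by (rule T.Zset_A_orbit)
        have "invariant A f" using that by (simp add: real_inv_poly_def)
        from orbits[OF this w(2)] show "f z = 0" using 0 w(1) by simp
      qed
    qed
  next
    fix g :: "complex^(unit + 'k) \<Rightarrow> complex" assume g: "real_inv_poly B g"
    show "\<exists>f. real_inv_poly A f \<and> (\<forall>w\<in>Zset B. f (T.L w) = g w)"
    proof (rule T.poly_lifting[of g])
      show "real_inv_poly T.B g" using g by (simp add: B)
      fix f :: "complex^('l + 'k) \<Rightarrow> complex" assume "real_inv_poly T.A f" "\<And>w. f (T.L w) = g w"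
      then show ?thesis unfolding A_def by (intro exI[of _ f]) simp
    qed
  next
    show "\<exists>F. graded_regular_symplecto B A F \<and> (\<forall>f. real_inv_poly A f \<longrightarrow>
        (\<forall>z\<in>Zset A. \<forall>w\<in>Zset B. F (orbit B w) = orbit A z \<longrightarrow> f (T.L w) = f z))"
    proof (intro exI[of _ T.F] conjI allI impI ballI)
      show "graded_regular_symplecto B A T.F"
        unfolding A_def B by (rule T.graded_regular_symplecto_F)
      fix f :: "complex^('l + 'k) \<Rightarrow> complex" and z w
      assume "real_inv_poly A f" "T.F (orbit B w) = orbit A z"
      then show "f (T.L w) = f z"
        using orbits[of f z w] by (simp add: real_inv_poly_def A_def B T.F_orbit)
    qed
  qed (simp_all only: T.L_nth r prod_c prod_c[of "cnj _", unfolded complex_cnj_scaleR[symmetric]])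
qed

end
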